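(* LS Max $c$-Cut can be solved in $O((3e)^k\cdot(\Delta(G)-1)^{k+1}\cdot c\cdot k^3\cdot n)$ time, where $n=|V|$ and $\Delta(G)$ is the maximum degree of the input graph $G$.
   Context: LS Max $c$-Cut: given a graph $G=(V,E)$, $c\in\mathbb{N}$, $\omega:E\to\mathbb{Q}$, a $c$-coloring $\chi:V\to\{1,\dots,c\}$ and $k\in\mathbb{N}$, decide whether there is a $c$-coloring $\chi'$ with $|\{v:\chi(v)\neq\chi'(v)\}|\le k$ and $\omega(E(\chi'))>\omega(E(\chi))$, where $E(\chi)=\{\{u,v\}\in E:\chi(u)\neq\chi(v)\}$ and $\omega(F)$ is total weight; $e$ denotes Euler's number.
   Formalization: The factors Δ(G)−1, c, k and n in the time bound are read as max(1,·), because the printed bound is zero or negative (hence unattainable) e.g. when Δ(G)=1, k=0 or n=0; for Δ(G)≥2 and k≥1 the bound is exactly the printed one. *)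

theory Defs
  imports Complex_Main
begin

section \<open>The problem LS Max c-Cut\<close>

definition simple_graph :: "'a set \<Rightarrow> 'a set set \<Rightarrow> bool" where
  "simple_graph V E \<longleftrightarrow> finite V \<and> (\<forall>e\<in>E. e \<subseteq> V \<and> card e = 2)"

definition degree :: "'a set set \<Rightarrow> 'a \<Rightarrow> nat" where
  "degree E v = card {e \<in> E. v \<in> e}"

text \<open>The maximum degree of the graph without vertices is taken to be 0.\<close>
definition max_degree :: "'a set \<Rightarrow> 'a set set \<Rightarrow> nat" where
  "max_degree V E = Max (insert 0 (degree E ` V))"

definition coloring :: "'a set \<Rightarrow> nat \<Rightarrow> ('a \<Rightarrow> nat) \<Rightarrow> bool" where
  "coloring V c \<chi> \<longleftrightarrow> (\<forall>v\<in>V. \<chi> v \<in> {1..c})"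

definition cut_edges :: "'a set set \<Rightarrow> ('a \<Rightarrow> nat) \<Rightarrow> 'a set set" where
  "cut_edges E \<chi> = {{u, v} |u v. {u, v} \<in> E \<and> \<chi> u \<noteq> \<chi> v}"

definition weight :: "('a set \<Rightarrow> rat) \<Rightarrow> 'a set set \<Rightarrow> rat" where
  "weight \<omega> F = (\<Sum>e\<in>F. \<omega> e)"

definition LS_Max_Cut ::
  "'a set \<Rightarrow> 'a set set \<Rightarrow> ('a set \<Rightarrow> rat) \<Rightarrow> nat \<Rightarrow> ('a \<Rightarrow> nat) \<Rightarrow> nat \<Rightarrow> bool" where
  "LS_Max_Cut V E \<omega> c \<chi> k \<longleftrightarrow>
    (\<exists>\<chi>'. coloring V c \<chi>' \<and>
          card {v \<in> V. \<chi> v \<noteq> \<chi>' v} \<le> k \<and>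
          weight \<omega> (cut_edges E \<chi>') > weight \<omega> (cut_edges E \<chi>))"

section \<open>The machine model\<close>

text \<open>
  A random access machine programmed in a structured language. The memory consists of
  named registers and named, unboundedly long arrays, holding either natural numbers or
  rationals (the latter for edge weights). The primitive operations, each of unit cost, are
  constants, register and (indirectly addressed) array access, addition, subtraction (truncated
  on natural numbers), comparison and the Boolean connectives. Multiplication and division are
  deliberately absent: together with unbounded numbers they would make the unit-cost measure
  unrealistically powerful. A program mentions only finitely many registers and arrays.
\<close>

type_synonym name = string

record mem =
  nreg :: "name \<Rightarrow> nat"
  narr :: "name \<Rightarrow> nat \<Rightarrow> nat"
  rreg :: "name \<Rightarrow> rat"
  rarr :: "name \<Rightarrow> nat \<Rightarrow> rat"

datatype nexp = NConst nat | NReg name | NArr name nexp | NAdd nexp nexp | NSub nexp nexp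

datatype rexp = RConst rat | RReg name | RArr name nexp | RAdd rexp rexp | RSub rexp rexp

datatype bexp = NLess nexp nexp | NEq nexp nexp | RLess rexp rexp | REq rexp rexp
  | BNot bexp | BAnd bexp bexp

fun nval :: "nexp \<Rightarrow> mem \<Rightarrow> nat" where
  "nval (NConst a) m = a"
| "nval (NReg x) m = nreg m x"
| "nval (NArr x i) m = narr m x (nval i m)"
| "nval (NAdd a b) m = nval a m + nval b m"
| "nval (NSub a b) m = nval a m - nval b m"

fun rval :: "rexp \<Rightarrow> mem \<Rightarrow> rat" where
  "rval (RConst a) m = a"
| "rval (RReg x) m = rreg m x"
| "rval (RArr x i) m = rarr m x (nval i m)"
| "rval (RAdd a b) m = rval a m + rval b m"
| "rval (RSub a b) m = rval a m - rval b m"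

fun bval :: "bexp \<Rightarrow> mem \<Rightarrow> bool" where
  "bval (NLess a b) m \<longleftrightarrow> nval a m < nval b m"
| "bval (NEq a b) m \<longleftrightarrow> nval a m = nval b m"
| "bval (RLess a b) m \<longleftrightarrow> rval a m < rval b m"
| "bval (REq a b) m \<longleftrightarrow> rval a m = rval b m"
| "bval (BNot p) m \<longleftrightarrow> \<not> bval p m"
| "bval (BAnd p q) m \<longleftrightarrow> bval p m \<and> bval q m"

fun ncost :: "nexp \<Rightarrow> nat" where
  "ncost (NConst a) = 1"
| "ncost (NReg x) = 1"
| "ncost (NArr x i) = ncost i + 1"
| "ncost (NAdd a b) = ncost a + ncost b + 1"
| "ncost (NSub a b) = ncost a + ncost b + 1"

fun rcost :: "rexp \<Rightarrow> nat" where
  "rcost (RConst a) = 1"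
| "rcost (RReg x) = 1"
| "rcost (RArr x i) = ncost i + 1"
| "rcost (RAdd a b) = rcost a + rcost b + 1"
| "rcost (RSub a b) = rcost a + rcost b + 1"

fun bcost :: "bexp \<Rightarrow> nat" where
  "bcost (NLess a b) = ncost a + ncost b + 1"
| "bcost (NEq a b) = ncost a + ncost b + 1"
| "bcost (RLess a b) = rcost a + rcost b + 1"
| "bcost (REq a b) = rcost a + rcost b + 1"
| "bcost (BNot p) = bcost p + 1"
| "bcost (BAnd p q) = bcost p + bcost q + 1"

datatype com =
    Skip
  | SetN name nexp
  | SetNArr name nexp nexp
  | SetR name rexp
  | SetRArr name nexp rexp
  | Seq com com
  | Cond bexp com com
  | While bexp com

text \<open>\<open>exec P m t m'\<close>: started in memory \<open>m\<close>, the program \<open>P\<close> halts after exactly \<open>t\<close>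
  steps in memory \<open>m'\<close>.\<close>
inductive exec :: "com \<Rightarrow> mem \<Rightarrow> nat \<Rightarrow> mem \<Rightarrow> bool" where
  Skip: "exec Skip m 1 m"
| SetN: "exec (SetN x a) m (ncost a + 1) (m\<lparr>nreg := (nreg m)(x := nval a m)\<rparr>)"
| SetNArr: "exec (SetNArr x i a) m (ncost i + ncost a + 1)
    (m\<lparr>narr := (narr m)(x := (narr m x)(nval i m := nval a m))\<rparr>)"
| SetR: "exec (SetR x a) m (rcost a + 1) (m\<lparr>rreg := (rreg m)(x := rval a m)\<rparr>)"
| SetRArr: "exec (SetRArr x i a) m (ncost i + rcost a + 1)
    (m\<lparr>rarr := (rarr m)(x := (rarr m x)(nval i m := rval a m))\<rparr>)"
| Seq: "exec P m t m' \<Longrightarrow> exec Q m' t' m'' \<Longrightarrow> exec (Seq P Q) m (t + t') m''"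
| CondTrue: "bval b m \<Longrightarrow> exec P m t m' \<Longrightarrow> exec (Cond b P Q) m (bcost b + 1 + t) m'"
| CondFalse: "\<not> bval b m \<Longrightarrow> exec Q m t m' \<Longrightarrow> exec (Cond b P Q) m (bcost b + 1 + t) m'"
| WhileFalse: "\<not> bval b m \<Longrightarrow> exec (While b P) m (bcost b + 1) m"
| WhileTrue: "bval b m \<Longrightarrow> exec P m t m' \<Longrightarrow> exec (While b P) m' t' m'' \<Longrightarrow>
    exec (While b P) m (bcost b + 1 + t + t') m''"

inductive_cases SkipE: "exec Skip m t m'"
inductive_cases SetNE: "exec (SetN x a) m t m'"
inductive_cases SetNArrE: "exec (SetNArr x i a) m t m'"
inductive_cases SetRE: "exec (SetR x a) m t m'"
inductive_cases SetRArrE: "exec (SetRArr x i a) m t m'"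
inductive_cases SeqE: "exec (Seq P Q) m t m'"
inductive_cases CondE: "exec (Cond b P Q) m t m'"
inductive_cases WhileE: "exec (While b P) m t m'"

lemma exec_deterministic:
  "exec P m t m' \<Longrightarrow> exec P m t2 m2 \<Longrightarrow> t2 = t \<and> m2 = m'"
proof (induction arbitrary: t2 m2 rule: exec.induct)
  case (Skip m)
  from Skip.prems show ?case by (rule SkipE) simp
next
  case (SetN x a m)
  from SetN.prems show ?case by (rule SetNE) simp
next
  case (SetNArr x i a m)
  from SetNArr.prems show ?case by (rule SetNArrE) simp
next
  case (SetR x a m)
  from SetR.prems show ?case by (rule SetRE) simp
next
  case (SetRArr x i a m)
  from SetRArr.prems show ?case by (rule SetRArrE) simp
next
  case (Seq P m t m' Q t' m'')
  from Seq.prems show ?case by (rule SeqE) (metis Seq.IH)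
next
  case (CondTrue b m P t m' Q)
  from CondTrue.prems show ?case by (rule CondE) (use CondTrue.IH CondTrue.hyps(1) in fastforce)+
next
  case (CondFalse b m Q t m' P)
  from CondFalse.prems show ?case by (rule CondE) (use CondFalse.IH CondFalse.hyps(1) in fastforce)+
next
  case (WhileFalse b m P)
  from WhileFalse.prems show ?case by (rule WhileE) (simp_all add: WhileFalse.hyps)
next
  case (WhileTrue b m P t m' t' m'')
  from WhileTrue.prems show ?case by (rule WhileE) (use WhileTrue.IH WhileTrue.hyps(1) in fastforce)+
qed

section \<open>Encoding of instances\<close>

text \<open>The graph has vertex set \<open>{..<n}\<close> and is presented by adjacency lists, in any order.\<close>
definition adjacency_lists :: "nat \<Rightarrow> nat set set \<Rightarrow> (nat \<Rightarrow> nat list) \<Rightarrow> bool" where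
  "adjacency_lists n E nbrs \<longleftrightarrow>
    (\<forall>v<n. distinct (nbrs v) \<and> set (nbrs v) = {u. {v, u} \<in> E})"

definition list_to_array :: "'a::zero list \<Rightarrow> nat \<Rightarrow> 'a" where
  "list_to_array xs i = (if i < length xs then xs ! i else 0)"

text \<open>The adjacency lists are stored consecutively in the array \<open>adj\<close>, that of \<open>v\<close> occupying
  the positions from \<open>off[v]\<close> up to but excluding \<open>off[v+1]\<close>; \<open>wt\<close> holds the weights of the
  corresponding edges at the same positions. All other cells are initially 0.\<close>
definition input_mem ::
  "nat \<Rightarrow> (nat \<Rightarrow> nat list) \<Rightarrow> (nat set \<Rightarrow> rat) \<Rightarrow> nat \<Rightarrow> (nat \<Rightarrow> nat) \<Rightarrow> nat \<Rightarrow> mem" where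
  "input_mem n nbrs \<omega> c \<chi> k = \<lparr>
     nreg = (\<lambda>_. 0)(''n'' := n, ''c'' := c, ''k'' := k),
     narr = (\<lambda>_ _. 0)(
       ''off'' := list_to_array (map (\<lambda>v. \<Sum>u<v. length (nbrs u)) [0..<n + 1]),
       ''adj'' := list_to_array (concat (map nbrs [0..<n])),
       ''col'' := list_to_array (map \<chi> [0..<n])),
     rreg = (\<lambda>_. 0),
     rarr = (\<lambda>_ _. 0)(
       ''wt'' := list_to_array (concat (map (\<lambda>v. map (\<lambda>u. \<omega> {v, u}) (nbrs v)) [0..<n])))\<rparr>"

text \<open>The answer is left in the register \<open>res\<close>.\<close>
definition decides_within ::
  "com \<Rightarrow> mem \<Rightarrow> bool \<Rightarrow> real \<Rightarrow> bool" where
  "decides_within P m answer T \<longleftrightarrow>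
    (\<exists>t m'. exec P m t m' \<and> real t \<le> T \<and> nreg m' ''res'' = (if answer then 1 else 0))"

end

theory Submission
  imports Defs "HOL-Library.Nat_Bijection"
begin

text \<open>
  An improving colouring at minimal distance from \<open>\<chi>\<close> changes a connected vertex set \<open>S\<close>, because the
  gain is additive over parts of the changed set that are not joined by edges. Write
  \<open>D = max 1 (\<Delta> - 1)\<close>.

  Connected sets of size \<open>s\<close> containing a root \<open>v\<close> are explored with a queue that starts as \<open>[v]\<close>;
  selecting an entry appends all its neighbours except the vertex through which it was
  reached. A set is thus described by an increasing sequence of queue positions. The first one is 0
  and the others are at most \<open>D(s-1)+1\<close>, so there are at most \<open>(D(s-1)+1 choose s-1) \<le> 2 (e D)^(s-1)\<close> sequences.

  For a fixed \<open>S\<close>, the least weight of monochromatic edges touching \<open>S\<close> is found by dynamic programming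
  over the colours: an optimal colouring of \<open>A \<subseteq> S\<close> with the colours \<open>1..i\<close> uses the colour \<open>i\<close> on \<open>A - C\<close> and
  \<open>1..i-1\<close> on some \<open>C \<subseteq> A\<close>, and there are \<open>3^s\<close> such pairs \<open>(A, C)\<close>.
\<close>

section \<open>A weakest-precondition calculus with running time\<close>

text \<open>Passing to the complement turns maximising the cut into minimising monochromatic weight.
  That weight is a sum over colour classes, which is why colours can be treated one after another.
  The vertex through which an entry was reached is left out because this lowers the growth per
  selection from \<open>D + 1\<close> to \<open>D\<close>; only the root contributes one more.
  Summing \<open>(e * D) ^ (s - 1) * 3 ^ s\<close> over \<open>s\<close> is geometric and leaves
  \<open>D ^ k\<close>. The further factors come from one evaluation: for each colour and each pair
  of selected vertices it scans an adjacency list, which gives \<open>D\<close>, \<open>c\<close>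
  and \<open>k\<^sup>2\<close>. Multiplication is not a machine operation, so powers and all pairs
  \<open>(A, C)\<close> are tabulated beforehand by additions. No work proportional to the number of
  vertices may be spent on a single set: labels and queue are maintained incrementally, and a
  selection is undone in constant time. Since the queue is rescanned after backtracking, the cost of
  the search is amortised over the sequences still to be visited.\<close>

datatype loc = NR name | NA name | RR name | RA name

fun writes :: "com \<Rightarrow> loc set" where
  "writes Skip = {}"
| "writes (SetN x a) = {NR x}"
| "writes (SetNArr x i a) = {NA x}"
| "writes (SetR x a) = {RR x}"
| "writes (SetRArr x i a) = {RA x}"
| "writes (Seq P Q) = writes P \<union> writes Q"
| "writes (Cond b P Q) = writes P \<union> writes Q"
| "writes (While b P) = writes P"

definition same :: "loc set \<Rightarrow> mem \<Rightarrow> mem \<Rightarrow> bool" where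
  "same X m m' \<longleftrightarrow>
    (\<forall>x. NR x \<notin> X \<longrightarrow> nreg m' x = nreg m x) \<and> (\<forall>x. NA x \<notin> X \<longrightarrow> narr m' x = narr m x) \<and>
    (\<forall>x. RR x \<notin> X \<longrightarrow> rreg m' x = rreg m x) \<and> (\<forall>x. RA x \<notin> X \<longrightarrow> rarr m' x = rarr m x)"

lemma same_trans: "same X m m' \<Longrightarrow> same X m' m'' \<Longrightarrow> same X m m''"
  by (simp add: same_def)

lemma same_narr: "same X m m' \<Longrightarrow> NA x \<notin> X \<Longrightarrow> narr m' x = narr m x"
  by (simp add: same_def)

lemma same_mono: "same X m m' \<Longrightarrow> X \<subseteq> Y \<Longrightarrow> same Y m m'"
  unfolding same_def by blast

lemma exec_same: "exec P m t m' \<Longrightarrow> same (writes P) m m'"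
proof (induction rule: exec.induct)
  case (Seq P m t m' Q t' m'')
  then show ?case by (auto simp: same_def)
next
  case (WhileTrue b m P t m' t' m'')
  then show ?case by (auto simp: same_def)
qed (auto simp: same_def)

definition wp :: "com \<Rightarrow> (nat \<Rightarrow> mem \<Rightarrow> bool) \<Rightarrow> mem \<Rightarrow> bool" where
  "wp P Q m \<longleftrightarrow> (\<exists>t m'. exec P m t m' \<and> Q t m')"

lemma wp_Skip: "wp Skip Q m = Q 1 m"
  unfolding wp_def by (metis SkipE exec.Skip)

lemma wp_SetN: "wp (SetN x a) Q m = Q (ncost a + 1) (m\<lparr>nreg := (nreg m)(x := nval a m)\<rparr>)"
  unfolding wp_def by (metis SetNE exec.SetN)

lemma wp_SetNArr: "wp (SetNArr x i a) Q m = Q (ncost i + ncost a + 1)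
    (m\<lparr>narr := (narr m)(x := (narr m x)(nval i m := nval a m))\<rparr>)"
  unfolding wp_def by (metis SetNArrE exec.SetNArr)

lemma wp_SetR: "wp (SetR x a) Q m = Q (rcost a + 1) (m\<lparr>rreg := (rreg m)(x := rval a m)\<rparr>)"
  unfolding wp_def by (metis SetRE exec.SetR)

lemma wp_SetRArr: "wp (SetRArr x i a) Q m = Q (ncost i + rcost a + 1)
    (m\<lparr>rarr := (rarr m)(x := (rarr m x)(nval i m := rval a m))\<rparr>)"
  unfolding wp_def by (metis SetRArrE exec.SetRArr)

lemma wp_Seq: "wp (Seq P R) Q m = wp P (\<lambda>t m'. wp R (\<lambda>t'. Q (t + t')) m') m"
  unfolding wp_def by (auto intro: exec.Seq elim!: SeqE)

lemma wp_Cond: "wp (Cond b P R) Q m =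
    (if bval b m then wp P (\<lambda>t. Q (bcost b + 1 + t)) m else wp R (\<lambda>t. Q (bcost b + 1 + t)) m)"
  unfolding wp_def
  by (auto elim!: CondE) (metis (no_types, lifting) CondTrue CondFalse add_Suc Suc_eq_plus1)+

text \<open>The frame fact \<open>same (writes P) m m'\<close> is read off the syntax of
  \<open>P\<close>, so specifications can concentrate on what a program changes.\<close>

lemma wp_mono: "wp P Q m \<Longrightarrow> (\<And>t m'. Q t m' \<Longrightarrow> same (writes P) m m' \<Longrightarrow> Q' t m') \<Longrightarrow> wp P Q' m"
  unfolding wp_def using exec_same by blast

text \<open>Amortised analysis: \<open>a\<close> is a ghost state tied to the memory by
  \<open>I\<close>, and a drop of \<open>\<Phi>\<close> pays for the body and the test. As the test
  alone costs a step, \<open>\<Phi>\<close> decreases strictly and the loop terminates.\<close>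

lemma wp_While:
  fixes \<Phi> :: "'s \<Rightarrow> nat"
  assumes "I a m"
    and "\<And>a m. I a m \<Longrightarrow> bval b m \<Longrightarrow>
      wp P (\<lambda>t m'. \<exists>a'. I a' m' \<and> \<Phi> a' + t + bcost b + 1 \<le> \<Phi> a) m"
  shows "wp (While b P) (\<lambda>t m'. \<exists>a'. I a' m' \<and> \<not> bval b m' \<and> t \<le> \<Phi> a + bcost b + 1) m"
  using assms(1)
proof (induction "\<Phi> a" arbitrary: a m rule: less_induct)
  case less
  show ?case
  proof (cases "bval b m")
    case False
    with less.prems show ?thesis
      unfolding wp_def by (blast intro: WhileFalse trans_le_add2 le_refl order_trans[rotated] add_mono)
  next
    case True
    from assms(2)[OF less.prems True] obtain t m' a' where
      *: "exec P m t m'" "I a' m'" "\<Phi> a' + t + bcost b + 1 \<le> \<Phi> a"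
      unfolding wp_def by blast
    from *(3) have "\<Phi> a' < \<Phi> a" by simp
    from less.hyps[OF this *(2)] obtain t' m'' a'' where
      **: "exec (While b P) m' t' m''" "I a'' m''" "\<not> bval b m''" "t' \<le> \<Phi> a' + bcost b + 1"
      unfolding wp_def by blast
    have "exec (While b P) m (bcost b + 1 + t + t') m''"
      using WhileTrue[OF True *(1) **(1)] .
    moreover have "bcost b + 1 + t + t' \<le> \<Phi> a + bcost b + 1" using *(3) **(4) by linarith
    ultimately show ?thesis unfolding wp_def using **(2,3) by blast
  qed
qed

abbreviation seq :: "com \<Rightarrow> com \<Rightarrow> com" (infixr ";;" 60) where
  "P ;; Q \<equiv> Seq P Q"

definition For :: "name \<Rightarrow> nexp \<Rightarrow> nexp \<Rightarrow> com \<Rightarrow> com" where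
  "For i lo hi P = Seq (SetN i lo)
     (While (NLess (NReg i) hi) (Seq P (SetN i (NAdd (NReg i) (NConst 1)))))"

lemma writes_For: "writes (For i lo hi P) = insert (NR i) (writes P)"
  by (auto simp: For_def)

text \<open>The upper bound is an expression evaluated anew at each test, hence the hypothesis that
  it keeps the value \<open>h\<close>. The 7 per round consists of 4 for the increment and, besides
  \<open>ncost hi\<close>, 3 for the test.\<close>

lemma wp_For:
  assumes init: "I (nval lo m) (m\<lparr>nreg := (nreg m)(i := nval lo m)\<rparr>)"
    and hi: "\<And>j m'. I j m' \<Longrightarrow> nval lo m \<le> j \<Longrightarrow> j \<le> h \<Longrightarrow> same (insert (NR i) (writes P)) m m' \<Longrightarrow>
      nreg m' i = j \<Longrightarrow> nval hi m' = h"
    and le: "nval lo m \<le> h"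
    and step: "\<And>j m'. I j m' \<Longrightarrow> nval lo m \<le> j \<Longrightarrow> j < h \<Longrightarrow> same (insert (NR i) (writes P)) m m' \<Longrightarrow>
      nreg m' i = j \<Longrightarrow>
      wp P (\<lambda>t m''. t \<le> T \<and> nreg m'' i = j \<and> I (Suc j) (m''\<lparr>nreg := (nreg m'')(i := Suc j)\<rparr>)) m'"
    and post: "\<And>t m'. I h m' \<Longrightarrow> nreg m' i = h \<Longrightarrow> same (insert (NR i) (writes P)) m m' \<Longrightarrow>
      t \<le> (h - nval lo m) * (T + ncost hi + 7) + (ncost lo + ncost hi + 4) \<Longrightarrow> Q t m'"
  shows "wp (For i lo hi P) Q m"
proof -
  let ?X = "insert (NR i) (writes P)"
  let ?J = "\<lambda>j m'. I j m' \<and> nval lo m \<le> j \<and> j \<le> h \<and> same ?X m m' \<and> nreg m' i = j"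
  let ?b = "NLess (NReg i) hi"
  let ?m = "m\<lparr>nreg := (nreg m)(i := nval lo m)\<rparr>"
  have "wp (While ?b (Seq P (SetN i (NAdd (NReg i) (NConst 1)))))
    (\<lambda>t m'. \<exists>j. ?J j m' \<and> \<not> bval ?b m' \<and>
       t \<le> (h - nval lo m) * (T + ncost hi + 7) + bcost ?b + 1) ?m"
  proof (rule wp_While[where I = ?J and \<Phi> = "\<lambda>j. (h - j) * (T + ncost hi + 7)"])
    show "?J (nval lo m) ?m" using init le by (simp add: same_def)
  next
    fix j m' assume J: "?J j m'" and b: "bval ?b m'"
    then have jh: "j < h" using hi by auto
    have "wp P (\<lambda>t m''. t \<le> T \<and> nreg m'' i = j \<and> I (Suc j) (m''\<lparr>nreg := (nreg m'')(i := Suc j)\<rparr>)) m'"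
      using J jh by (intro step) auto
    then show "wp (Seq P (SetN i (NAdd (NReg i) (NConst 1))))
      (\<lambda>t m''. \<exists>j'. ?J j' m'' \<and>
         (h - j') * (T + ncost hi + 7) + t + bcost ?b + 1 \<le> (h - j) * (T + ncost hi + 7)) m'"
      unfolding wp_Seq
    proof (rule wp_mono)
      fix t m''
      assume *: "t \<le> T \<and> nreg m'' i = j \<and> I (Suc j) (m''\<lparr>nreg := (nreg m'')(i := Suc j)\<rparr>)"
        and s: "same (writes P) m' m''"
      have "same ?X m m''" using J s by (meson same_mono same_trans subset_insertI)
      then have s': "same ?X m (m''\<lparr>nreg := (nreg m'')(i := Suc j)\<rparr>)" by (simp add: same_def)
      have "h - j = Suc (h - Suc j)" using jh by simp
      then have "(h - j) * (T + ncost hi + 7) = (h - Suc j) * (T + ncost hi + 7) + (T + ncost hi + 7)"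
        by simp
      then show "wp (SetN i (NAdd (NReg i) (NConst 1))) (\<lambda>t' m''. \<exists>j'. ?J j' m'' \<and>
         (h - j') * (T + ncost hi + 7) + (t + t') + bcost ?b + 1 \<le> (h - j) * (T + ncost hi + 7)) m''"
        using * s' jh J by (auto simp: wp_SetN intro!: exI[of _ "Suc j"])
    qed
  qed
  then show ?thesis
    unfolding For_def wp_Seq wp_SetN
  proof (rule wp_mono)
    fix t m'
    assume "\<exists>j. ?J j m' \<and> \<not> bval ?b m' \<and> t \<le> (h - nval lo m) * (T + ncost hi + 7) + bcost ?b + 1"
    then obtain j where J: "?J j m'" and nb: "\<not> bval ?b m'"
      and t: "t \<le> (h - nval lo m) * (T + ncost hi + 7) + bcost ?b + 1" by blast
    then have "j = h" using hi[of j m'] by auto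
    then show "Q (ncost lo + 1 + t) m'" using J t by (intro post) auto
  qed
qed

lemmas wp_simps = wp_Skip wp_SetN wp_SetNArr wp_SetR wp_SetRArr wp_Seq wp_Cond

section \<open>Monochromatic weight of a recoloured set\<close>

text \<open>Vertices of the recoloured set are named by positions: \<open>a i j\<close> is what
  \<open>j\<close> pays towards outside vertices of colour \<open>i\<close>, and
  \<open>b j l\<close> is the weight of an inner edge. The condition \<open>l < j\<close> counts
  each inner edge once.\<close>

definition mono_cost :: "(nat \<Rightarrow> nat \<Rightarrow> rat) \<Rightarrow> (nat \<Rightarrow> nat \<Rightarrow> rat) \<Rightarrow> (nat \<Rightarrow> nat) \<Rightarrow> nat set \<Rightarrow> rat" where
  "mono_cost a b f A = (\<Sum>j\<in>A. a (f j) j + (\<Sum>l | l \<in> A \<and> l < j \<and> f l = f j. b j l))"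

lemma mono_cost_cong:
  assumes "\<And>j. j \<in> A \<Longrightarrow> f j = g j"
  shows "mono_cost a b f A = mono_cost a b g A"
  unfolding mono_cost_def using assms by (intro sum.cong arg_cong2[where f = "(+)"]) auto

lemma mono_cost_empty [simp]: "mono_cost a b f {} = 0"
  by (simp add: mono_cost_def)

text \<open>Vertices of different colours share no term. This is both the recurrence of the dynamic
  program and the way the original weight is accumulated colour by colour.\<close>

lemma mono_cost_split_colour:
  assumes "finite A" "B = {j \<in> A. f j = i}"
  shows "mono_cost a b f A = mono_cost a b f (A - B) + mono_cost a b (\<lambda>_. i) B"
proof -
  let ?g = "\<lambda>A j. a (f j) j + (\<Sum>l | l \<in> A \<and> l < j \<and> f l = f j. b j l)"
  have "mono_cost a b f A = (\<Sum>j\<in>A - B. ?g A j) + (\<Sum>j\<in>B. ?g A j)"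
    unfolding mono_cost_def using assms by (subst sum.subset_diff[of B A]) auto
  also have "(\<Sum>j\<in>A - B. ?g A j) = mono_cost a b f (A - B)"
    unfolding mono_cost_def using assms
    by (intro sum.cong arg_cong2[where f = "(+)"]) auto
  also have "(\<Sum>j\<in>B. ?g A j) = mono_cost a b (\<lambda>_. i) B"
    unfolding mono_cost_def using assms
    by (intro sum.cong arg_cong2[where f = "(+)"]) auto
  finally show ?thesis .
qed

text \<open>Since \<open>j\<close> exceeds all of \<open>A\<close>, it is never the smaller partner
  of an old position and the old terms are unaffected. For this reason sets and tables are grown by
  their largest element.\<close>

lemma mono_cost_insert:
  assumes "A \<subseteq> {..<j}"
  shows "mono_cost a b f (insert j A) =
    mono_cost a b f A + (a (f j) j + (\<Sum>l | l \<in> A \<and> f l = f j. b j l))"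
proof -
  have fin: "finite A" and j: "j \<notin> A" using assms finite_subset by auto
  have "(\<Sum>i\<in>A. a (f i) i + (\<Sum>l | l \<in> insert j A \<and> l < i \<and> f l = f i. b i l)) = mono_cost a b f A"
    unfolding mono_cost_def using assms
    by (intro sum.cong arg_cong2[where f = "(+)"]) auto
  moreover have "{l. l \<in> insert j A \<and> l < j \<and> f l = f j} = {l. l \<in> A \<and> f l = f j}"
    using assms by auto
  ultimately show ?thesis
    unfolding mono_cost_def[of a b f "insert j A"] using fin j by (simp add: add.commute)
qed

definition monochromatic :: "('a \<Rightarrow> nat) \<Rightarrow> 'a set \<Rightarrow> bool" where
  "monochromatic \<psi> e \<longleftrightarrow> (\<forall>u\<in>e. \<forall>v\<in>e. \<psi> u = \<psi> v)"

lemma monochromatic_pair [simp]: "monochromatic \<psi> {u, v} \<longleftrightarrow> \<psi> u = \<psi> v"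
  by (auto simp: monochromatic_def)

lemma monochromatic_cong: "(\<And>u. u \<in> e \<Longrightarrow> \<psi> u = \<phi> u) \<Longrightarrow> monochromatic \<psi> e = monochromatic \<phi> e"
  by (simp add: monochromatic_def)

section \<open>Cut weight through monochromatic edges\<close>

locale cut_instance =
  fixes n :: nat and E :: "nat set set" and nbrs :: "nat \<Rightarrow> nat list"
    and \<omega> :: "nat set \<Rightarrow> rat" and c :: nat and \<chi> :: "nat \<Rightarrow> nat" and k :: nat
  assumes graph: "simple_graph {..<n} E"
    and adjacency: "adjacency_lists n E nbrs"
    and colour: "coloring {..<n} c \<chi>"
begin

lemma finite_E: "finite E"
  using graph unfolding simple_graph_def by (auto intro: finite_subset[of E "Pow {..<n}"])

lemma edgeE:
  assumes "e \<in> E"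
  obtains u v where "e = {u, v}" "u \<noteq> v" "u < n" "v < n"
proof -
  from assms graph have "e \<subseteq> {..<n}" "card e = 2" unfolding simple_graph_def by auto
  then show thesis using that by (auto simp: card_2_iff)
qed

lemma edge_pairD: "{u, v} \<in> E \<Longrightarrow> u \<noteq> v \<and> u < n \<and> v < n"
  by (erule edgeE) (auto simp: doubleton_eq_iff)

lemma set_nbrs: "v < n \<Longrightarrow> set (nbrs v) = {u. {v, u} \<in> E}"
  and distinct_nbrs: "v < n \<Longrightarrow> distinct (nbrs v)"
  using adjacency unfolding adjacency_lists_def by auto

lemma nbrs_less: "v < n \<Longrightarrow> u \<in> set (nbrs v) \<Longrightarrow> u < n \<and> u \<noteq> v"
  using set_nbrs edge_pairD by blast

lemma colour_bounds: "v < n \<Longrightarrow> 1 \<le> \<chi> v \<and> \<chi> v \<le> c"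
  using colour unfolding coloring_def by auto

definition mono_weight :: "(nat \<Rightarrow> nat) \<Rightarrow> nat set \<Rightarrow> rat" where
  "mono_weight \<psi> U = (\<Sum>e | e \<in> E \<and> e \<subseteq> U \<and> monochromatic \<psi> e. \<omega> e)"

lemma weight_cut_edges: "weight \<omega> (cut_edges E \<psi>) = weight \<omega> E - mono_weight \<psi> {..<n}"
proof -
  have "cut_edges E \<psi> = E - {e. e \<in> E \<and> e \<subseteq> {..<n} \<and> monochromatic \<psi> e}"
  proof (intro subset_antisym subsetI)
    fix e assume "e \<in> cut_edges E \<psi>"
    then show "e \<in> E - {e. e \<in> E \<and> e \<subseteq> {..<n} \<and> monochromatic \<psi> e}"
      unfolding cut_edges_def by auto
  next
    fix e assume e: "e \<in> E - {e. e \<in> E \<and> e \<subseteq> {..<n} \<and> monochromatic \<psi> e}"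
    then obtain u v where "e = {u, v}" "u < n" "v < n" by (auto elim: edgeE)
    then show "e \<in> cut_edges E \<psi>" using e unfolding cut_edges_def by auto
  qed
  then show ?thesis
    unfolding weight_def mono_weight_def using finite_E
    by (simp add: sum_diff)
qed

lemma mono_weight_insert:
  assumes "x \<notin> U"
  shows "mono_weight \<psi> (insert x U) =
    mono_weight \<psi> U + (\<Sum>u | u \<in> U \<and> {x, u} \<in> E \<and> \<psi> u = \<psi> x. \<omega> {x, u})"
proof -
  let ?A = "{e. e \<in> E \<and> e \<subseteq> U \<and> monochromatic \<psi> e}"
  let ?N = "{u. u \<in> U \<and> {x, u} \<in> E \<and> \<psi> u = \<psi> x}"
  let ?B = "(\<lambda>u. {x, u}) ` ?N"
  have "{e. e \<in> E \<and> e \<subseteq> insert x U \<and> monochromatic \<psi> e} = ?A \<union> ?B"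
  proof (intro subset_antisym subsetI)
    fix e assume "e \<in> {e. e \<in> E \<and> e \<subseteq> insert x U \<and> monochromatic \<psi> e}"
    then have e: "e \<in> E" "e \<subseteq> insert x U" "monochromatic \<psi> e" by auto
    from e(1) obtain u v where uv: "e = {u, v}" "u \<noteq> v" by (rule edgeE)
    show "e \<in> ?A \<union> ?B"
      using e uv by (cases "u = x"; cases "v = x") (auto simp: insert_commute)
  next
    fix e assume "e \<in> ?A \<union> ?B"
    then show "e \<in> {e. e \<in> E \<and> e \<subseteq> insert x U \<and> monochromatic \<psi> e}" by auto
  qed
  moreover have "?A \<inter> ?B = {}" using assms by auto
  moreover have "finite ?A" using finite_E by auto
  moreover have inj: "inj_on (\<lambda>u. {x, u}) ?N"
    by (auto simp: inj_on_def doubleton_eq_iff)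
  moreover have "finite ?B" using finite_E by (rule finite_subset[rotated]) auto
  ultimately show ?thesis
    unfolding mono_weight_def by (simp add: sum.union_disjoint sum.reindex)
qed

definition ext_weight :: "nat list \<Rightarrow> nat \<Rightarrow> nat \<Rightarrow> rat" where
  "ext_weight ss i j =
    (\<Sum>u | u \<in> set (nbrs (ss ! j)) \<and> u \<notin> set ss \<and> \<chi> u = i. \<omega> {ss ! j, u})"

definition int_weight :: "nat list \<Rightarrow> nat \<Rightarrow> nat \<Rightarrow> rat" where
  "int_weight ss j l = (if {ss ! j, ss ! l} \<in> E then \<omega> {ss ! j, ss ! l} else 0)"

abbreviation "touch_cost ss \<equiv> mono_cost (ext_weight ss) (int_weight ss)"

text \<open>The vertices of \<open>ss\<close> are added to the complement one at a time. A neighbour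
  already present is either outside \<open>ss\<close>, where the colour is still
  \<open>\<chi>\<close>, or an earlier entry of \<open>ss\<close>; these give the two kinds of
  terms. The first summand is independent of \<open>\<psi>\<close>, so recolourings are compared by
  \<open>touch_cost\<close> alone.\<close>

lemma mono_weight_decompose:
  assumes ss: "distinct ss" "set ss \<subseteq> {..<n}"
    and \<psi>: "\<And>u. u < n \<Longrightarrow> u \<notin> set ss \<Longrightarrow> \<psi> u = \<chi> u"
  shows "mono_weight \<psi> {..<n} =
    mono_weight \<chi> ({..<n} - set ss) + touch_cost ss (\<lambda>j. \<psi> (ss ! j)) {..<length ss}"
proof -
  let ?f = "\<lambda>j. \<psi> (ss ! j)"
  let ?U = "\<lambda>t. ({..<n} - set ss) \<union> (\<lambda>j. ss ! j) ` {..<t}"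
  have "mono_weight \<psi> (?U t) = mono_weight \<chi> ({..<n} - set ss) + touch_cost ss ?f {..<t}"
    if "t \<le> length ss" for t
    using that
  proof (induction t)
    case 0
    have "{e. e \<in> E \<and> e \<subseteq> {..<n} - set ss \<and> monochromatic \<psi> e} =
      {e. e \<in> E \<and> e \<subseteq> {..<n} - set ss \<and> monochromatic \<chi> e}"
      using \<psi> by (intro Collect_cong conj_cong refl monochromatic_cong) auto
    then show ?case by (simp add: mono_weight_def)
  next
    case (Suc t)
    let ?x = "ss ! t"
    from Suc.prems have t: "t < length ss" by simp
    have xn: "?x < n" "?x \<in> set ss" using nth_mem[OF t] ss(2) by (blast, blast)
    have "?x \<notin> ?U t" using t ss(1) by (auto simp: nth_eq_iff_index_eq)
    moreover have "?U (Suc t) = insert ?x (?U t)" by (auto simp: lessThan_Suc)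
    ultimately have "mono_weight \<psi> (?U (Suc t)) = mono_weight \<psi> (?U t) +
      (\<Sum>u | u \<in> ?U t \<and> {?x, u} \<in> E \<and> \<psi> u = \<psi> ?x. \<omega> {?x, u})"
      by (simp add: mono_weight_insert)
    moreover have "(\<Sum>u | u \<in> ?U t \<and> {?x, u} \<in> E \<and> \<psi> u = \<psi> ?x. \<omega> {?x, u}) =
      ext_weight ss (\<psi> ?x) t + (\<Sum>l | l \<in> {..<t} \<and> ?f l = ?f t. int_weight ss t l)"
    proof -
      let ?X = "{u. u \<in> set (nbrs ?x) \<and> u \<notin> set ss \<and> \<chi> u = \<psi> ?x}"
      let ?L = "{l. l < t \<and> {?x, ss ! l} \<in> E \<and> ?f l = ?f t}"
      let ?Y = "(\<lambda>l. ss ! l) ` ?L"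
      have "{u. u \<in> ?U t \<and> {?x, u} \<in> E \<and> \<psi> u = \<psi> ?x} = ?X \<union> ?Y"
        using \<psi> xn edge_pairD by (auto simp: set_nbrs)
      moreover have "?X \<inter> ?Y = {}" using t by auto
      moreover have "inj_on (\<lambda>l. ss ! l) ?L"
        using t ss(1) by (auto simp: inj_on_def nth_eq_iff_index_eq)
      moreover have "(\<Sum>l | l \<in> {..<t} \<and> ?f l = ?f t. int_weight ss t l) = (\<Sum>l\<in>?L. \<omega> {?x, ss ! l})"
        by (rule sum.mono_neutral_cong_right) (auto simp: int_weight_def)
      ultimately show ?thesis
        by (simp add: sum.union_disjoint sum.reindex ext_weight_def)
    qed
    ultimately show ?case
      using Suc mono_cost_insert[of "{..<t}" t "ext_weight ss" "int_weight ss" ?f]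
      by (simp add: lessThan_Suc)
  qed
  from this[of "length ss"] have "mono_weight \<psi> (?U (length ss)) =
    mono_weight \<chi> ({..<n} - set ss) + touch_cost ss ?f {..<length ss}" by simp
  moreover have "?U (length ss) = {..<n}"
    using ss(2) by (auto simp: set_conv_nth)
  ultimately show ?thesis by simp
qed

section \<open>Reduction to connected sets\<close>

definition improvable :: "nat list \<Rightarrow> bool" where
  "improvable ss \<longleftrightarrow> (\<exists>f. (\<forall>j<length ss. f j \<in> {1..c}) \<and>
     touch_cost ss f {..<length ss} < touch_cost ss (\<lambda>j. \<chi> (ss ! j)) {..<length ss})"

lemma improvable_imp_LS:
  assumes ss: "distinct ss" "set ss \<subseteq> {..<n}" "length ss \<le> k" and imp: "improvable ss"
  shows "LS_Max_Cut {..<n} E \<omega> c \<chi> k"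
proof -
  from imp obtain f where f: "\<forall>j<length ss. f j \<in> {1..c}"
    and less: "touch_cost ss f {..<length ss} < touch_cost ss (\<lambda>j. \<chi> (ss ! j)) {..<length ss}"
    unfolding improvable_def by blast
  define \<psi> where "\<psi> u = (if u \<in> set ss then f (THE j. j < length ss \<and> ss ! j = u) else \<chi> u)" for u
  have \<psi>: "\<psi> (ss ! j) = f j" if "j < length ss" for j
  proof -
    have "(THE j'. j' < length ss \<and> ss ! j' = ss ! j) = j"
      using that ss(1) by (intro the_equality) (auto simp: nth_eq_iff_index_eq)
    then show ?thesis using that by (simp add: \<psi>_def)
  qed
  have out: "\<psi> u = \<chi> u" if "u \<notin> set ss" for u using that by (simp add: \<psi>_def)
  have "touch_cost ss (\<lambda>j. \<psi> (ss ! j)) {..<length ss} = touch_cost ss f {..<length ss}"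
    using \<psi> by (intro mono_cost_cong) auto
  then have "mono_weight \<psi> {..<n} < mono_weight \<chi> {..<n}"
    using mono_weight_decompose[OF ss(1,2), of \<psi>] mono_weight_decompose[OF ss(1,2), of \<chi>] out less
    by simp
  moreover have "coloring {..<n} c \<psi>"
    unfolding coloring_def
  proof
    fix u assume "u \<in> {..<n}"
    then show "\<psi> u \<in> {1..c}"
    proof (cases "u \<in> set ss")
      case True
      then obtain j where "j < length ss" "u = ss ! j" by (auto simp: in_set_conv_nth)
      then show ?thesis using f \<psi> by auto
    qed (use colour out in \<open>auto simp: coloring_def\<close>)
  qed
  moreover have "card {v \<in> {..<n}. \<chi> v \<noteq> \<psi> v} \<le> k"
  proof -
    have "card {v \<in> {..<n}. \<chi> v \<noteq> \<psi> v} \<le> card (set ss)"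
      using out by (intro card_mono) (auto, metis)
    also have "\<dots> \<le> k" using card_length[of ss] ss(3) by linarith
    finally show ?thesis .
  qed
  ultimately show ?thesis
    unfolding LS_Max_Cut_def by (intro exI[of _ \<psi>]) (simp add: weight_cut_edges)
qed

text \<open>Connectedness of the graph induced on \<open>S\<close>, expressed by cuts instead of
  paths: an improving colouring is split along a cut, and completeness of the enumeration applies
  the property to the set selected so far.\<close>

definition attached :: "nat \<Rightarrow> nat set \<Rightarrow> bool" where
  "attached v S \<longleftrightarrow> v \<in> S \<and> (\<forall>I. v \<in> I \<longrightarrow> I \<subset> S \<longrightarrow> (\<exists>x\<in>I. \<exists>u\<in>S - I. {x, u} \<in> E))"

lemma LS_imp_attached_improvable:
  assumes "LS_Max_Cut {..<n} E \<omega> c \<chi> k"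
  obtains v S where "v < n" "S \<subseteq> {..<n}" "card S \<le> k" "attached v S"
    "\<And>ss. distinct ss \<Longrightarrow> set ss = S \<Longrightarrow> improvable ss"
proof -
  define diff where "diff \<psi> = {v \<in> {..<n}. \<chi> v \<noteq> \<psi> v}" for \<psi>
  define imp where "imp \<psi> \<longleftrightarrow> coloring {..<n} c \<psi> \<and> card (diff \<psi>) \<le> k \<and>
    mono_weight \<psi> {..<n} < mono_weight \<chi> {..<n}" for \<psi>
  from assms have "\<exists>\<psi>. imp \<psi>"
    unfolding LS_Max_Cut_def imp_def diff_def by (auto simp: weight_cut_edges)
  then obtain \<psi> where \<psi>: "imp \<psi>" and min: "\<And>\<phi>. imp \<phi> \<Longrightarrow> card (diff \<psi>) \<le> card (diff \<phi>)"
    using ex_has_least_nat[of imp _ "\<lambda>\<psi>. card (diff \<psi>)"] by blast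
  have fin: "finite (diff \<psi>)" by (simp add: diff_def)
  have nonempty: "diff \<psi> \<noteq> {}"
  proof
    assume "diff \<psi> = {}"
    then have eq: "\<And>u. u < n \<Longrightarrow> \<psi> u = \<chi> u" by (auto simp: diff_def)
    have "mono_weight \<psi> {..<n} = mono_weight \<chi> {..<n}"
      using mono_weight_decompose[of "[]" \<psi>] eq by simp
    then show False using \<psi> by (simp add: imp_def)
  qed
  then obtain v where v: "v \<in> diff \<psi>" by blast
  have "attached v (diff \<psi>)"
    unfolding attached_def
  proof (intro conjI allI impI)
    show "v \<in> diff \<psi>" by fact
    fix I assume I: "v \<in> I" "I \<subset> diff \<psi>"
    show "\<exists>x\<in>I. \<exists>u\<in>diff \<psi> - I. {x, u} \<in> E"
    proof (rule ccontr)
      assume no: "\<not> ?thesis"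
      \<comment> \<open>Recolour only inside \<open>I\<close>, respectively only outside it. Both
        results are strictly closer to \<open>\<chi>\<close>, because \<open>I\<close> contains
        \<open>v\<close> and is a proper part of the changed set.\<close>
      define \<psi>1 where "\<psi>1 u = (if u \<in> I then \<psi> u else \<chi> u)" for u
      define \<psi>2 where "\<psi>2 u = (if u \<in> I then \<chi> u else \<psi> u)" for u
      have d1: "diff \<psi>1 \<subset> diff \<psi>" and d2: "diff \<psi>2 \<subset> diff \<psi>"
        using I v by (auto simp: diff_def \<psi>1_def \<psi>2_def)
      have col: "coloring {..<n} c \<psi>1" "coloring {..<n} c \<psi>2"
        using \<psi> colour by (auto simp: imp_def coloring_def \<psi>1_def \<psi>2_def)
      have not_imp: "\<not> mono_weight \<phi> {..<n} < mono_weight \<chi> {..<n}"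
        if "coloring {..<n} c \<phi>" "diff \<phi> \<subset> diff \<psi>" for \<phi>
      proof
        assume "mono_weight \<phi> {..<n} < mono_weight \<chi> {..<n}"
        moreover have "card (diff \<phi>) < card (diff \<psi>)" using that(2) fin by (rule psubset_card_mono[rotated])
        ultimately show False using min[of \<phi>] that(1) \<psi> by (auto simp: imp_def)
      qed
      have sum: "mono_weight \<phi> {..<n} = (\<Sum>e\<in>E. if monochromatic \<phi> e then \<omega> e else 0)" for \<phi>
      proof -
        have "{e. e \<in> E \<and> e \<subseteq> {..<n} \<and> monochromatic \<phi> e} = {e \<in> E. monochromatic \<phi> e}"
          using graph by (auto simp: simple_graph_def)
        then show ?thesis
          unfolding mono_weight_def using finite_E by (simp add: sum.inter_filter)
      qed
      \<comment> \<open>By \<open>no\<close>, an edge leaving \<open>I\<close> ends at a vertex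
        where \<open>\<psi>\<close> and \<open>\<chi>\<close> agree. So on every edge
        \<open>\<psi>1\<close> and \<open>\<psi>2\<close> reproduce \<open>\<psi>\<close> and
        \<open>\<chi>\<close> in some order, and one of the two would already improve.\<close>
      have "mono_weight \<psi>1 {..<n} + mono_weight \<psi>2 {..<n} = mono_weight \<psi> {..<n} + mono_weight \<chi> {..<n}"
        unfolding sum sum.distrib[symmetric]
      proof (rule sum.cong[OF refl])
        fix e assume "e \<in> E"
        then obtain a b where e: "e = {a, b}" "a < n" "b < n" "{a, b} \<in> E" by (metis edgeE)
        have eq: "\<psi> u = \<chi> u" if "u < n" "u \<notin> diff \<psi>" for u using that by (auto simp: diff_def)
        have ab: "(a \<in> I \<longrightarrow> b \<in> I \<or> \<psi> b = \<chi> b) \<and> (b \<in> I \<longrightarrow> a \<in> I \<or> \<psi> a = \<chi> a)"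
          using no e eq by (metis DiffI insert_commute)
        then show "(if monochromatic \<psi>1 e then \<omega> e else 0) + (if monochromatic \<psi>2 e then \<omega> e else 0) =
          (if monochromatic \<psi> e then \<omega> e else 0) + (if monochromatic \<chi> e then \<omega> e else 0)"
          unfolding e(1) monochromatic_pair \<psi>1_def \<psi>2_def
          by (cases "a \<in> I"; cases "b \<in> I") auto
      qed
      then show False
        using not_imp[OF col(1) d1] not_imp[OF col(2) d2] \<psi> by (auto simp: imp_def)
    qed
  qed
  moreover have "improvable ss" if ss: "distinct ss" "set ss = diff \<psi>" for ss
  proof -
    have sub: "set ss \<subseteq> {..<n}" using ss by (auto simp: diff_def)
    have "\<psi> u = \<chi> u" if "u < n" "u \<notin> set ss" for u using that ss by (auto simp: diff_def)
    then have "touch_cost ss (\<lambda>j. \<psi> (ss ! j)) {..<length ss} < touch_cost ss (\<lambda>j. \<chi> (ss ! j)) {..<length ss}"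
      using mono_weight_decompose[OF ss(1) sub, of \<psi>] mono_weight_decompose[OF ss(1) sub, of \<chi>] \<psi>
      by (auto simp: imp_def)
    moreover have "\<psi> (ss ! j) \<in> {1..c}" if "j < length ss" for j
      using \<psi> sub nth_mem[OF that] by (auto simp: imp_def coloring_def)
    ultimately show ?thesis
      unfolding improvable_def by (intro exI[of _ "\<lambda>j. \<psi> (ss ! j)"]) auto
  qed
  moreover have "v < n" "diff \<psi> \<subseteq> {..<n}" "card (diff \<psi>) \<le> k"
    using v \<psi> by (auto simp: diff_def imp_def)
  ultimately show thesis using that by blast
qed

end

section \<open>Enumeration of connected sets\<close>

context cut_instance
begin

text \<open>Sequences of selected positions are stored with the latest position first. A queue entry pairs
  a vertex with the vertex through which it was reached; the root is paired with itself, which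
  excludes none of its neighbours.\<close>

fun queue :: "nat \<Rightarrow> nat list \<Rightarrow> (nat \<times> nat) list" where
  "queue v [] = [(v, v)]"
| "queue v (p # ps) = queue v ps @
     map (\<lambda>u. (u, fst (queue v ps ! p)))
       (filter (\<lambda>u. u \<noteq> snd (queue v ps ! p)) (nbrs (fst (queue v ps ! p))))"

fun verts :: "nat \<Rightarrow> nat list \<Rightarrow> nat list" where
  "verts v [] = []"
| "verts v (p # ps) = verts v ps @ [fst (queue v ps ! p)]"

text \<open>Strictly increasing positions make a sequence recoverable from its set of positions, as
  the counting requires. A vertex may occur several times in the queue, hence the separate demand
  that it be new.\<close>

fun valid :: "nat \<Rightarrow> nat list \<Rightarrow> bool" where
  "valid v [] \<longleftrightarrow> True"
| "valid v (p # ps) \<longleftrightarrow> valid v ps \<and> length ps < k \<and> p < length (queue v ps) \<and>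
     (\<forall>q\<in>set ps. q < p) \<and> fst (queue v ps ! p) \<notin> set (verts v ps)"

text \<open>The maximum with 1 keeps \<open>1 / D\<close> meaningful in the binomial estimate and
  lets \<open>D\<close> absorb constant overheads.\<close>

definition D :: nat where
  "D = max 1 (max_degree {..<n} E - 1)"

lemma D_pos: "1 \<le> D"
  by (simp add: D_def)

lemma length_nbrs:
  assumes "v < n"
  shows "length (nbrs v) \<le> max_degree {..<n} E"
proof -
  have "(\<lambda>u. {v, u}) ` set (nbrs v) = {e \<in> E. v \<in> e}"
  proof (intro subset_antisym subsetI)
    fix e assume "e \<in> {e \<in> E. v \<in> e}"
    then have "e \<in> E" "v \<in> e" by auto
    moreover from \<open>e \<in> E\<close> obtain a b where "e = {a, b}" by (rule edgeE)
    ultimately show "e \<in> (\<lambda>u. {v, u}) ` set (nbrs v)"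
      using assms by (auto simp: set_nbrs insert_commute)
  qed (use assms in \<open>auto simp: set_nbrs\<close>)
  moreover have "inj_on (\<lambda>u. {v, u}) (set (nbrs v))"
    by (auto simp: inj_on_def doubleton_eq_iff)
  ultimately have "degree E v = card (set (nbrs v))"
    unfolding degree_def by (metis card_image)
  then have "degree E v = length (nbrs v)"
    using distinct_nbrs[OF assms] by (simp add: distinct_card)
  moreover have "degree E v \<le> max_degree {..<n} E"
    unfolding max_degree_def using assms by (intro Max_ge) auto
  ultimately show ?thesis by simp
qed

lemma length_nbrs_le: "v < n \<Longrightarrow> length (nbrs v) \<le> D + 1"
  using length_nbrs[of v] by (simp add: D_def)

lemma length_verts [simp]: "length (verts v ps) = length ps"
  by (induction ps) auto

lemma valid_length: "valid v ps \<Longrightarrow> length ps \<le> k"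
  by (cases ps) auto

lemma distinct_verts: "valid v ps \<Longrightarrow> distinct (verts v ps)"
  by (induction ps) auto

lemma queue_ne: "queue v ps \<noteq> []"
  by (induction ps) auto

lemma queue_0: "queue v ps ! 0 = (v, v)"
  using queue_ne by (induction ps) (auto simp: nth_append)

lemma valid_append: "valid v (zs @ ps) \<Longrightarrow> valid v ps"
  by (induction zs) auto

text \<open>The initial queue has a single entry, so the position selected first, which stands last
  in the list, can only be 0.\<close>

lemma valid_last: "valid v (zs @ [p]) \<Longrightarrow> p = 0"
  using valid_append by fastforce

lemma queue_entry:
  assumes "v < n" "valid v ps" "e < length (queue v ps)" "queue v ps ! e = (x, y)"
  shows "x < n \<and> (e > 0 \<longrightarrow> x \<in> set (nbrs y) \<and> y \<in> set (verts v ps))"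
  using assms(2-)
proof (induction ps arbitrary: e x y)
  case Nil
  then show ?case using assms(1) by auto
next
  case (Cons p ps)
  let ?q = "queue v ps ! p"
  have p: "p < length (queue v ps)" "valid v ps" using Cons.prems by auto
  then have q: "fst ?q < n" using Cons.IH[of p "fst ?q" "snd ?q"] by auto
  show ?case
  proof (cases "e < length (queue v ps)")
    case True
    then show ?thesis using Cons.IH[of e x y] Cons.prems by (auto simp: nth_append)
  next
    case False
    then have "queue v (p # ps) ! e \<in> set (map (\<lambda>u. (u, fst ?q)) (filter (\<lambda>u. u \<noteq> snd ?q) (nbrs (fst ?q))))"
      using Cons.prems(2) by (auto simp only: queue.simps nth_append if_False length_append intro!: nth_mem)
    then have "x \<in> set (nbrs y)" "y = fst ?q" using Cons.prems(3) by auto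
    then show ?thesis using q nbrs_less by auto
  qed
qed

lemma queue_vert_less: "v < n \<Longrightarrow> valid v ps \<Longrightarrow> e < length (queue v ps) \<Longrightarrow> fst (queue v ps ! e) < n"
  using queue_entry[of v ps e] by (metis prod.collapse)

lemma set_verts: "v < n \<Longrightarrow> valid v ps \<Longrightarrow> set (verts v ps) \<subseteq> {..<n}"
  by (induction ps) (auto simp: queue_vert_less)

lemma nbrs_sym: "x < n \<Longrightarrow> y < n \<Longrightarrow> x \<in> set (nbrs y) \<Longrightarrow> y \<in> set (nbrs x)"
  by (simp add: set_nbrs insert_commute)

text \<open>The root adds up to \<open>D + 1\<close> entries. A later vertex was reached from one of
  its own neighbours, which is left out, so it adds at most \<open>D\<close>. The initial entry
  accounts for the rest.\<close>

lemma length_queue: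
  assumes "v < n" "valid v ps"
  shows "length (queue v ps) \<le> D * length ps + 2"
  using assms(2)
proof (induction ps)
  case (Cons p ps)
  obtain x y where q: "queue v ps ! p = (x, y)" by fastforce
  have *: "valid v ps" "p < length (queue v ps)" using Cons.prems by auto
  have x: "x < n" using queue_entry[OF assms(1) * q] by simp
  show ?case
  proof (cases ps)
    case Nil
    have "length (filter (\<lambda>u. u \<noteq> y) (nbrs x)) \<le> D + 1"
      using length_nbrs_le[OF x] length_filter_le le_trans by blast
    then show ?thesis using Nil q *(2) by auto
  next
    case (Cons p' ps')
    then have "p > 0" using Cons.prems by auto
    then have "x \<in> set (nbrs y)" "y \<in> set (verts v ps)" using queue_entry[OF assms(1) * q] by auto
    then have y: "y \<in> set (nbrs x)" using x set_verts[OF assms(1) *(1)] nbrs_sym by blast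
    have "length (filter (\<lambda>u. u \<noteq> y) (nbrs x)) < length (nbrs x)"
      using y by (intro length_filter_less) auto
    then have "length (filter (\<lambda>u. u \<noteq> y) (nbrs x)) \<le> D" using length_nbrs_le[OF x] by simp
    then show ?thesis using Cons.IH *(1) q by simp
  qed
qed simp

lemma length_queue_le:
  assumes "v < n" "valid v ps"
  shows "length (queue v ps) \<le> D * k + 2"
proof -
  have "D * length ps \<le> D * k" using valid_length[OF assms(2)] by (rule mult_le_mono2)
  then show ?thesis using length_queue[OF assms] by linarith
qed

text \<open>The only neighbour not appended is the one through which \<open>x\<close> was reached.
  That vertex was itself selected from the queue, so it is present already.\<close>

lemma queue_complete:
  assumes "valid v ps" "x \<in> set (verts v ps)" "u \<in> set (nbrs x)" "v < n"
  shows "u \<in> fst ` set (queue v ps)"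
  using assms(1,2)
proof (induction ps)
  case (Cons p ps)
  show ?case
  proof (cases "x \<in> set (verts v ps)")
    case True
    then show ?thesis using Cons by auto
  next
    case False
    obtain y where q: "queue v ps ! p = (x, y)" using False Cons.prems by (cases "queue v ps ! p") auto
    show ?thesis
    proof (cases "u = y")
      case False
      then have "(u, x) \<in> set (queue v (p # ps))" using q assms(3) by simp
      then show ?thesis by force
    next
      case True
      have p: "valid v ps" "p < length (queue v ps)" using Cons.prems by auto
      have "y \<in> fst ` set (queue v ps)"
      proof (cases "p = 0")
        case True
        then have "(x, y) = (v, v)" using q queue_0 by metis
        then have "y = fst (queue v ps ! p)" using q by simp
        then show ?thesis using p(2) by auto
      next
        case False
        then have "y \<in> set (verts v ps)" using queue_entry[OF assms(4) p q] by simp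
        moreover have "set (verts v ps) \<subseteq> fst ` set (queue v ps)"
          using p(1) by (induction ps) auto
        ultimately show ?thesis by blast
      qed
      then show ?thesis using True by auto
    qed
  qed
qed simp

text \<open>Scan the queue and select every vertex of \<open>S\<close> not selected before. At the
  end of the queue each neighbour in \<open>S\<close> of a selected vertex has been selected too,
  and \<open>attached\<close> rules out that anything of \<open>S\<close> is missing.\<close>

lemma enumeration_complete:
  assumes v: "v < n" and S: "S \<subseteq> {..<n}" "card S \<le> k" and att: "attached v S"
  obtains ps where "valid v ps" "set (verts v ps) = S"
proof -
  define inv where "inv ps cur \<longleftrightarrow> valid v ps \<and> set (verts v ps) \<subseteq> S \<and> (\<forall>q\<in>set ps. q < cur) \<and>
    cur \<le> length (queue v ps) \<and>
    (\<forall>e<cur. fst (queue v ps ! e) \<in> S \<longrightarrow> fst (queue v ps ! e) \<in> set (verts v ps))" for ps cur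
  have finS: "finite S" using S(1) finite_subset by blast
  define P where "P cur \<longleftrightarrow> (\<exists>ps. inv ps cur)" for cur
  have P0: "P 0" unfolding P_def inv_def by (intro exI[of _ "[]"]) auto
  have bd: "cur \<le> D * k + 2" if "P cur" for cur
    using that length_queue_le[OF v] unfolding P_def inv_def by (meson order_trans)
  \<comment> \<open>Selecting and skipping both advance the scan by one, so the furthest attainable
    position represents the finished scan. It exists because queue lengths are bounded.\<close>
  define cur where "cur = (GREATEST cur. P cur)"
  have "P cur" unfolding cur_def using P0 bd by (rule GreatestI_nat)
  then obtain ps where inv: "inv ps cur" unfolding P_def by blast
  have maxcur: "\<not> P (Suc cur)"
  proof
    assume "P (Suc cur)"
    then have "Suc cur \<le> cur" using Greatest_le_nat[of P "Suc cur", OF _ bd] by (simp add: cur_def)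
    then show False by simp
  qed
  let ?x = "fst (queue v ps ! cur)"
  have "\<not> cur < length (queue v ps)"
  proof
    assume cur: "cur < length (queue v ps)"
    show False
    proof (cases "?x \<in> S \<and> ?x \<notin> set (verts v ps)")
      case True
      \<comment> \<open>The selected set is still a proper part of \<open>S\<close>, so the size
        limit \<open>k\<close> cannot block this selection.\<close>
      have "set (verts v ps) \<subset> S" using True inv by (auto simp: inv_def)
      then have "card (set (verts v ps)) < card S" using finS by (rule psubset_card_mono[rotated])
      then have "length ps < k"
        using S(2) inv distinct_card[OF distinct_verts[of v ps]] by (auto simp: inv_def)
      then have "valid v (cur # ps)" using inv cur True by (auto simp: inv_def)
      then have "inv (cur # ps) (Suc cur)"
        using inv cur True unfolding inv_def by (auto simp: less_Suc_eq nth_append)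
      then show False using maxcur P_def by blast
    next
      case False
      then have "inv ps (Suc cur)"
        using inv cur unfolding inv_def by (auto simp: less_Suc_eq)
      then show False using maxcur P_def by blast
    qed
  qed
  then have cur: "cur = length (queue v ps)" using inv by (simp add: inv_def)
  have closed: "u \<in> set (verts v ps)" if "u \<in> S" "u \<in> fst ` set (queue v ps)" for u
    using that inv cur unfolding inv_def by (auto simp: in_set_conv_nth) (metis fst_conv)
  have "v \<in> fst ` set (queue v ps)"
    using queue_0[of v ps] queue_ne[of v ps] by (metis fst_conv imageI length_greater_0_conv nth_mem)
  then have vI: "v \<in> set (verts v ps)" using att closed by (auto simp: attached_def)
  have "set (verts v ps) = S"
  proof (rule ccontr)
    assume "set (verts v ps) \<noteq> S"
    then have "set (verts v ps) \<subset> S" using inv by (auto simp: inv_def)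
    then obtain x u where xu: "x \<in> set (verts v ps)" "u \<in> S" "u \<notin> set (verts v ps)" "{x, u} \<in> E"
      using att vI unfolding attached_def by blast
    have "u \<in> set (nbrs x)" using xu(4) edge_pairD[OF xu(4)] by (simp add: set_nbrs)
    then have "u \<in> fst ` set (queue v ps)"
      using queue_complete[OF _ xu(1) _ v] inv by (simp add: inv_def)
    then show False using closed xu(2,3) by blast
  qed
  then show thesis using that inv by (auto simp: inv_def)
qed

lemma LS_iff_improvable_verts:
  "LS_Max_Cut {..<n} E \<omega> c \<chi> k \<longleftrightarrow> (\<exists>v<n. \<exists>ps. ps \<noteq> [] \<and> valid v ps \<and> improvable (verts v ps))"
proof
  assume "LS_Max_Cut {..<n} E \<omega> c \<chi> k"
  then obtain v S where vS: "v < n" "S \<subseteq> {..<n}" "card S \<le> k" "attached v S"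
    "\<And>ss. distinct ss \<Longrightarrow> set ss = S \<Longrightarrow> improvable ss"
    using LS_imp_attached_improvable by blast
  obtain ps where ps: "valid v ps" "set (verts v ps) = S"
    using enumeration_complete[OF vS(1-4)] by blast
  moreover have "ps \<noteq> []" using ps vS(4) by (auto simp: attached_def)
  ultimately show "\<exists>v<n. \<exists>ps. ps \<noteq> [] \<and> valid v ps \<and> improvable (verts v ps)"
    using vS distinct_verts by blast
next
  assume "\<exists>v<n. \<exists>ps. ps \<noteq> [] \<and> valid v ps \<and> improvable (verts v ps)"
  then obtain v ps where "v < n" "valid v ps" "improvable (verts v ps)" by blast
  then show "LS_Max_Cut {..<n} E \<omega> c \<chi> k"
    using improvable_imp_LS[of "verts v ps"] distinct_verts set_verts valid_length by simp
qed

text \<open>\<open>remaining v ps cur\<close> collects the sequences that a depth-first search in lexicographic order visits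
  after it has selected \<open>ps\<close> and examined the positions below \<open>cur\<close>.\<close>

definition extensions :: "nat \<Rightarrow> nat list \<Rightarrow> nat \<Rightarrow> nat list set" where
  "extensions v ps cur = {ys. valid v ys \<and> (\<exists>zs q. ys = zs @ q # ps \<and> cur \<le> q)}"

fun remaining :: "nat \<Rightarrow> nat list \<Rightarrow> nat \<Rightarrow> nat list set" where
  "remaining v [] cur = extensions v [] cur"
| "remaining v (p # ps) cur = extensions v (p # ps) cur \<union> remaining v ps (Suc p)"

lemma extensions_push:
  assumes "valid v (cur # ps)"
  shows "extensions v ps cur =
    insert (cur # ps) (extensions v (cur # ps) (Suc cur) \<union> extensions v ps (Suc cur))"
proof (intro subset_antisym subsetI)
  fix ys assume "ys \<in> extensions v ps cur"
  then obtain zs q where ys: "valid v ys" "ys = zs @ q # ps" "cur \<le> q"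
    unfolding extensions_def by blast
  show "ys \<in> insert (cur # ps) (extensions v (cur # ps) (Suc cur) \<union> extensions v ps (Suc cur))"
  proof (cases "q = cur")
    case True
    show ?thesis
    proof (cases zs rule: rev_cases)
      case Nil
      then show ?thesis using ys True by simp
    next
      case (snoc zs' r)
      then have "valid v (r # cur # ps)" using ys True valid_append[of v zs' "r # cur # ps"] by simp
      then have "Suc cur \<le> r" by auto
      then show ?thesis using snoc ys True unfolding extensions_def by auto
    qed
  next
    case False
    then have "Suc cur \<le> q" using ys by simp
    then show ?thesis using ys unfolding extensions_def by blast
  qed
next
  fix ys assume *: "ys \<in> insert (cur # ps) (extensions v (cur # ps) (Suc cur) \<union> extensions v ps (Suc cur))"
  have "ys \<in> extensions v ps cur" if "ys \<in> extensions v (cur # ps) (Suc cur)"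
  proof -
    from that obtain zs q where "valid v ys" "ys = (zs @ [q]) @ cur # ps"
      unfolding extensions_def by auto
    then show ?thesis unfolding extensions_def by blast
  qed
  moreover have "ys \<in> extensions v ps cur" if "ys \<in> extensions v ps (Suc cur)"
    using that unfolding extensions_def using Suc_leD by blast
  moreover have "cur # ps \<in> extensions v ps cur"
    using assms unfolding extensions_def by auto
  ultimately show "ys \<in> extensions v ps cur" using * by blast
qed

lemma remaining_push:
  assumes "valid v (cur # ps)"
  shows "remaining v ps cur = insert (cur # ps) (remaining v (cur # ps) (Suc cur))"
  using extensions_push[OF assms] by (cases ps) auto

text \<open>Prepares the proof that no sequence is visited twice. A sequence remaining at a lower
  level leaves \<open>ps\<close> there through a position above the one on the stack, so it does not
  have \<open>ps\<close> as a suffix.\<close>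

lemma append_mem_remaining:
  "zs @ ps \<in> remaining v ps cur \<Longrightarrow> \<exists>zs' q. zs = zs' @ [q] \<and> cur \<le> q"
proof (induction v ps cur arbitrary: zs rule: remaining.induct)
  case (1 v cur)
  then show ?case unfolding remaining.simps extensions_def by auto
next
  case (2 v p ps cur)
  from "2.prems" consider "zs @ p # ps \<in> extensions v (p # ps) cur"
    | "(zs @ [p]) @ ps \<in> remaining v ps (Suc p)" by auto
  then show ?case
  proof cases
    case 1
    then obtain zs' q where "zs @ p # ps = (zs' @ [q]) @ p # ps" "cur \<le> q"
      unfolding extensions_def by auto
    then show ?thesis by (metis append_same_eq)
  next
    case 2
    then show ?thesis using "2.IH"[OF 2] by auto
  qed
qed

text \<open>Hence a visited sequence really drops out of the sum in \<open>potential\<close>, and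
  its share is free to pay for the visit.\<close>

lemma push_notin_remaining: "cur # ps \<notin> remaining v (cur # ps) (Suc cur)"
proof
  assume "cur # ps \<in> remaining v (cur # ps) (Suc cur)"
  then have "[] @ cur # ps \<in> remaining v (cur # ps) (Suc cur)" by simp
  from append_mem_remaining[OF this] show False by simp
qed

lemma remaining_skip:
  assumes "\<not> valid v (cur # ps)"
  shows "remaining v ps cur = remaining v ps (Suc cur)"
proof -
  have "extensions v ps cur = extensions v ps (Suc cur)"
    unfolding extensions_def using assms valid_append[of v _ "_ # ps"]
    by (auto simp: le_less Suc_le_eq)
  then show ?thesis by (cases ps) auto
qed

lemma extensions_empty:
  assumes "length ps = k \<or> length (queue v ps) \<le> cur"
  shows "extensions v ps cur = {}"
proof -
  have "\<not> valid v (q # ps)" if "cur \<le> q" for q using assms that by auto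
  then show ?thesis unfolding extensions_def using valid_append[of v _ "_ # ps"] by blast
qed

lemma remaining_pop:
  assumes "length (p # ps) = k \<or> length (queue v (p # ps)) \<le> cur"
  shows "remaining v (p # ps) cur = remaining v ps (Suc p)"
  using extensions_empty[OF assms] by simp

lemma remaining_start: "remaining v [] 0 = {ys. valid v ys \<and> ys \<noteq> []}"
  unfolding remaining.simps extensions_def by (auto intro: append_butlast_last_id[symmetric])

lemma remaining_finished: "0 < cur \<Longrightarrow> remaining v [] cur = {}"
  by (simp add: extensions_empty)

section \<open>Counting the sequences\<close>

lemma valid_positions:
  assumes "v < n"
  shows "valid v ys \<Longrightarrow> ys \<noteq> [] \<Longrightarrow> set ys \<subseteq> {..D * (length ys - 1) + 1}"
proof (induction ys)
  case (Cons p ps)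
  then have "p < length (queue v ps)" and "valid v ps" and "\<forall>q\<in>set ps. q < p" by auto
  moreover have "length (queue v ps) \<le> D * length ps + 2" using length_queue[OF assms] Cons by simp
  ultimately show ?case by fastforce
qed simp

lemma finite_valid:
  assumes "v < n"
  shows "finite {ys. valid v ys}"
proof (rule finite_subset)
  show "{ys. valid v ys} \<subseteq> {ys. set ys \<subseteq> {..D * k + 2} \<and> length ys \<le> k}"
  proof
    fix ys assume "ys \<in> {ys. valid v ys}"
    then have ys: "valid v ys" by simp
    have "D * (length ys - 1) \<le> D * k" using valid_length[OF ys] by (intro mult_le_mono2) simp
    then have "{..D * (length ys - 1) + 1} \<subseteq> {..D * k + 2}"
      by (intro atMost_subset_iff[THEN iffD2]) linarith
    then show "ys \<in> {ys. set ys \<subseteq> {..D * k + 2} \<and> length ys \<le> k}"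
      using valid_length[OF ys] valid_positions[OF assms ys] by (cases "ys = []") auto
  qed
qed (auto intro: finite_lists_length_le)

lemma finite_remaining: "v < n \<Longrightarrow> finite (remaining v ps cur)"
proof (induction v ps cur rule: remaining.induct)
  case (1 v cur)
  then show ?case using finite_valid by (auto simp: extensions_def)
next
  case (2 v p ps cur)
  then show ?case using finite_valid by (auto simp: extensions_def)
qed

lemma valid_decreasing: "valid v ys \<Longrightarrow> sorted_wrt (>) ys"
  by (induction ys) auto

text \<open>A decreasing list is determined by its set. That set contains 0, and its other elements
  lie below the length of the queue before the last selection, which is at most
  \<open>D * (s - 1) + 2\<close>.\<close>

lemma card_valid:
  assumes "v < n" "0 < s"
  shows "card {ys. valid v ys \<and> length ys = s} \<le> (D * (s - 1) + 1) choose (s - 1)"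
proof -
  let ?A = "{ys. valid v ys \<and> length ys = s}"
  let ?M = "{1..D * (s - 1) + 1}"
  let ?B = "{Y. Y \<subseteq> ?M \<and> card Y = s - 1}"
  have dist: "distinct ys \<and> sorted (rev ys)" if "valid v ys" for ys
    using valid_decreasing[OF that]
    by (induction ys) (auto simp: sorted_append less_imp_le)
  have "inj_on set ?A"
    using dist by (auto simp: inj_on_def) (metis distinct_rev rev_rev_ident set_rev sorted_distinct_set_unique)
  moreover have "set ` ?A \<subseteq> insert 0 ` ?B"
  proof
    fix X assume "X \<in> set ` ?A"
    then obtain ys where ys: "valid v ys" "length ys = s" "X = set ys" by auto
    then have ne: "ys \<noteq> []" using assms(2) by auto
    then have "last ys = 0" using valid_last[of v "butlast ys" "last ys"] ys(1) by simp
    then have "0 \<in> X" using last_in_set[OF ne] ys(3) by simp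
    have "card X = s" using ys dist by (simp add: distinct_card)
    then have "card (X - {0}) = s - 1" using \<open>0 \<in> X\<close> by simp
    moreover have "X - {0} \<subseteq> ?M" using valid_positions[OF assms(1) ys(1) ne] ys by (auto simp: Suc_le_eq)
    ultimately show "X \<in> insert 0 ` ?B" using \<open>0 \<in> X\<close> by (intro image_eqI[of _ _ "X - {0}"]) auto
  qed
  moreover have finB: "finite ?B" by simp
  ultimately have "card ?A \<le> card (insert (0::nat) ` ?B)"
    by (simp only: card_image[symmetric] card_mono finite_imageI)
  also have "\<dots> \<le> card ?B" using finB by (rule card_image_le)
  also have "\<dots> = (D * (s - 1) + 1) choose (s - 1)" by (simp add: n_subsets)
  finally show ?thesis .
qed

end

text \<open>Keep only the term of index \<open>j\<close> in the expansion of
  \<open>(1 + 1 / d) ^ (d * j + 1)\<close>. The power is at most \<open>2 * e ^ j\<close>, as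
  \<open>(1 + 1 / d) ^ d\<close> does not exceed \<open>e\<close> and the leftover factor is at most
  2.\<close>

lemma binomial_le_exp:
  fixes d j :: nat
  assumes "1 \<le> d"
  shows "real ((d * j + 1) choose j) \<le> 2 * (exp 1 * real d) ^ j"
proof -
  let ?N = "d * j + 1" and ?x = "1 / real d"
  have dj: "j \<le> ?N" using assms by (simp add: le_SucI)
  have "real (?N choose j) * ?x ^ j = real (?N choose j) * ?x ^ j * 1 ^ (?N - j)" by simp
  also have "\<dots> \<le> (\<Sum>i\<le>?N. real (?N choose i) * ?x ^ i * 1 ^ (?N - i))"
    using dj by (intro member_le_sum[of j "{..?N}" "\<lambda>i. real (?N choose i) * ?x ^ i * 1 ^ (?N - i)"]) auto
  also have "\<dots> = (?x + 1) ^ ?N" by (rule binomial_ring[symmetric])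
  also have "\<dots> = (1 + ?x) * ((1 + ?x) ^ d) ^ j" by (simp add: power_mult add.commute)
  also have "\<dots> \<le> 2 * (exp 1) ^ j"
  proof (intro mult_mono power_mono)
    have "(1 + ?x) ^ d \<le> exp ?x ^ d" by (intro power_mono exp_ge_add_one_self) auto
    also have "\<dots> = exp 1" using assms by (simp flip: exp_of_nat_mult)
    finally show "(1 + ?x) ^ d \<le> exp 1" .
  qed (use assms in auto)
  finally have "real (?N choose j) * ?x ^ j * real d ^ j \<le> 2 * exp 1 ^ j * real d ^ j"
    by (rule mult_right_mono) simp
  then show ?thesis using assms by (simp add: power_mult_distrib power_divide mult.assoc)
qed

lemma sum_power_le:
  fixes x :: real
  assumes "2 \<le> x"
  shows "(\<Sum>s<k. x ^ s) \<le> x ^ k"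
proof (induction k)
  case (Suc k)
  have "x ^ k + x ^ k \<le> x ^ Suc k" using assms by (simp add: mult_right_mono flip: mult_2)
  then show ?case using Suc by simp
qed simp

context cut_instance
begin

lemma sum_valid_le:
  assumes "v < n"
  shows "real (\<Sum>ys | valid v ys \<and> ys \<noteq> []. G * 3 ^ length ys) \<le>
    6 * real G * (3 * exp 1) ^ k * real D ^ k"
proof -
  let ?A = "{ys. valid v ys \<and> ys \<noteq> []}"
  let ?x = "3 * exp 1 * real D"
  have fin: "finite ?A" using finite_valid[OF assms] by (rule finite_subset[rotated]) auto
  have "length ` ?A \<subseteq> {1..k}" using valid_length by (auto simp: Suc_le_eq)
  then have "(\<Sum>ys\<in>?A. real (G * 3 ^ length ys)) =
    (\<Sum>s\<in>{1..k}. \<Sum>ys\<in>{ys. ys \<in> ?A \<and> length ys = s}. real (G * 3 ^ length ys))"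
    using fin by (intro sum.group[symmetric]) auto
  also have "\<dots> \<le> (\<Sum>s\<in>{1..k}. 6 * real G * ?x ^ (s - 1))"
  proof (rule sum_mono)
    fix s assume s: "s \<in> {1..k}"
    have "{ys. ys \<in> ?A \<and> length ys = s} = {ys. valid v ys \<and> length ys = s}" using s by auto
    then have "(\<Sum>ys\<in>{ys. ys \<in> ?A \<and> length ys = s}. real (G * 3 ^ length ys)) =
      real (card {ys. valid v ys \<and> length ys = s}) * (real G * 3 ^ s)" by simp
    also have "\<dots> \<le> 2 * (exp 1 * real D) ^ (s - 1) * (real G * 3 ^ s)"
    proof (rule mult_right_mono)
      have "card {ys. valid v ys \<and> length ys = s} \<le> (D * (s - 1) + 1) choose (s - 1)"
        using card_valid[OF assms] s by simp
      then have "real (card {ys. valid v ys \<and> length ys = s}) \<le> real ((D * (s - 1) + 1) choose (s - 1))"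
        by (rule of_nat_mono)
      then show "real (card {ys. valid v ys \<and> length ys = s}) \<le> 2 * (exp 1 * real D) ^ (s - 1)"
        using binomial_le_exp[OF D_pos, of "s - 1"] by linarith
    qed simp
    also have "\<dots> = 6 * real G * ?x ^ (s - 1)"
    proof -
      \<comment> \<open>One factor 3 is split off to match the exponents; with the 2 of the binomial
        estimate it makes the 6.\<close>
      have "(3::real) ^ s = 3 * 3 ^ (s - 1)" using s by (cases s) auto
      then show ?thesis by (simp add: power_mult_distrib)
    qed
    finally show "(\<Sum>ys\<in>{ys. ys \<in> ?A \<and> length ys = s}. real (G * 3 ^ length ys)) \<le> 6 * real G * ?x ^ (s - 1)" .
  qed
  also have "\<dots> = 6 * real G * (\<Sum>s<k. ?x ^ s)"
    unfolding sum_distrib_left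
    by (rule sum.reindex_bij_witness[of _ Suc "\<lambda>s. s - 1"]) auto
  also have "\<dots> \<le> 6 * real G * ?x ^ k"
  proof (rule mult_left_mono[OF sum_power_le])
    have "2 * 1 \<le> exp (1::real) * real D" using D_pos exp_ge_add_one_self[of "1::real"] by (intro mult_mono) auto
    then show "2 \<le> ?x" by simp
  qed simp
  finally show ?thesis by (simp add: power_mult_distrib mult.assoc)
qed

end

section \<open>Optimal recolouring of a fixed set\<close>

abbreviation subset_pairs :: "nat \<Rightarrow> (nat \<times> nat) set" where
  "subset_pairs j \<equiv> {(set_encode A, set_encode C) | A C. C \<subseteq> A \<and> A \<subseteq> {..<j}}"

definition subset_table :: "nat \<Rightarrow> (nat \<Rightarrow> rat) \<Rightarrow> (nat set \<Rightarrow> rat) \<Rightarrow> bool" where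
  "subset_table s arr F \<longleftrightarrow> (\<forall>B\<subseteq>{..<s}. arr (set_encode B) = F B)"

lemma set_encode_less:
  assumes "B \<subseteq> {..<s}"
  shows "set_encode B < 2 ^ s"
proof -
  have "set_encode B \<le> (\<Sum>j<s. 2 ^ j)"
    unfolding set_encode_def using assms by (intro sum_mono2) auto
  also have "\<dots> < (2::nat) ^ s" by (induction s) auto
  finally show ?thesis .
qed

lemma set_encode_add:
  assumes "B \<subseteq> {..<j}"
  shows "set_encode (insert j B) = 2 ^ j + set_encode B"
  using assms finite_subset[OF assms] by (subst set_encode_insert) auto

lemma set_encode_full: "set_encode {..<s} = 2 ^ s - 1"
proof -
  have "Suc (set_encode {..<s}) = 2 ^ s"
    by (induction s) (auto simp: lessThan_Suc set_encode_add)
  then show ?thesis by simp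
qed

lemma set_encode_eq_iff:
  assumes "A \<subseteq> {..<s}" "B \<subseteq> {..<s}"
  shows "set_encode A = set_encode B \<longleftrightarrow> A = B"
  using assms finite_subset[OF assms(1)] finite_subset[OF assms(2)] set_encode_eq by simp

text \<open>Removing a subset of the bits never borrows, so one machine subtraction performs the set
  difference in \<open>pair_value\<close>.\<close>

lemma set_encode_diff:
  assumes "C \<subseteq> A" "A \<subseteq> {..<s}"
  shows "set_encode A - set_encode C = set_encode (A - C)"
proof -
  have "finite A" using assms(2) finite_subset by blast
  then have "set_encode A = set_encode (A - C) + set_encode C"
    unfolding set_encode_def using assms by (simp add: sum.subset_diff)
  then show ?thesis by simp
qed

text \<open>Subsets containing \<open>j\<close> have the codes \<open>2 ^ j + q\<close> with
  \<open>q < 2 ^ j\<close>, so the larger table is the old one followed by a second half computed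
  from it entry by entry.\<close>

lemma subset_table_Suc:
  assumes "subset_table j arr F" "subset_table j brr G"
    and "\<And>q. q < 2 ^ j \<Longrightarrow> arr' q = arr q \<and> arr' (2 ^ j + q) = arr q + brr q"
    and "\<And>B. B \<subseteq> {..<j} \<Longrightarrow> F (insert j B) = F B + G B"
  shows "subset_table (Suc j) arr' F"
  unfolding subset_table_def
proof (intro allI impI)
  fix B assume B: "B \<subseteq> {..<Suc j}"
  show "arr' (set_encode B) = F B"
  proof (cases "j \<in> B")
    case True
    define B' where "B' = B - {j}"
    have B': "B' \<subseteq> {..<j}" "B = insert j B'" using B True by (auto simp: B'_def less_Suc_eq)
    have "arr' (set_encode B) = arr (set_encode B') + brr (set_encode B')"
      using B' assms(3)[OF set_encode_less[OF B'(1)]] by (simp add: set_encode_add)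
    then show ?thesis using assms(1,2,4) B' unfolding subset_table_def by simp
  next
    case False
    then have "B \<subseteq> {..<j}" using B by (auto simp: less_Suc_eq)
    then show ?thesis using assms(1,3) set_encode_less unfolding subset_table_def by metis
  qed
qed

text \<open>Register and array names: \<open>sv[0..<d]\<close> is the selected set; \<open>lab\<close> holds the colour of an unselected
  vertex and \<open>c + 1 + j\<close> for \<open>sv[j]\<close>, so that one scan for a given label yields either the weight towards
  a colour outside the set or the weight of an edge inside it. Subsets of the selected set
  are addressed by their encoding as a number; \<open>Y\<close> and \<open>W\<close> are such tables, \<open>W\<close> for the weight caused by giving
  one colour to a subset, \<open>M\<close> and \<open>N\<close> for the optima before and after the current colour. \<open>mask\<close>
  encodes the vertices whose original colour is the current one, and \<open>base\<close> sums the
  original weight.\<close>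

definition sum_label :: com where
  "sum_label =
    SetR ''t'' (RConst 0) ;;
    For ''p'' (NArr ''off'' (NReg ''x'')) (NArr ''off'' (NAdd (NReg ''x'') (NConst 1)))
      (Cond (NEq (NArr ''lab'' (NArr ''adj'' (NReg ''p''))) (NReg ''lb''))
         (SetR ''t'' (RAdd (RReg ''t'') (RArr ''wt'' (NReg ''p''))))
         Skip)"

lemma writes_sum_label: "writes sum_label = {NR ''p'', RR ''t''}"
  by (auto simp: sum_label_def writes_For)

definition double_table :: "name \<Rightarrow> name \<Rightarrow> rexp \<Rightarrow> com" where
  "double_table X z e = For ''q'' (NConst 0) (NArr ''pow2'' (NReg z))
    (SetRArr X (NAdd (NArr ''pow2'' (NReg z)) (NReg ''q'')) (RAdd (RArr X (NReg ''q'')) e))"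

lemma writes_double_table: "writes (double_table X z e) = {NR ''q'', RA X}"
  by (auto simp: double_table_def writes_For)

text \<open>Only cells from \<open>P\<close> on are written, so the lower half is always read in its
  original state. Hypothesis \<open>e\<close> says that of all the loop changes, the added
  expression depends on the counter alone.\<close>

lemma wp_double_table:
  assumes P: "narr m ''pow2'' (nreg m z) = P" and z: "z \<noteq> ''q''"
    and e: "\<And>m'. same {NR ''q'', RA X} m m' \<Longrightarrow> nreg m' ''q'' < P \<Longrightarrow> rval e m' = g (nreg m' ''q'')"
  shows "wp (double_table X z e) (\<lambda>t m'. t \<le> P * (rcost e + 20) + 10 \<and>
    (\<forall>q<P. rarr m' X q = rarr m X q \<and> rarr m' X (P + q) = rarr m X q + g q)) m"
  unfolding double_table_def
proof (rule wp_For[where h = P and T = "rcost e + 8" and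
      I = "\<lambda>j m'. (\<forall>q<P. rarr m' X q = rarr m X q) \<and> (\<forall>q<j. rarr m' X (P + q) = rarr m X q + g q)"])
  fix j m'
  assume I: "(\<forall>q<P. rarr m' X q = rarr m X q) \<and> (\<forall>q<j. rarr m' X (P + q) = rarr m X q + g q)"
    and j: "j < P"
    and s: "same (insert (NR ''q'') (writes (SetRArr X (NAdd (NArr ''pow2'' (NReg z)) (NReg ''q''))
      (RAdd (RArr X (NReg ''q'')) e)))) m m'" and q: "nreg m' ''q'' = j"
  have s': "same {NR ''q'', RA X} m m'" using s by simp
  have P': "narr m' ''pow2'' (nreg m' z) = P" using s' z P by (simp add: same_def)
  have "rval e m' = g j" using e[OF s'] q j by simp
  then show "wp (SetRArr X (NAdd (NArr ''pow2'' (NReg z)) (NReg ''q'')) (RAdd (RArr X (NReg ''q'')) e))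
     (\<lambda>t m''. t \<le> rcost e + 8 \<and> nreg m'' ''q'' = j \<and>
       (\<forall>q<P. rarr (m''\<lparr>nreg := (nreg m'')(''q'' := Suc j)\<rparr>) X q = rarr m X q) \<and>
       (\<forall>q<Suc j. rarr (m''\<lparr>nreg := (nreg m'')(''q'' := Suc j)\<rparr>) X (P + q) = rarr m X q + g q)) m'"
    using I j q P' by (simp add: wp_simps less_Suc_eq)
next
  fix j m'
  assume "same (insert (NR ''q'') (writes (SetRArr X (NAdd (NArr ''pow2'' (NReg z)) (NReg ''q''))
      (RAdd (RArr X (NReg ''q'')) e)))) m m'"
  then show "nval (NArr ''pow2'' (NReg z)) m' = P" using P z by (simp add: same_def)
qed (auto simp: algebra_simps)

definition copy_table :: "name \<Rightarrow> name \<Rightarrow> com" where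
  "copy_table X Z = For ''q'' (NConst 0) (NArr ''pow2'' (NReg ''d''))
    (SetRArr X (NReg ''q'') (RArr Z (NReg ''q'')))"

lemma writes_copy_table: "writes (copy_table X Z) = {NR ''q'', RA X}"
  by (auto simp: copy_table_def writes_For)

lemma wp_copy_table:
  assumes P: "narr m ''pow2'' (nreg m ''d'') = P" and X: "X \<noteq> Z"
  shows "wp (copy_table X Z) (\<lambda>t m'. t \<le> P * 20 + 10 \<and> (\<forall>q<P. rarr m' X q = rarr m Z q)) m"
  unfolding copy_table_def
  by (rule wp_For[where h = P and T = 5 and I = "\<lambda>j m'. \<forall>q<j. rarr m' X q = rarr m Z q"])
    (use P X in \<open>auto simp: same_def wp_simps less_Suc_eq\<close>)

text \<open>Entry \<open>B\<close> of \<open>Y\<close> is what the vertex in position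
  \<open>j\<close> adds when, of the earlier positions, exactly those in \<open>B\<close> share its
  colour. One scan per \<open>l < j\<close> then serves all subsets.\<close>

definition fill_Y :: com where
  "fill_Y =
    SetN ''lb'' (NReg ''i'') ;;
    sum_label ;;
    SetRArr ''Y'' (NConst 0) (RReg ''t'') ;;
    For ''l'' (NConst 0) (NReg ''j'')
      (SetN ''lb'' (NAdd (NAdd (NReg ''c'') (NConst 1)) (NReg ''l'')) ;;
       sum_label ;;
       double_table ''Y'' ''l'' (RReg ''t''))"

lemma writes_fill_Y: "writes fill_Y =
    {NR ''lb'', NR ''p'', RR ''t'', RA ''Y'', NR ''l'', NR ''q''}"
  by (auto simp: fill_Y_def writes_For writes_sum_label writes_double_table)

definition fill_W :: com where
  "fill_W =
    SetRArr ''W'' (NConst 0) (RConst 0) ;;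
    SetN ''mask'' (NConst 0) ;;
    For ''j'' (NConst 0) (NReg ''d'')
      (SetN ''x'' (NArr ''sv'' (NReg ''j'')) ;;
       fill_Y ;;
       double_table ''W'' ''j'' (RArr ''Y'' (NReg ''q'')) ;;
       Cond (NEq (NArr ''col'' (NReg ''x'')) (NReg ''i''))
         (SetN ''mask'' (NAdd (NReg ''mask'') (NArr ''pow2'' (NReg ''j''))))
         Skip)"

lemma writes_fill_W: "writes fill_W =
    {RA ''W'', NR ''mask'', NR ''j'', NR ''x'', NR ''lb'', NR ''p'', RR ''t'', RA ''Y'', NR ''l'', NR ''q''}"
  by (auto simp: fill_W_def writes_For writes_fill_Y writes_double_table)

definition pair_value :: rexp where
  "pair_value = RAdd (RArr ''M'' (NArr ''PC'' (NReg ''q'')))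
     (RArr ''W'' (NSub (NArr ''PA'' (NReg ''q'')) (NArr ''PC'' (NReg ''q''))))"

text \<open>At the first colour \<open>M\<close> may still hold results for an earlier set, so it
  must not be read; the copy of \<open>W\<close> in \<open>N\<close> is then already optimal. For
  later colours that copy is the starting value, with \<open>i\<close> used on all of
  \<open>A\<close>.\<close>

definition min_plus :: com where
  "min_plus =
    Cond (NLess (NConst 1) (NReg ''i''))
      (For ''q'' (NConst 0) (NArr ''pow3'' (NReg ''d''))
         (Cond (RLess pair_value (RArr ''N'' (NArr ''PA'' (NReg ''q''))))
            (SetRArr ''N'' (NArr ''PA'' (NReg ''q'')) pair_value)
            Skip))
      Skip"

lemma writes_min_plus: "writes min_plus = {NR ''q'', RA ''N''}"
  by (auto simp: min_plus_def writes_For)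

definition colour_step :: com where
  "colour_step =
    fill_W ;;
    SetR ''base'' (RAdd (RReg ''base'') (RArr ''W'' (NReg ''mask''))) ;;
    copy_table ''N'' ''W'' ;;
    min_plus ;;
    copy_table ''M'' ''N''"

lemma writes_colour_step: "writes colour_step =
    {RR ''base'', RA ''N'', RA ''M'',
     RA ''W'', NR ''mask'', NR ''j'', NR ''x'', NR ''lb'', NR ''p'', RR ''t'', RA ''Y'', NR ''l'', NR ''q''}"
  by (auto simp: colour_step_def writes_fill_W writes_copy_table writes_min_plus)

definition check_set :: com where
  "check_set =
    SetR ''base'' (RConst 0) ;;
    For ''i'' (NConst 1) (NAdd (NReg ''c'') (NConst 1)) colour_step ;;
    Cond (RLess (RArr ''M'' (NSub (NArr ''pow2'' (NReg ''d'')) (NConst 1))) (RReg ''base''))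
      (SetN ''res'' (NConst 1))
      Skip"

lemma writes_check_set: "writes check_set =
    {NR ''res'', NR ''i'', RR ''base'', RA ''N'', RA ''M'',
     RA ''W'', NR ''mask'', NR ''j'', NR ''x'', NR ''lb'', NR ''p'', RR ''t'', RA ''Y'', NR ''l'', NR ''q''}"
  by (auto simp: check_set_def writes_For writes_colour_step)

context cut_instance
begin

definition off :: "nat \<Rightarrow> nat" where
  "off v = (\<Sum>u<v. length (nbrs u))"

lemma off_Suc: "off (Suc v) = off v + length (nbrs v)"
  by (simp add: off_def)

definition input_ok :: "mem \<Rightarrow> bool" where
  "input_ok m \<longleftrightarrow> nreg m ''n'' = n \<and> nreg m ''c'' = c \<and> nreg m ''k'' = k \<and>
    (\<forall>v\<le>n. narr m ''off'' v = off v) \<and>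
    (\<forall>v<n. \<forall>i<length (nbrs v). narr m ''adj'' (off v + i) = nbrs v ! i \<and>
       rarr m ''wt'' (off v + i) = \<omega> {v, nbrs v ! i}) \<and>
    (\<forall>v<n. narr m ''col'' v = \<chi> v)"

definition tables_ok :: "mem \<Rightarrow> bool" where
  "tables_ok m \<longleftrightarrow> (\<forall>j\<le>k. narr m ''pow2'' j = 2 ^ j \<and> narr m ''pow3'' j = 3 ^ j \<and>
    (\<lambda>q. (narr m ''PA'' q, narr m ''PC'' q)) ` {..<3 ^ j} =
      subset_pairs j)"

definition selection_ok :: "nat list \<Rightarrow> mem \<Rightarrow> bool" where
  "selection_ok ss m \<longleftrightarrow> distinct ss \<and> set ss \<subseteq> {..<n} \<and> length ss \<le> k \<and> ss \<noteq> [] \<and>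
    nreg m ''d'' = length ss \<and>
    (\<forall>j<length ss. narr m ''sv'' j = ss ! j \<and> narr m ''lab'' (ss ! j) = c + 1 + j) \<and>
    (\<forall>u<n. u \<notin> set ss \<longrightarrow> narr m ''lab'' u = \<chi> u)"

definition check_pre :: "nat list \<Rightarrow> mem \<Rightarrow> bool" where
  "check_pre ss m \<longleftrightarrow> input_ok m \<and> tables_ok m \<and> selection_ok ss m"

definition check_reads :: "loc set" where
  "check_reads = {NR ''n'', NR ''c'', NR ''k'', NR ''d'', NA ''off'', NA ''adj'', NA ''col'', NA ''pow2'',
     NA ''pow3'', NA ''PA'', NA ''PC'', NA ''sv'', NA ''lab'', RA ''wt''}"

lemma check_pre_same:
  assumes pre: "check_pre ss m" and same: "same X m m'" and X: "X \<inter> check_reads = {}"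
  shows "check_pre ss m'"
proof -
  have "x \<notin> X" if "x \<in> check_reads" for x using X that by blast
  then have eqs: "nreg m' ''n'' = nreg m ''n''" "nreg m' ''c'' = nreg m ''c''"
    "nreg m' ''k'' = nreg m ''k''" "nreg m' ''d'' = nreg m ''d''"
    "narr m' ''off'' = narr m ''off''" "narr m' ''adj'' = narr m ''adj''" "narr m' ''col'' = narr m ''col''"
    "narr m' ''pow2'' = narr m ''pow2''" "narr m' ''pow3'' = narr m ''pow3''"
    "narr m' ''PA'' = narr m ''PA''" "narr m' ''PC'' = narr m ''PC''" "narr m' ''sv'' = narr m ''sv''"
    "narr m' ''lab'' = narr m ''lab''" "rarr m' ''wt'' = rarr m ''wt''"
    using same unfolding same_def check_reads_def by simp_all
  show ?thesis
    using pre unfolding check_pre_def input_ok_def tables_ok_def selection_ok_def eqs .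
qed

lemma wp_sum_label:
  assumes m: "input_ok m" and x: "nreg m ''x'' = x" "x < n"
  shows "wp sum_label (\<lambda>t m'. t \<le> 60 * D \<and> rreg m' ''t'' =
    (\<Sum>u | u \<in> set (nbrs x) \<and> narr m ''lab'' u = nreg m ''lb''. \<omega> {x, u})) m"
proof -
  let ?g = "\<lambda>i. if narr m ''lab'' (nbrs x ! i) = nreg m ''lb'' then \<omega> {x, nbrs x ! i} else 0"
  have off: "narr m ''off'' x = off x" "narr m ''off'' (Suc x) = off x + length (nbrs x)"
    using m x by (auto simp: input_ok_def off_Suc)
  have nth: "narr m ''adj'' j = nbrs x ! (j - off x) \<and> rarr m ''wt'' j = \<omega> {x, nbrs x ! (j - off x)}"
    if "off x \<le> j" "j < off x + length (nbrs x)" for j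
  proof -
    have "j = off x + (j - off x)" "j - off x < length (nbrs x)" using that by auto
    then show ?thesis using m x unfolding input_ok_def by metis
  qed
  have sum: "(\<Sum>i<length (nbrs x). ?g i) = (\<Sum>u | u \<in> set (nbrs x) \<and> narr m ''lab'' u = nreg m ''lb''. \<omega> {x, u})"
  proof -
    let ?h = "\<lambda>u. if narr m ''lab'' u = nreg m ''lb'' then \<omega> {x, u} else 0"
    have "(\<Sum>i<length (nbrs x). ?g i) = sum ?h (set (nbrs x))"
      using distinct_nbrs[OF x(2)]
      by (intro sum.reindex_bij_betw[OF bij_betw_nth]) auto
    then show ?thesis by (simp add: sum.inter_filter)
  qed
  show ?thesis
    unfolding sum_label_def wp_Seq wp_SetR
  proof (rule wp_For[where h = "off x + length (nbrs x)" and T = 11 and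
        I = "\<lambda>j m'. rreg m' ''t'' = (\<Sum>i<j - off x. ?g i)"], goal_cases)
    case (4 j m')
    then have "Suc j - off x = Suc (j - off x)" using off x by simp
    then show ?case using 4 off x nth[of j] by (auto simp: wp_simps same_def)
  next
    case (5 t m')
    \<comment> \<open>Each of at most \<open>D + 1\<close> neighbours costs 22 steps and the
      overhead is 12; as \<open>D\<close> is at least 1, \<open>60 * D\<close> covers both.\<close>
    then show ?case using off x length_nbrs_le[OF x(2)] D_pos sum by (simp add: same_def)
  qed (use off x in \<open>auto simp: same_def\<close>)
qed

text \<open>Selected vertices carry labels above \<open>c\<close>, so a scan for a genuine colour
  passes over them.\<close>

lemma wp_sum_label_ext:
  assumes "check_pre ss m" "nreg m ''x'' = ss ! j" "j < length ss" "nreg m ''lb'' = i" "i \<le> c"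
  shows "wp sum_label (\<lambda>t m'. t \<le> 60 * D \<and> rreg m' ''t'' = ext_weight ss i j) m"
proof -
  have "set ss \<subseteq> {..<n}" using assms(1) by (simp add: check_pre_def selection_ok_def)
  then have x: "ss ! j < n" using nth_mem[OF assms(3)] by blast
  have "{u. u \<in> set (nbrs (ss ! j)) \<and> narr m ''lab'' u = nreg m ''lb''} =
    {u. u \<in> set (nbrs (ss ! j)) \<and> u \<notin> set ss \<and> \<chi> u = i}"
  proof (rule Collect_cong, rule conj_cong[OF refl])
    fix u assume "u \<in> set (nbrs (ss ! j))"
    then have u: "u < n" using nbrs_less[OF x] by simp
    show "(narr m ''lab'' u = nreg m ''lb'') = (u \<notin> set ss \<and> \<chi> u = i)"
      using assms u by (cases "u \<in> set ss") (auto simp: check_pre_def selection_ok_def in_set_conv_nth)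
  qed
  then show ?thesis
    using wp_sum_label[of m "ss ! j"] assms x by (simp add: ext_weight_def check_pre_def)
qed

text \<open>No colour reaches \<open>c + 1\<close>, so the label singles out \<open>ss ! l\<close>
  and the sum has at most one term.\<close>

lemma wp_sum_label_int:
  assumes "check_pre ss m" "nreg m ''x'' = ss ! j" "j < length ss" "nreg m ''lb'' = c + 1 + l" "l < length ss"
  shows "wp sum_label (\<lambda>t m'. t \<le> 60 * D \<and> rreg m' ''t'' = int_weight ss j l) m"
proof -
  have "set ss \<subseteq> {..<n}" using assms(1) by (simp add: check_pre_def selection_ok_def)
  then have x: "ss ! j < n" using nth_mem[OF assms(3)] by blast
  have "{u. u \<in> set (nbrs (ss ! j)) \<and> narr m ''lab'' u = nreg m ''lb''} =
    {u. u \<in> set (nbrs (ss ! j)) \<and> u = ss ! l}"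
  proof (rule Collect_cong, rule conj_cong[OF refl])
    fix u assume "u \<in> set (nbrs (ss ! j))"
    then have u: "u < n" using nbrs_less[OF x] by simp
    show "(narr m ''lab'' u = nreg m ''lb'') = (u = ss ! l)"
    proof (cases "u \<in> set ss")
      case True
      then obtain l' where "l' < length ss" "u = ss ! l'" by (auto simp: in_set_conv_nth)
      then show ?thesis using assms by (auto simp: check_pre_def selection_ok_def nth_eq_iff_index_eq)
    next
      case False
      then have "narr m ''lab'' u = \<chi> u" "u \<noteq> ss ! l"
        using assms u by (auto simp: check_pre_def selection_ok_def)
      then show ?thesis using colour_bounds[OF u] assms by auto
    qed
  qed
  also have "\<dots> = (if {ss ! j, ss ! l} \<in> E then {ss ! l} else {})"
    using x by (auto simp: set_nbrs)
  finally have eq: "{u. u \<in> set (nbrs (ss ! j)) \<and> narr m ''lab'' u = nreg m ''lb''} =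
    (if {ss ! j, ss ! l} \<in> E then {ss ! l} else {})" .
  have "input_ok m" using assms(1) by (simp add: check_pre_def)
  from wp_sum_label[OF this assms(2) x, unfolded eq] show ?thesis
    by (cases "{ss ! j, ss ! l} \<in> E") (simp_all add: int_weight_def)
qed

end

section \<open>Recurrence for optimal recolourings\<close>

definition opt :: "(nat \<Rightarrow> nat \<Rightarrow> rat) \<Rightarrow> (nat \<Rightarrow> nat \<Rightarrow> rat) \<Rightarrow> nat \<Rightarrow> nat set \<Rightarrow> rat \<Rightarrow> bool" where
  "opt a b i A x \<longleftrightarrow> (\<exists>f. (\<forall>j\<in>A. f j \<in> {1..i}) \<and> mono_cost a b f A = x) \<and>
     (\<forall>f. (\<forall>j\<in>A. f j \<in> {1..i}) \<longrightarrow> x \<le> mono_cost a b f A)"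

lemma opt_1: "opt a b 1 A (mono_cost a b (\<lambda>_. 1) A)"
proof -
  have "mono_cost a b f A = mono_cost a b (\<lambda>_. 1) A" if "\<forall>j\<in>A. f j \<in> {1..1}" for f
    using that by (intro mono_cost_cong) auto
  then show ?thesis unfolding opt_def by (metis atLeastAtMost_singleton order_refl singletonI)
qed

lemma opt_extend:
  assumes "opt a b (i - 1) C x" "C \<subseteq> A" "finite A" "1 \<le> i"
  shows "\<exists>f. (\<forall>j\<in>A. f j \<in> {1..i}) \<and> mono_cost a b f A = x + mono_cost a b (\<lambda>_. i) (A - C)"
proof -
  from assms(1) obtain f where f: "\<forall>j\<in>C. f j \<in> {1..i - 1}" "mono_cost a b f C = x"
    unfolding opt_def by blast
  let ?g = "\<lambda>j. if j \<in> C then f j else i"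
  have "{j \<in> A. ?g j = i} = A - C" "A - (A - C) = C" using f(1) assms(2,4) by fastforce+
  then have "mono_cost a b ?g A = mono_cost a b ?g C + mono_cost a b (\<lambda>_. i) (A - C)"
    using mono_cost_split_colour[OF assms(3), of "A - C" ?g i a b] by simp
  moreover have "mono_cost a b ?g C = x" unfolding f(2)[symmetric] by (intro mono_cost_cong) auto
  moreover have "\<forall>j\<in>A. ?g j \<in> {1..i}" using f(1) assms(4) by fastforce
  ultimately show ?thesis by (intro exI[of _ ?g]) simp
qed

text \<open>A colouring \<open>f\<close> is compared with the choice of \<open>C\<close> as all
  vertices that \<open>f\<close> does not colour \<open>i\<close>: there \<open>f\<close> uses
  smaller colours only, and \<open>mono_cost_split_colour\<close> adds the class of
  \<open>i\<close>.\<close>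

lemma opt_stepI:
  assumes "1 \<le> i" "finite A"
    and "\<exists>f. (\<forall>j\<in>A. f j \<in> {1..i}) \<and> mono_cost a b f A = x"
    and "\<And>C. C \<subseteq> A \<Longrightarrow> opt a b (i - 1) C (M C) \<and> x \<le> M C + mono_cost a b (\<lambda>_. i) (A - C)"
  shows "opt a b i A x"
  unfolding opt_def
proof (intro conjI allI impI)
  fix f assume f: "\<forall>j\<in>A. f j \<in> {1..i}"
  define B where "B = {j \<in> A. f j = i}"
  have B: "A - B \<subseteq> A" "A - (A - B) = B" by (auto simp: B_def)
  have "\<forall>j\<in>A - B. f j \<in> {1..i - 1}"
  proof
    fix j assume "j \<in> A - B"
    then have "1 \<le> f j" "f j \<le> i" "f j \<noteq> i" using f by (auto simp: B_def)
    then show "f j \<in> {1..i - 1}" by auto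
  qed
  then have "M (A - B) \<le> mono_cost a b f (A - B)" using assms(4)[OF B(1)] unfolding opt_def by blast
  moreover have "x \<le> M (A - B) + mono_cost a b (\<lambda>_. i) B" using assms(4)[OF B(1)] B(2) by simp
  ultimately show "x \<le> mono_cost a b f A"
    using mono_cost_split_colour[OF assms(2) B_def, of a b] by linarith
qed (rule assms(3))

context cut_instance
begin

lemma check_preD:
  assumes "check_pre ss m"
  shows "nreg m ''c'' = c" "nreg m ''d'' = length ss" "length ss \<le> k" "ss \<noteq> []"
    "\<And>j. j \<le> k \<Longrightarrow> narr m ''pow2'' j = 2 ^ j" "\<And>j. j \<le> k \<Longrightarrow> narr m ''pow3'' j = 3 ^ j"
    "\<And>j. j < length ss \<Longrightarrow> narr m ''sv'' j = ss ! j"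
    "\<And>j. j < length ss \<Longrightarrow> ss ! j < n"
    "\<And>v. v < n \<Longrightarrow> narr m ''col'' v = \<chi> v"
    "(\<lambda>q. (narr m ''PA'' q, narr m ''PC'' q)) ` {..<3 ^ length ss} =
      subset_pairs (length ss)"
  using assms unfolding check_pre_def input_ok_def selection_ok_def tables_ok_def
  by (auto dest: nth_mem)

text \<open>A common unit for the cost of a check: it dominates \<open>D\<close>, the number of
  subsets and the number of pairs.\<close>

definition table_size :: "nat list \<Rightarrow> nat" where
  "table_size ss = D * 3 ^ length ss"

lemma table_size_bounds:
  shows "1 \<le> table_size ss" "D \<le> table_size ss" "3 ^ length ss \<le> table_size ss" "j \<le> length ss \<Longrightarrow> 2 ^ j \<le> table_size ss"
proof -
  show *: "3 ^ length ss \<le> table_size ss" using D_pos by (simp add: table_size_def)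
  then show "1 \<le> table_size ss" using one_le_power[of "3::nat" "length ss"] by linarith
  show "D \<le> table_size ss" by (simp add: table_size_def)
  assume "j \<le> length ss"
  then have "(2::nat) ^ j \<le> 2 ^ length ss" by (intro power_increasing) auto
  also have "\<dots> \<le> 3 ^ length ss" by (intro power_mono) auto
  finally show "2 ^ j \<le> table_size ss" using * by linarith
qed

lemma wp_fill_Y:
  assumes pre: "check_pre ss m" and i: "nreg m ''i'' = i" "i \<le> c"
    and j: "nreg m ''j'' = j" "j < length ss" and x: "nreg m ''x'' = ss ! j"
  shows "wp fill_Y (\<lambda>t m'. t \<le> 110 * table_size ss * length ss \<and>
    subset_table j (rarr m' ''Y'') (\<lambda>B. ext_weight ss i j + (\<Sum>l\<in>B. int_weight ss j l))) m"
  unfolding fill_Y_def wp_Seq wp_SetN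
proof (rule wp_mono)
  let ?m = "m\<lparr>nreg := (nreg m)(''lb'' := nval (NReg ''i'') m)\<rparr>"
  let ?F = "\<lambda>B. ext_weight ss i j + (\<Sum>l\<in>B. int_weight ss j l)"
  let ?U = "table_size ss"
  have pre1: "check_pre ss ?m"
    by (rule check_pre_same[OF pre, of "{NR ''lb''}"]) (auto simp: same_def check_reads_def)
  show "wp sum_label (\<lambda>t m'. t \<le> 60 * D \<and> rreg m' ''t'' = ext_weight ss i j) ?m"
    by (rule wp_sum_label_ext[OF pre1]) (use i j x in auto)
  fix t1 m1
  assume t1: "t1 \<le> 60 * D \<and> rreg m1 ''t'' = ext_weight ss i j" and s1: "same (writes sum_label) ?m m1"
  let ?m1 = "m1\<lparr>rarr := (rarr m1)(''Y'' := (rarr m1 ''Y'')(nval (NConst 0) m1 := rval (RReg ''t'') m1))\<rparr>"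
  have s1': "same {NR ''lb'', NR ''p'', RR ''t'', RA ''Y''} m ?m1"
    using s1 by (simp add: same_def writes_sum_label)
  have "wp (For ''l'' (NConst 0) (NReg ''j'')
        (Seq (SetN ''lb'' (NAdd (NAdd (NReg ''c'') (NConst 1)) (NReg ''l'')))
          (Seq sum_label (double_table ''Y'' ''l'' (RReg ''t'')))))
     (\<lambda>t m'. t \<le> j * (97 * ?U + 8) + 6 \<and> subset_table j (rarr m' ''Y'') ?F) ?m1"
  proof (rule wp_For[where h = j and T = "97 * ?U" and I = "\<lambda>l m'. subset_table l (rarr m' ''Y'') ?F"], goal_cases)
    case 1
    then show ?case using t1 by (simp add: subset_table_def)
  next
    case (2 l m')
    then show ?case using s1' j by (simp add: same_def writes_sum_label writes_double_table)
  next
    case (4 l m')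
    let ?X = "{NR ''lb'', NR ''p'', RR ''t'', RA ''Y'', NR ''l'', NR ''q''}"
    have s: "same ?X m m'"
      by (rule same_trans[OF same_mono[OF s1'] same_mono[OF 4(4)]])
        (auto simp: writes_sum_label writes_double_table)
    let ?m' = "m'\<lparr>nreg := (nreg m')(''lb'' := nval (NAdd (NAdd (NReg ''c'') (NConst 1)) (NReg ''l'')) m')\<rparr>"
    have s2: "same ?X m ?m'" using s by (simp add: same_def)
    have pre2: "check_pre ss ?m'"
      by (rule check_pre_same[OF pre s2]) (auto simp: check_reads_def)
    have l: "l < j" using 4 by simp
    show ?case
      unfolding wp_Seq wp_SetN
    proof (rule wp_mono)
      show "wp sum_label (\<lambda>t m'. t \<le> 60 * D \<and> rreg m' ''t'' = int_weight ss j l) ?m'"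
        by (rule wp_sum_label_int[OF pre2])
          (use s2 l j x 4(5) check_preD(1)[OF pre] in \<open>simp_all add: same_def\<close>)
      fix t2 m2
      assume t2: "t2 \<le> 60 * D \<and> rreg m2 ''t'' = int_weight ss j l" and s3: "same (writes sum_label) ?m' m2"
      have s4: "same ?X m m2"
        by (rule same_trans[OF s2 same_mono[OF s3]]) (auto simp: writes_sum_label)
      have pre3: "check_pre ss m2"
        by (rule check_pre_same[OF pre s4]) (auto simp: check_reads_def)
      have l2: "nreg m2 ''l'' = l" using s3 4(5) by (simp add: same_def writes_sum_label)
      have Y2: "rarr m2 ''Y'' = rarr m' ''Y''" using s3 by (simp add: same_def writes_sum_label)
      have lk: "l \<le> k" using l j check_preD(3)[OF pre] by simp
      show "wp (double_table ''Y'' ''l'' (RReg ''t''))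
        (\<lambda>t' m''. ncost (NAdd (NAdd (NReg ''c'') (NConst 1)) (NReg ''l'')) + 1 + (t2 + t') \<le> 97 * ?U \<and>
           nreg m'' ''l'' = l \<and>
           subset_table (Suc l) (rarr (m''\<lparr>nreg := (nreg m'')(''l'' := Suc l)\<rparr>) ''Y'') ?F) m2"
      proof (rule wp_mono[OF wp_double_table[where P = "2 ^ l" and g = "\<lambda>_. int_weight ss j l"]], goal_cases)
        case 1
        then show ?case using l2 check_preD(5)[OF pre3 lk] by simp
      next
        case (3 m')
        then show ?case using t2 by (simp add: same_def)
      next
        case (4 t3 m3)
        have "2 ^ l \<le> ?U" using table_size_bounds(4)[of l ss] l j by simp
        \<comment> \<open>60 for the scan, 21 for the table entries and 16 for constants add up to
          97.\<close>
        then have t: "6 + (t2 + t3) \<le> 97 * ?U"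
          using 4(1) t2 table_size_bounds(1,2)[of ss] by simp
        have "subset_table (Suc l) (rarr m3 ''Y'') ?F"
        proof (rule subset_table_Suc[where brr = "\<lambda>_. int_weight ss j l" and G = "\<lambda>_. int_weight ss j l"])
          show "subset_table l (rarr m2 ''Y'') ?F" using \<open>subset_table l (rarr m' ''Y'') ?F\<close> Y2 by simp
          show "?F (insert l B) = ?F B + int_weight ss j l" if "B \<subseteq> {..<l}" for B
          proof -
            have "finite B" "l \<notin> B" using that finite_subset by auto
            then show ?thesis by simp
          qed
        qed (use 4(1) in \<open>auto simp: subset_table_def\<close>)
        then show ?case using t 4(2) l2 by (simp add: same_def writes_double_table)
      qed simp
    qed
  qed (auto simp: add.commute)
  then show "wp (SetRArr ''Y'' (NConst 0) (RReg ''t'')) (\<lambda>t' m'. wp (For ''l'' (NConst 0) (NReg ''j'')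
        (Seq (SetN ''lb'' (NAdd (NAdd (NReg ''c'') (NConst 1)) (NReg ''l'')))
          (Seq sum_label (double_table ''Y'' ''l'' (RReg ''t'')))))
     (\<lambda>t'' m'. ncost (NReg ''i'') + 1 + (t1 + (t' + t'')) \<le> 110 * ?U * length ss \<and>
        subset_table j (rarr m' ''Y'') ?F) m') m1"
    unfolding wp_SetRArr
  proof (rule wp_mono)
    fix t m'
    assume *: "t \<le> j * (97 * ?U + 8) + 6 \<and> subset_table j (rarr m' ''Y'') ?F"
    have "j * (97 * ?U + 8) = 97 * (?U * j) + 8 * j" by (simp add: algebra_simps)
    moreover have "j \<le> ?U * j" using mult_le_mono1[OF table_size_bounds(1), of j ss] by simp
    moreover have "?U * j + ?U \<le> ?U * length ss" using j mult_le_mono2[of "Suc j" "length ss" ?U] by simp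
    ultimately have "t1 + t + 5 \<le> 110 * ?U * length ss"
      using *[THEN conjunct1] t1[THEN conjunct1] table_size_bounds(1,2)[of ss] by linarith
    then show "ncost (NReg ''i'') + 1 + (t1 + (ncost (NConst 0) + rcost (RReg ''t'') + 1 + t))
        \<le> 110 * ?U * length ss \<and> subset_table j (rarr m' ''Y'') ?F"
      using * by simp
  qed
qed

lemma wp_fill_W:
  assumes pre: "check_pre ss m" and i: "nreg m ''i'' = i" "i \<le> c"
  shows "wp fill_W (\<lambda>t m'. t \<le> 180 * table_size ss * (length ss)\<^sup>2 \<and>
    subset_table (length ss) (rarr m' ''W'') (touch_cost ss (\<lambda>_. i)) \<and>
    nreg m' ''mask'' = set_encode {j. j < length ss \<and> \<chi> (ss ! j) = i}) m"
proof -
  let ?U = "table_size ss" and ?s = "length ss"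
  let ?m0 = "m\<lparr>rarr := (rarr m)(''W'' := (rarr m ''W'')(0 := 0))\<rparr>"
  let ?m = "?m0\<lparr>nreg := (nreg ?m0)(''mask'' := 0)\<rparr>"
  let ?body = "Seq (SetN ''x'' (NArr ''sv'' (NReg ''j'')))
        (Seq fill_Y
          (Seq (double_table ''W'' ''j'' (RArr ''Y'' (NReg ''q'')))
            (Cond (NEq (NArr ''col'' (NReg ''x'')) (NReg ''i''))
              (SetN ''mask'' (NAdd (NReg ''mask'') (NArr ''pow2'' (NReg ''j'')))) Skip)))"
  let ?I = "\<lambda>j m'. subset_table j (rarr m' ''W'') (touch_cost ss (\<lambda>_. i)) \<and>
     nreg m' ''mask'' = set_encode {j'. j' < j \<and> \<chi> (ss ! j') = i}"
  have s_pos: "1 \<le> ?s" using check_preD(4)[OF pre] by (simp add: Suc_le_eq)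
  have s1: "same (writes fill_W) m ?m" by (simp add: same_def writes_fill_W)
  have loop: "wp (For ''j'' (NConst 0) (NReg ''d'') ?body)
     (\<lambda>t m'. t \<le> ?s * (155 * ?U * ?s + 8) + 6 \<and> ?I ?s m') ?m"
  proof (rule wp_For[where h = ?s and T = "155 * ?U * ?s" and I = ?I], goal_cases)
    case 1
    then show ?case by (simp add: subset_table_def)
  next
    case (2 j m')
    then show ?case using check_preD(2)[OF pre] by (simp add: same_def writes_fill_Y writes_double_table)
  next
    case (4 j m')
    let ?m' = "m'\<lparr>nreg := (nreg m')(''x'' := nval (NArr ''sv'' (NReg ''j'')) m')\<rparr>"
    have s: "same (writes fill_W) m m'"
      by (rule same_trans[OF s1 same_mono[OF 4(4)]])
        (auto simp: writes_fill_W writes_fill_Y writes_double_table)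
    then have s2: "same (writes fill_W) m ?m'" by (simp add: same_def writes_fill_W)
    have pre2: "check_pre ss ?m'"
      by (rule check_pre_same[OF pre s2]) (auto simp: check_reads_def writes_fill_W)
    have j: "j < ?s" using 4 by simp
    have x: "nreg ?m' ''x'' = ss ! j" using 4(5) check_preD(7)[OF pre2 j] by simp
    show ?case
      unfolding wp_Seq wp_SetN
    proof (rule wp_mono[OF wp_fill_Y[OF pre2 _ i(2) _ j x]], goal_cases)
      case 1
      then show ?case using s2 i by (simp add: same_def writes_fill_W)
    next
      case 2
      then show ?case using 4(5) by simp
    next
      case (3 t2 m2)
      note Y = 3(1) and s3 = 3(2)
      have s4: "same (writes fill_W) m m2"
        by (rule same_trans[OF s2 same_mono[OF s3]]) (auto simp: writes_fill_W writes_fill_Y)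
      have pre3: "check_pre ss m2"
        by (rule check_pre_same[OF pre s4]) (auto simp: check_reads_def writes_fill_W)
      have j2: "nreg m2 ''j'' = j" and W2: "rarr m2 ''W'' = rarr m' ''W''"
        and x2: "nreg m2 ''x'' = ss ! j" and i2: "nreg m2 ''i'' = i"
        and mask2: "nreg m2 ''mask'' = nreg m' ''mask''"
        using s3 4(5) x s2 i by (simp_all add: same_def writes_fill_Y writes_fill_W)
      have jk: "j \<le> k" using j check_preD(3)[OF pre] by simp
      have Yt: "subset_table j (rarr m2 ''Y'') (\<lambda>B. ext_weight ss i j + (\<Sum>l\<in>B. int_weight ss j l))"
        and t2: "t2 \<le> 110 * ?U * ?s"
        using Y by auto
      show ?case
      proof (rule wp_mono[OF wp_double_table[where P = "2 ^ j" and g = "rarr m2 ''Y''"]], goal_cases)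
        case 1
        then show ?case using j2 check_preD(5)[OF pre3 jk] by simp
      next
        case (3 m'')
        then show ?case by (simp add: same_def)
      next
        case (4 t3 m3)
        note s5 = 4(2)
        have st: "subset_table (Suc j) (rarr m3 ''W'') (touch_cost ss (\<lambda>_. i))"
        proof (rule subset_table_Suc[OF _ Yt])
          show "subset_table j (rarr m2 ''W'') (touch_cost ss (\<lambda>_. i))" using \<open>?I j m'\<close> W2 by simp
          show "touch_cost ss (\<lambda>_. i) (insert j B) =
            touch_cost ss (\<lambda>_. i) B + (ext_weight ss i j + (\<Sum>l\<in>B. int_weight ss j l))"
            if "B \<subseteq> {..<j}" for B
            using mono_cost_insert[OF that, of "ext_weight ss" "int_weight ss" "\<lambda>_. i"] by simp
        qed (use 4(1) in auto)
        have "2 ^ j \<le> ?U" using table_size_bounds(4)[of j ss] j by simp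
        moreover have "t3 \<le> 22 * 2 ^ j + 10" using 4(1) by simp
        moreover have "?U \<le> ?U * ?s" using mult_le_mono2[OF s_pos, of ?U] by simp
        \<comment> \<open>110 from \<open>fill_Y\<close>, 32 from doubling the table and 13 for the
          rest.\<close>
        ultimately have t: "t2 + t3 + 13 \<le> 155 * ?U * ?s"
          using t2 table_size_bounds(1)[of ss] by linarith
        have eqs: "nreg m3 ''j'' = j" "nreg m3 ''x'' = ss ! j" "nreg m3 ''i'' = i"
          "nreg m3 ''mask'' = set_encode {j'. j' < j \<and> \<chi> (ss ! j') = i}"
          "narr m3 ''col'' (ss ! j) = \<chi> (ss ! j)" "narr m3 ''pow2'' j = 2 ^ j"
          using s5 j2 x2 i2 mask2 \<open>?I j m'\<close> check_preD(5)[OF pre3 jk] check_preD(9)[OF pre3 check_preD(8)[OF pre3 j]]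
          by (simp_all add: same_def writes_double_table)
        have "{j'. j' < Suc j \<and> \<chi> (ss ! j') = i} = (if \<chi> (ss ! j) = i
          then insert j {j'. j' < j \<and> \<chi> (ss ! j') = i} else {j'. j' < j \<and> \<chi> (ss ! j') = i})"
          by (auto simp: less_Suc_eq)
        then have mask: "set_encode {j'. j' < Suc j \<and> \<chi> (ss ! j') = i} =
          set_encode {j'. j' < j \<and> \<chi> (ss ! j') = i} + (if \<chi> (ss ! j) = i then 2 ^ j else 0)"
          by (simp add: set_encode_add subset_iff)
        show ?case
          using st t eqs mask by (simp add: wp_simps)
      qed simp
    qed
  qed (auto simp: add.commute)
  show ?thesis
    unfolding fill_W_def wp_Seq wp_SetN wp_SetRArr nval.simps rval.simps
  proof (rule wp_mono[OF loop], goal_cases)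
    case (1 t m')
    have "?s * (155 * ?U * ?s + 8) \<le> ?s * (163 * ?U * ?s)"
      using mult_le_mono[OF table_size_bounds(1)[of ss] s_pos] by (intro mult_le_mono2) simp
    also have "\<dots> = 163 * ?U * ?s\<^sup>2" by (simp add: power2_eq_square)
    finally have "?s * (155 * ?U * ?s + 8) \<le> 163 * ?U * ?s\<^sup>2" .
    moreover have "1 \<le> ?U * ?s\<^sup>2" using table_size_bounds(1)[of ss] s_pos by simp
    ultimately have "t + 5 \<le> 180 * ?U * ?s\<^sup>2" using 1(1)[THEN conjunct1] by linarith
    then show ?case using 1 by simp
  qed
qed

text \<open>The loop keeps each entry of \<open>N\<close> attained by an actual colouring and no
  larger than the value of any pair already treated. As \<open>M\<close> and \<open>W\<close> are
  only read, these values are fixed in advance and any order of the pairs will do.\<close>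

lemma wp_min_plus:
  assumes pre: "check_pre ss m" and i: "nreg m ''i'' = i" "1 \<le> i"
    and W: "subset_table (length ss) (rarr m ''W'') (touch_cost ss (\<lambda>_. i))"
    and N: "\<And>q. q < 2 ^ length ss \<Longrightarrow> rarr m ''N'' q = rarr m ''W'' q"
    and M: "\<And>A. 1 < i \<Longrightarrow> A \<subseteq> {..<length ss} \<Longrightarrow>
      opt (ext_weight ss) (int_weight ss) (i - 1) A (rarr m ''M'' (set_encode A))"
  shows "wp min_plus (\<lambda>t m'. t \<le> 50 * table_size ss \<and> (\<forall>A\<subseteq>{..<length ss}.
    opt (ext_weight ss) (int_weight ss) i A (rarr m' ''N'' (set_encode A)))) m"
proof (cases "1 < i")
  case False
  then have "i = 1" using i by simp
  then show ?thesis
    unfolding min_plus_def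
    using i N W table_size_bounds(1)[of ss] opt_1[of "ext_weight ss" "int_weight ss"]
    by (simp add: wp_simps subset_table_def set_encode_less)
next
  case True
  let ?U = "table_size ss" and ?s = "length ss"
  let ?PA = "narr m ''PA''" and ?PC = "narr m ''PC''" and ?M = "rarr m ''M''" and ?W = "rarr m ''W''"
  let ?val = "\<lambda>q. ?M (?PC q) + ?W (?PA q - ?PC q)"
  let ?ach = "\<lambda>A x. \<exists>f. (\<forall>j\<in>A. f j \<in> {1..i}) \<and> touch_cost ss f A = x"
  note pairs = check_preD(10)[OF pre]
  have Wi: "?W (set_encode B) = touch_cost ss (\<lambda>_. i) B" if "B \<subseteq> {..<?s}" for B
    using W that by (simp add: subset_table_def)
  have ach: "?ach A (?val q)" if q: "q < 3 ^ ?s" "?PA q = set_encode A" "A \<subseteq> {..<?s}" for q A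
  proof -
    have "(?PA q, ?PC q) \<in> {(set_encode A, set_encode C) | A C. C \<subseteq> A \<and> A \<subseteq> {..<?s}}"
      using q(1) unfolding pairs[symmetric] by blast
    then obtain A' C where A': "?PA q = set_encode A'" "?PC q = set_encode C" "C \<subseteq> A'" "A' \<subseteq> {..<?s}"
      by blast
    then have [simp]: "A' = A" using q set_encode_eq_iff by metis
    have C: "C \<subseteq> {..<?s}" "A - C \<subseteq> {..<?s}" "finite A" using A' q(3) finite_subset by auto
    have "?val q = ?M (set_encode C) + touch_cost ss (\<lambda>_. i) (A - C)"
      using A' q Wi[OF C(2)] by (simp add: set_encode_diff)
    then show ?thesis
      using opt_extend[OF M[OF True C(1)] _ C(3) i(2)] A'(3) by simp
  qed
  have loop: "wp (For ''q'' (NConst 0) (NArr ''pow3'' (NReg ''d''))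
      (Cond (RLess pair_value (RArr ''N'' (NArr ''PA'' (NReg ''q''))))
        (SetRArr ''N'' (NArr ''PA'' (NReg ''q'')) pair_value) Skip))
    (\<lambda>t m'. t \<le> 3 ^ ?s * 37 + 7 \<and> (\<forall>A\<subseteq>{..<?s}. opt (ext_weight ss) (int_weight ss) i A (rarr m' ''N'' (set_encode A)))) m"
  proof (rule wp_For[where h = "3 ^ ?s" and T = 28 and I = "\<lambda>q m'. \<forall>A\<subseteq>{..<?s}.
      ?ach A (rarr m' ''N'' (set_encode A)) \<and>
      (\<forall>q'<q. ?PA q' = set_encode A \<longrightarrow> rarr m' ''N'' (set_encode A) \<le> ?val q')"], goal_cases)
    case 1
    have "?ach A (rarr m ''N'' (set_encode A))" if "A \<subseteq> {..<?s}" for A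
      using N[OF set_encode_less[OF that]] Wi[OF that] i(2) by (intro exI[of _ "\<lambda>_. i"]) auto
    then show ?case by simp
  next
    case (2 j m')
    then show ?case using check_preD(2,3)[OF pre] check_preD(6)[OF pre] by (simp add: same_def)
  next
    case (4 q m')
    have v: "rval pair_value m' = ?val q" "narr m' ''PA'' q = ?PA q"
      using 4(4,5) by (simp_all add: pair_value_def same_def)
    have c: "rcost pair_value = 10" by (simp add: pair_value_def)
    show ?case
    proof (cases "?val q < rarr m' ''N'' (?PA q)")
      case True
      let ?N' = "(rarr m' ''N'')(?PA q := ?val q)"
      have "?ach A (?N' (set_encode A)) \<and>
        (\<forall>q'<Suc q. ?PA q' = set_encode A \<longrightarrow> ?N' (set_encode A) \<le> ?val q')" if A: "A \<subseteq> {..<?s}" for A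
      proof (cases "?PA q = set_encode A")
        case eq: True
        then show ?thesis
          using ach[OF 4(3) eq A] 4(1) A True by (auto simp: less_Suc_eq) fastforce
      next
        case False
        then show ?thesis using 4(1) A by (auto simp: less_Suc_eq)
      qed
      then show ?thesis using True v c 4(5) by (simp add: wp_simps)
    next
      case False
      have "?ach A (rarr m' ''N'' (set_encode A)) \<and>
        (\<forall>q'<Suc q. ?PA q' = set_encode A \<longrightarrow> rarr m' ''N'' (set_encode A) \<le> ?val q')" if "A \<subseteq> {..<?s}" for A
        using 4(1) that False by (auto simp: less_Suc_eq)
      then show ?thesis using False v c 4(5) by (simp add: wp_simps)
    qed
  next
    case (5 t m')
    have "opt (ext_weight ss) (int_weight ss) i A (rarr m' ''N'' (set_encode A))" if A: "A \<subseteq> {..<?s}" for A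
    proof (rule opt_stepI[OF i(2)])
      show "finite A" using A finite_subset by blast
      show "?ach A (rarr m' ''N'' (set_encode A))" using 5(1) A by blast
      fix C assume C: "C \<subseteq> A"
      then have sub: "C \<subseteq> {..<?s}" "A - C \<subseteq> {..<?s}" using A by auto
      have "(set_encode A, set_encode C) \<in> (\<lambda>q. (?PA q, ?PC q)) ` {..<3 ^ ?s}"
        unfolding pairs using A C by blast
      then obtain q where q: "q < 3 ^ ?s" "?PA q = set_encode A" "?PC q = set_encode C" by auto
      have "rarr m' ''N'' (set_encode A) \<le> ?val q" using 5(1) A q by blast
      then show "opt (ext_weight ss) (int_weight ss) (i - 1) C (?M (set_encode C)) \<and>
        rarr m' ''N'' (set_encode A) \<le> ?M (set_encode C) + touch_cost ss (\<lambda>_. i) (A - C)"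
        using M[OF True sub(1)] q Wi[OF sub(2)] by (simp add: set_encode_diff[OF C A])
    qed
    then show ?case using 5(4) by simp
  qed simp
  have b: "bval (NLess (NConst 1) (NReg ''i'')) m" using i True by simp
  show ?thesis
    unfolding min_plus_def wp_Cond if_P[OF b]
  proof (rule wp_mono[OF loop], goal_cases)
    case (1 t m')
    then show ?case using table_size_bounds(1,3)[of ss] by simp
  qed
qed

lemma wp_colour_step:
  assumes pre: "check_pre ss m" and i: "nreg m ''i'' = i" "1 \<le> i" "i \<le> c"
    and base: "rreg m ''base'' = touch_cost ss (\<lambda>j. \<chi> (ss ! j)) {j. j < length ss \<and> \<chi> (ss ! j) < i}"
    and M: "\<And>A. 1 < i \<Longrightarrow> A \<subseteq> {..<length ss} \<Longrightarrow>
      opt (ext_weight ss) (int_weight ss) (i - 1) A (rarr m ''M'' (set_encode A))"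
  shows "wp colour_step (\<lambda>t m'. t \<le> 300 * table_size ss * (length ss)\<^sup>2 \<and>
    rreg m' ''base'' = touch_cost ss (\<lambda>j. \<chi> (ss ! j)) {j. j < length ss \<and> \<chi> (ss ! j) < Suc i} \<and>
    (\<forall>A\<subseteq>{..<length ss}. opt (ext_weight ss) (int_weight ss) i A (rarr m' ''M'' (set_encode A)))) m"
proof -
  let ?U = "table_size ss" and ?s = "length ss" and ?f = "\<lambda>j. \<chi> (ss ! j)"
  let ?B = "{j. j < ?s \<and> \<chi> (ss ! j) = i}"
  \<comment> \<open>\<open>mask\<close> encodes the original class of colour \<open>i\<close>, whose
    monochromatic weight stands in \<open>W\<close>; adding it extends the original weight by one
    class.\<close>
  have base_split: "touch_cost ss ?f {j. j < ?s \<and> ?f j < Suc i} =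
    touch_cost ss ?f {j. j < ?s \<and> ?f j < i} + touch_cost ss (\<lambda>_. i) ?B"
  proof -
    have "?B = {j \<in> {j. j < ?s \<and> ?f j < Suc i}. ?f j = i}" by auto
    moreover have "{j. j < ?s \<and> ?f j < Suc i} - ?B = {j. j < ?s \<and> ?f j < i}" by auto
    ultimately show ?thesis
      using mono_cost_split_colour[of "{j. j < ?s \<and> ?f j < Suc i}" ?B ?f i "ext_weight ss" "int_weight ss"] by simp
  qed
  have s_pos: "1 \<le> ?s" using check_preD(4)[OF pre] by (simp add: Suc_le_eq)
  have pow: "2 ^ ?s \<le> ?U" using table_size_bounds(4) by simp
  show ?thesis
    unfolding colour_step_def wp_Seq wp_SetR
  proof (rule wp_mono[OF wp_fill_W[OF pre i(1,3)]], goal_cases)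
    case (1 t1 m1)
    note W1 = 1(1) and s1 = 1(2)
    let ?m1 = "m1\<lparr>rreg := (rreg m1)(''base'' := rval (RAdd (RReg ''base'') (RArr ''W'' (NReg ''mask''))) m1)\<rparr>"
    have s1': "same (writes colour_step) m ?m1"
      using s1 by (simp add: same_def writes_fill_W writes_colour_step)
    have pre1: "check_pre ss ?m1"
      by (rule check_pre_same[OF pre s1']) (auto simp: check_reads_def writes_colour_step)
    have base1: "rreg ?m1 ''base'' = touch_cost ss ?f {j. j < ?s \<and> ?f j < Suc i}"
    proof -
      have "rarr m1 ''W'' (set_encode ?B) = touch_cost ss (\<lambda>_. i) ?B"
        using W1[THEN conjunct2, THEN conjunct1, unfolded subset_table_def, rule_format, of ?B] by auto
      then show ?thesis using W1 s1 base base_split by (simp add: same_def writes_fill_W)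
    qed
    have P1: "narr ?m1 ''pow2'' (nreg ?m1 ''d'') = 2 ^ ?s"
      using check_preD(2,3)[OF pre1] check_preD(5)[OF pre1] by simp
    show ?case
    proof (rule wp_mono[OF wp_copy_table[OF P1]], goal_cases)
      case (2 t2 m2)
      note N2 = 2(1) and s2 = 2(2)
      have s2': "same (writes colour_step) m m2"
        by (rule same_trans[OF s1' same_mono[OF s2]]) (auto simp: writes_colour_step writes_copy_table)
      have pre2: "check_pre ss m2"
        by (rule check_pre_same[OF pre s2']) (auto simp: check_reads_def writes_colour_step)
      have M2: "rarr m2 ''M'' = rarr m ''M''" and W2: "rarr m2 ''W'' = rarr m1 ''W''"
        and i2: "nreg m2 ''i'' = i" and base2: "rreg m2 ''base'' = rreg ?m1 ''base''"
        using s1 s2 i by (simp_all add: same_def writes_fill_W writes_copy_table)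
      show ?case
      proof (rule wp_mono[OF wp_min_plus[OF pre2 i2 i(2)]], goal_cases)
        case 1
        then show ?case using W1 W2 by simp
      next
        case (2 q)
        then show ?case using N2 W2 by simp
      next
        case (3 A)
        then show ?case using M M2 by simp
      next
        case (4 t3 m3)
        note N3 = 4(1) and s3 = 4(2)
        have s3': "same (writes colour_step) m m3"
          by (rule same_trans[OF s2' same_mono[OF s3]]) (auto simp: writes_colour_step writes_min_plus)
        have pre3: "check_pre ss m3"
          by (rule check_pre_same[OF pre s3']) (auto simp: check_reads_def writes_colour_step)
        have P3: "narr m3 ''pow2'' (nreg m3 ''d'') = 2 ^ ?s"
          using check_preD(2,3)[OF pre3] check_preD(5)[OF pre3] by simp
        have base3: "rreg m3 ''base'' = rreg ?m1 ''base''"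
          using s3 base2 by (simp add: same_def writes_min_plus)
        show ?case
        proof (rule wp_mono[OF wp_copy_table[OF P3]], goal_cases)
          case (2 t4 m4)
          note M4 = 2(1) and s4 = 2(2)
          have "opt (ext_weight ss) (int_weight ss) i A (rarr m4 ''M'' (set_encode A))" if "A \<subseteq> {..<?s}" for A
            using N3 M4 that set_encode_less[OF that] by simp
          moreover have "rreg m4 ''base'' = rreg ?m1 ''base''"
            using s4 base3 by (simp add: same_def writes_copy_table)
          moreover have "?U * 1 \<le> ?U * ?s\<^sup>2" using s_pos by (intro mult_le_mono2) simp
          then have "t1 + (5 + (t2 + (t3 + t4))) \<le> 300 * ?U * ?s\<^sup>2"
            using W1[THEN conjunct1] N2[THEN conjunct1] N3[THEN conjunct1] M4[THEN conjunct1] pow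
              table_size_bounds(1)[of ss] by linarith
          ultimately show ?case using base1 by simp
        qed simp
      qed
    qed simp
  qed
qed

lemma wp_check_set:
  assumes pre: "check_pre ss m"
  shows "wp check_set (\<lambda>t m'. t \<le> 330 * c * table_size ss * (length ss)\<^sup>2 \<and>
    nreg m' ''res'' = (if improvable ss then 1 else nreg m ''res'')) m"
proof -
  let ?U = "table_size ss" and ?s = "length ss" and ?f = "\<lambda>j. \<chi> (ss ! j)"
  let ?m = "m\<lparr>rreg := (rreg m)(''base'' := 0)\<rparr>"
  have s_pos: "1 \<le> ?s" using check_preD(4)[OF pre] by (simp add: Suc_le_eq)
  have f: "1 \<le> ?f j \<and> ?f j \<le> c" if "j < ?s" for j
    using colour_bounds[OF check_preD(8)[OF pre that]] .
  have c_pos: "1 \<le> c" using f[of 0] s_pos by linarith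
  have s0: "same (writes check_set) m ?m" by (simp add: same_def writes_check_set)
  let ?I = "\<lambda>i m'. rreg m' ''base'' = touch_cost ss ?f {j. j < ?s \<and> ?f j < i} \<and>
    (1 < i \<longrightarrow> (\<forall>A\<subseteq>{..<?s}. opt (ext_weight ss) (int_weight ss) (i - 1) A (rarr m' ''M'' (set_encode A))))"
  have loop: "wp (For ''i'' (NConst 1) (NAdd (NReg ''c'') (NConst 1)) colour_step)
    (\<lambda>t m'. t \<le> c * (300 * ?U * ?s\<^sup>2 + 10) + 8 \<and> ?I (c + 1) m') ?m"
  proof (rule wp_For[where h = "c + 1" and T = "300 * ?U * ?s\<^sup>2" and I = ?I], goal_cases)
    case 1
    \<comment> \<open>Colours start at 1, so the weight gathered before the first round is that of
      the empty set.\<close>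
    have none: "{j. j < ?s \<and> ?f j = 0} = {}" using f by fastforce
    show ?case by (simp add: none)
  next
    case (2 i m')
    then show ?case using check_preD(1)[OF pre] by (simp add: same_def writes_colour_step)
  next
    case (4 i m')
    have s1: "same (writes check_set) m m'"
      by (rule same_trans[OF s0 same_mono[OF 4(4)]]) (auto simp: writes_check_set writes_colour_step)
    have pre1: "check_pre ss m'"
      by (rule check_pre_same[OF pre s1]) (auto simp: check_reads_def writes_check_set)
    show ?case
    proof (rule wp_mono[OF wp_colour_step[OF pre1 4(5)]], goal_cases)
      case (5 t m'')
      have "nreg m'' ''i'' = i" using 5(2) 4(5) by (simp add: same_def writes_colour_step)
      then show ?case using 5(1) by simp
    qed (use 4 in auto)
  next
    case (5 t m')
    then show ?case by (simp add: add.commute)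
  qed simp
  show ?thesis
    unfolding check_set_def wp_Seq wp_SetR rval.simps
  proof (rule wp_mono[OF loop], goal_cases)
    case (1 t1 m1)
    note I = 1(1) and s1 = 1(2)
    have s1': "same (writes check_set) m m1"
      by (rule same_trans[OF s0 same_mono[OF s1]]) (auto simp: writes_check_set writes_For writes_colour_step)
    have pre1: "check_pre ss m1"
      by (rule check_pre_same[OF pre s1']) (auto simp: check_reads_def writes_check_set)
    have P1: "narr m1 ''pow2'' (nreg m1 ''d'') = 2 ^ ?s"
      using check_preD(2,3)[OF pre1] check_preD(5)[OF pre1] by simp
    have "{j. j < ?s \<and> ?f j < c + 1} = {..<?s}" using f by (auto simp: less_Suc_eq_le)
    then have base: "rreg m1 ''base'' = touch_cost ss ?f {..<?s}" using I by simp
    have opt: "opt (ext_weight ss) (int_weight ss) c {..<?s} (rarr m1 ''M'' (2 ^ ?s - 1))"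
      using I c_pos set_encode_full[of ?s] by (metis Suc_eq_plus1 add_diff_cancel_right' le_imp_less_Suc subset_refl)
    have iff: "rarr m1 ''M'' (2 ^ ?s - 1) < rreg m1 ''base'' \<longleftrightarrow> improvable ss"
      using opt unfolding base opt_def improvable_def by (auto intro: le_less_trans)
    have res: "nreg m1 ''res'' = nreg m ''res''"
      using s1 by (simp add: same_def writes_For writes_colour_step)
    have "1 \<le> ?U * ?s\<^sup>2" using table_size_bounds(1)[of ss] s_pos by simp
    then have "c * 1 \<le> c * (?U * ?s\<^sup>2)" by (rule mult_le_mono2)
    moreover have "c * (300 * ?U * ?s\<^sup>2 + 10) = 300 * (c * (?U * ?s\<^sup>2)) + 10 * c"
      by (simp add: algebra_simps)
    ultimately have "t1 + 12 \<le> 330 * (c * (?U * ?s\<^sup>2))"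
      using I[THEN conjunct1] c_pos by linarith
    then have "t1 + 12 \<le> 330 * c * ?U * ?s\<^sup>2" by (simp add: mult.assoc)
    then show ?case
      using P1 iff res by (simp add: wp_simps)
  qed
qed

end

section \<open>The search program\<close>

text \<open>The position \<open>q < 3^j\<close>, read in base 3, encodes a pair \<open>(A, C)\<close> with \<open>C \<subseteq> A \<subseteq> {..<j}\<close>: the digits 0, 1, 2
  stand for not in \<open>A\<close>, in \<open>A - C\<close> and in \<open>C\<close>.\<close>

definition build_tables :: com where
  "build_tables =
    SetNArr ''pow2'' (NConst 0) (NConst 1) ;;
    SetNArr ''pow3'' (NConst 0) (NConst 1) ;;
    SetNArr ''PA'' (NConst 0) (NConst 0) ;;
    SetNArr ''PC'' (NConst 0) (NConst 0) ;;
    For ''j'' (NConst 0) (NReg ''k'')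
      (SetNArr ''pow2'' (NAdd (NReg ''j'') (NConst 1))
         (NAdd (NArr ''pow2'' (NReg ''j'')) (NArr ''pow2'' (NReg ''j''))) ;;
       SetNArr ''pow3'' (NAdd (NReg ''j'') (NConst 1))
         (NAdd (NArr ''pow3'' (NReg ''j'')) (NAdd (NArr ''pow3'' (NReg ''j'')) (NArr ''pow3'' (NReg ''j'')))) ;;
       For ''q'' (NConst 0) (NArr ''pow3'' (NReg ''j''))
         (SetNArr ''PA'' (NAdd (NArr ''pow3'' (NReg ''j'')) (NReg ''q''))
            (NAdd (NArr ''PA'' (NReg ''q'')) (NArr ''pow2'' (NReg ''j''))) ;;
          SetNArr ''PC'' (NAdd (NArr ''pow3'' (NReg ''j'')) (NReg ''q'')) (NArr ''PC'' (NReg ''q'')) ;;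
          SetNArr ''PA'' (NAdd (NAdd (NArr ''pow3'' (NReg ''j'')) (NArr ''pow3'' (NReg ''j''))) (NReg ''q''))
            (NAdd (NArr ''PA'' (NReg ''q'')) (NArr ''pow2'' (NReg ''j''))) ;;
          SetNArr ''PC'' (NAdd (NAdd (NArr ''pow3'' (NReg ''j'')) (NArr ''pow3'' (NReg ''j''))) (NReg ''q''))
            (NAdd (NArr ''PC'' (NReg ''q'')) (NArr ''pow2'' (NReg ''j'')))))"

lemma writes_build_tables: "writes build_tables =
    {NA ''pow2'', NA ''pow3'', NA ''PA'', NA ''PC'', NR ''j'', NR ''q''}"
  by (auto simp: build_tables_def writes_For)

definition init_labels :: com where
  "init_labels =
    For ''u'' (NConst 0) (NReg ''n'')
      (SetNArr ''lab'' (NReg ''u'') (NArr ''col'' (NReg ''u'')))"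

lemma writes_init_labels: "writes init_labels = {NA ''lab'', NR ''u''}"
  by (auto simp: init_labels_def writes_For)

definition append_nbrs :: com where
  "append_nbrs =
    For ''p'' (NArr ''off'' (NReg ''z'')) (NArr ''off'' (NAdd (NReg ''z'') (NConst 1)))
      (Cond (NEq (NArr ''adj'' (NReg ''p'')) (NReg ''y''))
         Skip
         (SetNArr ''Q'' (NReg ''e'') (NArr ''adj'' (NReg ''p'')) ;;
          SetNArr ''QP'' (NReg ''e'') (NReg ''z'') ;;
          SetN ''e'' (NAdd (NReg ''e'') (NConst 1))))"

lemma writes_append_nbrs: "writes append_nbrs = {NR ''p'', NA ''Q'', NA ''QP'', NR ''e''}"
  by (auto simp: append_nbrs_def writes_For)

text \<open>\<open>L\<close> records the queue length at each depth, so appending starts there and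
  overwrites what abandoned branches left behind.\<close>

definition push :: com where
  "push =
    SetNArr ''sv'' (NReg ''d'') (NReg ''z'') ;;
    SetNArr ''ps'' (NReg ''d'') (NReg ''cur'') ;;
    SetNArr ''lab'' (NReg ''z'') (NAdd (NAdd (NReg ''c'') (NConst 1)) (NReg ''d'')) ;;
    SetN ''y'' (NArr ''QP'' (NReg ''cur'')) ;;
    SetN ''e'' (NArr ''L'' (NReg ''d'')) ;;
    append_nbrs ;;
    SetN ''d'' (NAdd (NReg ''d'') (NConst 1)) ;;
    SetNArr ''L'' (NReg ''d'') (NReg ''e'') ;;
    check_set"

text \<open>The queue needs no repair, because the smaller depth refers to its former length in
  \<open>L\<close>. Restoring one label undoes the selection.\<close>

definition pop :: com where
  "pop =
    SetN ''d'' (NSub (NReg ''d'') (NConst 1)) ;;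
    SetN ''cur'' (NAdd (NArr ''ps'' (NReg ''d'')) (NConst 1)) ;;
    SetNArr ''lab'' (NArr ''sv'' (NReg ''d'')) (NArr ''col'' (NArr ''sv'' (NReg ''d'')))"

definition search_step :: com where
  "search_step =
    Cond (BAnd (NLess (NReg ''d'') (NReg ''k'')) (NLess (NReg ''cur'') (NArr ''L'' (NReg ''d''))))
      (SetN ''z'' (NArr ''Q'' (NReg ''cur'')) ;;
       Cond (NLess (NReg ''c'') (NArr ''lab'' (NReg ''z''))) Skip push ;;
       SetN ''cur'' (NAdd (NReg ''cur'') (NConst 1)))
      pop"

text \<open>At depth 0 the queue consists of the root alone, so the search is over once the cursor
  has passed position 0 there.\<close>

definition search_root :: com where
  "search_root =
    SetNArr ''Q'' (NConst 0) (NReg ''v'') ;;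
    SetNArr ''QP'' (NConst 0) (NReg ''v'') ;;
    SetNArr ''L'' (NConst 0) (NConst 1) ;;
    SetN ''d'' (NConst 0) ;;
    SetN ''cur'' (NConst 0) ;;
    While (BNot (BAnd (NEq (NReg ''d'') (NConst 0)) (NLess (NConst 0) (NReg ''cur''))))
      search_step"

text \<open>With \<open>k = 0\<close> the search would pop from an empty stack. That case is
  answered directly: no improvement exists at distance 0.\<close>

definition program :: com where
  "program =
    SetN ''res'' (NConst 0) ;;
    build_tables ;;
    init_labels ;;
    Cond (NLess (NConst 0) (NReg ''k''))
      (For ''v'' (NConst 0) (NReg ''n'') search_root)
      Skip"

lemma subset_pairs_Suc: "subset_pairs (Suc j) = subset_pairs j \<union>
    (\<lambda>(a, c). (a + 2 ^ j, c)) ` subset_pairs j \<union> (\<lambda>(a, c). (a + 2 ^ j, c + 2 ^ j)) ` subset_pairs j"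
  (is "?L = ?R")
proof (intro subset_antisym subsetI)
  fix x assume "x \<in> ?L"
  then obtain A C where x: "x = (set_encode A, set_encode C)" "C \<subseteq> A" "A \<subseteq> {..<Suc j}" by blast
  define A' C' where "A' = A - {j}" and "C' = C - {j}"
  have sub: "C' \<subseteq> A'" "A' \<subseteq> {..<j}" "C' \<subseteq> {..<j}" using x by (auto simp: A'_def C'_def less_Suc_eq)
  then have mem: "(set_encode A', set_encode C') \<in> subset_pairs j" by blast
  consider "j \<notin> A" | "j \<in> A" "j \<notin> C" | "j \<in> C" by blast
  then show "x \<in> ?R"
  proof cases
    case 1
    then have "A' = A" "C' = C" using x by (auto simp: A'_def C'_def)
    then show ?thesis using mem x by simp
  next
    case 2
    then have "A = insert j A'" "C' = C" by (auto simp: A'_def C'_def)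
    then have "x = (\<lambda>(a, c). (a + 2 ^ j, c)) (set_encode A', set_encode C')"
      using x(1) set_encode_add[OF sub(2)] by simp
    then show ?thesis using mem by blast
  next
    case 3
    then have "A = insert j A'" "C = insert j C'" using x by (auto simp: A'_def C'_def)
    then have "x = (\<lambda>(a, c). (a + 2 ^ j, c + 2 ^ j)) (set_encode A', set_encode C')"
      using x(1) set_encode_add[OF sub(2)] set_encode_add[OF sub(3)] by simp
    then show ?thesis using mem by blast
  qed
next
  fix x assume "x \<in> ?R"
  then obtain A C where AC: "C \<subseteq> A" "A \<subseteq> {..<j}" "C \<subseteq> {..<j}"
    and x: "x = (set_encode A, set_encode C) \<or> x = (set_encode A + 2 ^ j, set_encode C) \<or>
      x = (set_encode A + 2 ^ j, set_encode C + 2 ^ j)" by auto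
  from x consider "x = (set_encode A, set_encode C)" | "x = (set_encode (insert j A), set_encode C)"
    | "x = (set_encode (insert j A), set_encode (insert j C))"
    using set_encode_add[OF AC(2)] set_encode_add[OF AC(3)] by (auto simp: add.commute)
  then show "x \<in> ?L"
  proof cases
    case 1
    have "C \<subseteq> A" "A \<subseteq> {..<Suc j}" using AC by auto
    then show ?thesis using 1 by blast
  next
    case 2
    have "C \<subseteq> insert j A" "insert j A \<subseteq> {..<Suc j}" using AC by auto
    then show ?thesis using 2 by blast
  next
    case 3
    have "insert j C \<subseteq> insert j A" "insert j A \<subseteq> {..<Suc j}" using AC by auto
    then show ?thesis using 3 by blast
  qed
qed

lemma lessThan_triple: "{..<3 * T} = {..<T} \<union> (\<lambda>q. T + q) ` {..<T} \<union> (\<lambda>q. T + T + q) ` {..<T::nat}"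
proof (intro subset_antisym subsetI)
  fix q assume "q \<in> {..<3 * T}"
  then consider "q < T" | "q = T + (q - T)" "q - T < T" | "q = T + T + (q - (T + T))" "q - (T + T) < T"
    by fastforce
  then show "q \<in> {..<T} \<union> (\<lambda>q. T + q) ` {..<T} \<union> (\<lambda>q. T + T + q) ` {..<T}"
    by cases blast+
qed auto

lemma pair_table_Suc:
  fixes f f' :: "nat \<Rightarrow> nat \<times> nat"
  assumes "f ` {..<T} = subset_pairs j"
    and "\<And>q. q < T \<Longrightarrow> f' q = f q"
    and "\<And>q. q < T \<Longrightarrow> f' (T + q) = (fst (f q) + 2 ^ j, snd (f q))"
    and "\<And>q. q < T \<Longrightarrow> f' (T + T + q) = (fst (f q) + 2 ^ j, snd (f q) + 2 ^ j)"
  shows "f' ` {..<3 * T} = subset_pairs (Suc j)"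
proof -
  have "f' ` {..<T} = f ` {..<T}" using assms(2) by (intro image_cong) auto
  moreover have "f' ` (\<lambda>q. T + q) ` {..<T} = (\<lambda>(a, c). (a + 2 ^ j, c)) ` f ` {..<T}"
    unfolding image_image using assms(3) by (intro image_cong) (auto simp: case_prod_beta)
  moreover have "f' ` (\<lambda>q. T + T + q) ` {..<T} = (\<lambda>(a, c). (a + 2 ^ j, c + 2 ^ j)) ` f ` {..<T}"
    unfolding image_image using assms(4) by (intro image_cong) (auto simp: case_prod_beta)
  ultimately show ?thesis
    unfolding lessThan_triple image_Un subset_pairs_Suc assms(1) by simp
qed

section \<open>Correctness of the tables and amortised cost of the search\<close>

context cut_instance
begin

definition table_at :: "mem \<Rightarrow> nat \<Rightarrow> bool" where
  "table_at m j \<longleftrightarrow> narr m ''pow2'' j = 2 ^ j \<and> narr m ''pow3'' j = 3 ^ j \<and>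
    (\<lambda>q. (narr m ''PA'' q, narr m ''PC'' q)) ` {..<3 ^ j} = subset_pairs j"

lemma tables_ok_iff: "tables_ok m \<longleftrightarrow> (\<forall>j\<le>k. table_at m j)"
  by (simp add: tables_ok_def table_at_def)

lemma table_at_cong:
  assumes "table_at m j" "narr m' ''pow2'' j = narr m ''pow2'' j" "narr m' ''pow3'' j = narr m ''pow3'' j"
    "\<And>q. q < 3 ^ j \<Longrightarrow> narr m' ''PA'' q = narr m ''PA'' q \<and> narr m' ''PC'' q = narr m ''PC'' q"
  shows "table_at m' j"
proof -
  have "(\<lambda>q. (narr m' ''PA'' q, narr m' ''PC'' q)) ` {..<3 ^ j} =
    (\<lambda>q. (narr m ''PA'' q, narr m ''PC'' q)) ` {..<3 ^ j}"
    using assms(4) by (intro image_cong) auto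
  then show ?thesis using assms by (simp add: table_at_def)
qed

lemma wp_build_tables:
  assumes k: "nreg m ''k'' = k"
  shows "wp build_tables (\<lambda>t m'. t \<le> k * (90 * 3 ^ k) + 20 \<and> tables_ok m') m"
  unfolding build_tables_def wp_Seq wp_SetNArr
proof (rule wp_For[where h = k and T = "80 * 3 ^ k" and I = "\<lambda>j m'. \<forall>j'\<le>j. table_at m' j'"], goal_cases)
  case 1
  have "{C. C = {}} = {{}}" by auto
  then show ?case by (auto simp: table_at_def)
next
  case (2 j m')
  then show ?case using k by (simp add: same_def writes_For)
next
  case (4 j m')
  let ?T = "3 ^ j :: nat"
  have tab: "table_at m' j" and less: "\<And>j'. j' \<le> j \<Longrightarrow> table_at m' j'" using 4(1) by auto
  have p2: "narr m' ''pow2'' j = 2 ^ j" and p3: "narr m' ''pow3'' j = ?T"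
    using tab by (simp_all add: table_at_def)
  have j: "j < k" "nreg m' ''j'' = j" using 4 by auto
  let ?PA = "narr m' ''PA''" and ?PC = "narr m' ''PC''"
  show ?case
    unfolding wp_Seq wp_SetNArr
  \<comment> \<open>Entries below \<open>3 ^ j\<close> are the source for the two new thirds and
    stay unchanged throughout the loop.\<close>
  proof (rule wp_For[where h = ?T and T = 43 and I = "\<lambda>q m''. \<forall>q'<?T.
        narr m'' ''PA'' q' = ?PA q' \<and> narr m'' ''PC'' q' = ?PC q' \<and>
        (q' < q \<longrightarrow> narr m'' ''PA'' (?T + q') = ?PA q' + 2 ^ j \<and> narr m'' ''PC'' (?T + q') = ?PC q' \<and>
          narr m'' ''PA'' (?T + ?T + q') = ?PA q' + 2 ^ j \<and> narr m'' ''PC'' (?T + ?T + q') = ?PC q' + 2 ^ j)"],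
      goal_cases)
    case (2 q m'')
    then show ?case using j p3 by (simp add: same_def)
  next
    case (4 q m'')
    have eqs: "narr m'' ''pow3'' j = ?T" "narr m'' ''pow2'' j = 2 ^ j" "nreg m'' ''j'' = j"
      using 4(4) j p3 p2 by (simp_all add: same_def)
    show ?case using 4(1,3,5) eqs by (auto simp: wp_simps less_Suc_eq)
  next
    case (5 t m'')
    have e2: "(2::nat) ^ Suc j = 2 ^ j + 2 ^ j" and e3: "(3::nat) ^ Suc j = 3 ^ j + (3 ^ j + 3 ^ j)" by simp_all
    have pw: "narr m'' ''pow2'' = (narr m' ''pow2'')(Suc j := 2 ^ Suc j)"
      "narr m'' ''pow3'' = (narr m' ''pow3'')(Suc j := 3 ^ Suc j)" "nreg m'' ''j'' = j"
      unfolding e2 e3 using 5(3) j p2 p3 by (simp_all add: same_def)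
    have old: "table_at m'' j'" if "j' \<le> j" for j'
    proof (rule table_at_cong[OF less[OF that]])
      fix q assume "q < (3::nat) ^ j'"
      also have "(3::nat) ^ j' \<le> 3 ^ j" using that by (intro power_increasing) auto
      finally show "narr m'' ''PA'' q = narr m' ''PA'' q \<and> narr m'' ''PC'' q = narr m' ''PC'' q"
        using 5(1) by simp
    qed (use that pw in auto)
    have "(\<lambda>q. (narr m'' ''PA'' q, narr m'' ''PC'' q)) ` {..<3 * ?T} = subset_pairs (Suc j)"
      by (rule pair_table_Suc[where f = "\<lambda>q. (?PA q, ?PC q)"])
        (use tab 5(1) in \<open>simp_all add: table_at_def\<close>)
    then have "table_at m'' (Suc j)" using pw by (simp add: table_at_def)
    then have tabs: "\<forall>j'\<le>Suc j. table_at m'' j'" using old by (auto simp: le_Suc_eq)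
    have "(3::nat) ^ j \<le> 3 ^ k" using j by (intro power_increasing) auto
    moreover have "t \<le> 52 * 3 ^ j + 7" using 5(4) j p3 by simp
    ultimately have "t + 21 \<le> 80 * 3 ^ k"
      using one_le_power[of "3::nat" k] by linarith
    then show ?case using tabs pw(3) by (simp add: table_at_def)
  qed (use j p3 in auto)
next
  case (5 t m')
  have "k * (80 * 3 ^ k + 8) \<le> k * (90 * (3 ^ k))"
    using one_le_power[of "3::nat" k] by (intro mult_le_mono2) linarith
  moreover have "t \<le> k * (80 * 3 ^ k + 8) + 6" using 5(4) by (simp add: add.commute)
  ultimately have "t + 12 \<le> k * (90 * 3 ^ k) + 20" by linarith
  then show ?case using 5(1) by (simp add: tables_ok_iff)
qed simp

lemma input_ok_same:
  assumes ok: "input_ok m" and same: "same X m m'"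
    and X: "X \<inter> {NR ''n'', NR ''c'', NR ''k'', NA ''off'', NA ''adj'', NA ''col'', RA ''wt''} = {}"
  shows "input_ok m'"
proof -
  have "x \<notin> X" if "x \<in> {NR ''n'', NR ''c'', NR ''k'', NA ''off'', NA ''adj'', NA ''col'', RA ''wt''}" for x
    using X that by blast
  then have eqs: "nreg m' ''n'' = nreg m ''n''" "nreg m' ''c'' = nreg m ''c''"
    "nreg m' ''k'' = nreg m ''k''"
    "narr m' ''off'' = narr m ''off''" "narr m' ''adj'' = narr m ''adj''" "narr m' ''col'' = narr m ''col''"
    "rarr m' ''wt'' = rarr m ''wt''"
    using same unfolding same_def by simp_all
  show ?thesis using ok unfolding input_ok_def eqs .
qed

lemma tables_ok_same:
  assumes ok: "tables_ok m" and same: "same X m m'"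
    and X: "X \<inter> {NA ''pow2'', NA ''pow3'', NA ''PA'', NA ''PC''} = {}"
  shows "tables_ok m'"
proof -
  have "x \<notin> X" if "x \<in> {NA ''pow2'', NA ''pow3'', NA ''PA'', NA ''PC''}" for x
    using X that by blast
  then have eqs: "narr m' ''pow2'' = narr m ''pow2''" "narr m' ''pow3'' = narr m ''pow3''"
    "narr m' ''PA'' = narr m ''PA''" "narr m' ''PC'' = narr m ''PC''"
    using same unfolding same_def by simp_all
  show ?thesis using ok unfolding tables_ok_def eqs .
qed

lemma wp_init_labels:
  assumes "input_ok m"
  shows "wp init_labels (\<lambda>t m'. t \<le> n * 12 + 6 \<and> (\<forall>u<n. narr m' ''lab'' u = \<chi> u)) m"
  unfolding init_labels_def
  by (rule wp_For[where h = n and T = 4 and I = "\<lambda>j m'. \<forall>u<j. narr m' ''lab'' u = \<chi> u"])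
    (use assms in \<open>auto simp: same_def wp_simps less_Suc_eq input_ok_def\<close>)

definition queue_ok :: "(nat \<times> nat) list \<Rightarrow> mem \<Rightarrow> bool" where
  "queue_ok qs m \<longleftrightarrow> (\<forall>e<length qs. narr m ''Q'' e = fst (qs ! e) \<and> narr m ''QP'' e = snd (qs ! e))"

lemma wp_append_nbrs:
  assumes ok: "input_ok m" and z: "nreg m ''z'' = z" "z < n" and y: "nreg m ''y'' = y"
    and e: "nreg m ''e'' = length qs" and q: "queue_ok qs m"
  shows "wp append_nbrs (\<lambda>t m'. t \<le> 64 * D \<and>
    queue_ok (qs @ map (\<lambda>u. (u, z)) (filter (\<lambda>u. u \<noteq> y) (nbrs z))) m' \<and>
    nreg m' ''e'' = length (qs @ map (\<lambda>u. (u, z)) (filter (\<lambda>u. u \<noteq> y) (nbrs z)))) m"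
proof -
  define ql where "ql i = qs @ map (\<lambda>u. (u, z)) (filter (\<lambda>u. u \<noteq> y) (take i (nbrs z)))" for i
  have off: "narr m ''off'' z = off z" "narr m ''off'' (Suc z) = off z + length (nbrs z)"
    using ok z by (auto simp: input_ok_def off_Suc)
  have nth: "narr m ''adj'' j = nbrs z ! (j - off z)"
    if "off z \<le> j" "j < off z + length (nbrs z)" for j
  proof -
    have "j = off z + (j - off z)" "j - off z < length (nbrs z)" using that by auto
    then show ?thesis using ok z unfolding input_ok_def by metis
  qed
  have "wp append_nbrs (\<lambda>t m'. t \<le> 64 * D \<and> queue_ok (ql (length (nbrs z))) m' \<and>
    nreg m' ''e'' = length (ql (length (nbrs z)))) m"
    unfolding append_nbrs_def
  proof (rule wp_For[where h = "off z + length (nbrs z)" and T = 16 and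
        I = "\<lambda>j m'. queue_ok (ql (j - off z)) m' \<and> nreg m' ''e'' = length (ql (j - off z))"], goal_cases)
    case 1
    then show ?case using e q off z by (simp add: ql_def queue_ok_def)
  next
    case (4 j m')
    then have i: "off z \<le> j" "j - off z < length (nbrs z)" using off z by auto
    have S: "Suc j - off z = Suc (j - off z)" using i by simp
    let ?u = "nbrs z ! (j - off z)"
    have "ql (Suc j - off z) = ql (j - off z) @ (if ?u \<noteq> y then [(?u, z)] else [])"
      unfolding S ql_def using i(2) by (simp add: take_Suc_conv_app_nth)
    moreover have "narr m' ''adj'' j = ?u" "nreg m' ''z'' = z" "nreg m' ''y'' = y"
      using 4(3,4) nth[OF i(1)] z y by (simp_all add: same_def)
    ultimately show ?case
      using 4(1,5) by (auto simp: wp_simps queue_ok_def nth_append less_Suc_eq)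
  next
    case (5 t m')
    then show ?case using off z length_nbrs_le[OF z(2)] D_pos by (simp add: same_def)
  qed (use off z in \<open>auto simp: same_def\<close>)
  then show ?thesis by (simp add: ql_def)
qed

fun stack_ok :: "nat \<Rightarrow> nat list \<Rightarrow> mem \<Rightarrow> bool" where
  "stack_ok v [] m \<longleftrightarrow> narr m ''L'' 0 = 1"
| "stack_ok v (p # ps) m \<longleftrightarrow> stack_ok v ps m \<and> narr m ''sv'' (length ps) = fst (queue v ps ! p) \<and>
     narr m ''ps'' (length ps) = p \<and> narr m ''L'' (Suc (length ps)) = length (queue v (p # ps))"

lemma stack_ok_cong:
  assumes "\<And>j. j < length ps \<Longrightarrow> narr m' ''sv'' j = narr m ''sv'' j \<and> narr m' ''ps'' j = narr m ''ps'' j"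
    and "\<And>j. j \<le> length ps \<Longrightarrow> narr m' ''L'' j = narr m ''L'' j"
  shows "stack_ok v ps m' = stack_ok v ps m"
  using assms by (induction ps) auto

lemma stack_ok_L: "stack_ok v ps m \<Longrightarrow> narr m ''L'' (length ps) = length (queue v ps)"
  by (cases ps) auto

lemma stack_ok_sv: "stack_ok v ps m \<Longrightarrow> j < length ps \<Longrightarrow> narr m ''sv'' j = verts v ps ! j"
  by (induction ps) (auto simp: nth_append less_Suc_eq)

definition labels_ok :: "nat list \<Rightarrow> (nat \<Rightarrow> nat) \<Rightarrow> bool" where
  "labels_ok ss lab \<longleftrightarrow> (\<forall>j<length ss. lab (ss ! j) = c + 1 + j) \<and> (\<forall>u<n. u \<notin> set ss \<longrightarrow> lab u = \<chi> u)"

lemma labels_ok_push: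
  assumes "labels_ok ss lab" "z \<notin> set ss"
  shows "labels_ok (ss @ [z]) (lab(z := c + 1 + length ss))"
  using assms nth_mem unfolding labels_ok_def by (auto simp: nth_append less_Suc_eq)

lemma labels_ok_pop:
  assumes "labels_ok (ss @ [z]) lab" "distinct (ss @ [z])"
  shows "labels_ok ss (lab(z := \<chi> z))"
  using assms unfolding labels_ok_def by (auto simp: nth_append less_Suc_eq)

lemma labels_ok_mem:
  assumes "labels_ok ss lab" "u < n"
  shows "c < lab u \<longleftrightarrow> u \<in> set ss"
  using assms colour_bounds[of u] unfolding labels_ok_def by (cases "u \<in> set ss") (auto simp: in_set_conv_nth)

text \<open>\<open>ans\<close> is constant during the search: an improvement is either recorded in
  \<open>res\<close> or still ahead. Once nothing remains, \<open>res\<close> is the answer.\<close>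

definition search_inv :: "nat \<Rightarrow> bool \<Rightarrow> nat list \<times> nat \<Rightarrow> mem \<Rightarrow> bool" where
  "search_inv v ans a m \<longleftrightarrow> (case a of (ps, cur) \<Rightarrow>
     input_ok m \<and> tables_ok m \<and> valid v ps \<and> (\<forall>q\<in>set ps. q < cur) \<and>
     nreg m ''v'' = v \<and> nreg m ''d'' = length ps \<and> nreg m ''cur'' = cur \<and>
     stack_ok v ps m \<and> queue_ok (queue v ps) m \<and> labels_ok (verts v ps) (narr m ''lab'') \<and>
     nreg m ''res'' \<le> 1 \<and>
     (nreg m ''res'' = 1 \<or> (\<exists>ys\<in>remaining v ps cur. improvable (verts v ys)) \<longleftrightarrow> ans))"

text \<open>Per unit of \<open>c * D * k\<^sup>2 * 3 ^ s\<close>, the check takes 330, extending the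
  queue 110, the rescan after the later removal 40 and constants 148; 700 covers the sum.\<close>

definition visit_cost :: nat where
  "visit_cost = 700 * c * D * k\<^sup>2"

text \<open>Every sequence still to be visited pays for its own check and for its later removal from the
  stack; the removal moves \<open>cur\<close> back by at most the queue length.\<close>

definition potential :: "nat \<Rightarrow> nat list \<times> nat \<Rightarrow> nat" where
  "potential v a = (case a of (ps, cur) \<Rightarrow>
     (\<Sum>ys\<in>remaining v ps cur. visit_cost * 3 ^ length ys) +
     length ps * (40 * (D * k + 2) + 33) + 40 * (D * k + 2 - cur))"

text \<open>Register \<open>z\<close> is set just before \<open>push\<close> and \<open>cur\<close>
  advanced just after it, so the invariant is assumed up to the value of \<open>z\<close> and
  established up to the increment of \<open>cur\<close>.\<close>

lemma wp_push:
  assumes v: "v < n" and inv: "search_inv v ans (ps, cur) (m\<lparr>nreg := (nreg m)(''z'' := z')\<rparr>)"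
    and z: "nreg m ''z'' = fst (queue v ps ! cur)" and val: "valid v (cur # ps)"
  shows "wp push (\<lambda>t m'. t \<le> 110 * D + 330 * c * (D * 3 ^ Suc (length ps)) * (Suc (length ps))\<^sup>2 \<and>
    nreg m' ''cur'' = cur \<and>
    search_inv v ans (cur # ps, Suc cur) (m'\<lparr>nreg := (nreg m')(''cur'' := Suc cur)\<rparr>)) m"
proof -
  let ?z = "fst (queue v ps ! cur)" and ?y = "snd (queue v ps ! cur)" and ?d = "length ps"
  let ?ss = "verts v (cur # ps)" and ?m = "m\<lparr>nreg := (nreg m)(''z'' := z')\<rparr>"
  have cur: "cur < length (queue v ps)" "valid v ps" "?d < k" "?z \<notin> set (verts v ps)" using val by auto
  have zn: "?z < n" using queue_vert_less[OF v cur(2,1)] .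
  have ok: "input_ok m" "tables_ok m"
    using inv input_ok_same[of ?m "{NR ''z''}" m] tables_ok_same[of ?m "{NR ''z''}" m]
    by (auto simp: search_inv_def same_def)
  have regs: "nreg m ''v'' = v" "nreg m ''d'' = ?d" "nreg m ''cur'' = cur" "nreg m ''c'' = c"
    using inv ok(1) by (auto simp: search_inv_def input_ok_def)
  have st: "stack_ok v ps m" and qok: "queue_ok (queue v ps) m"
    and lab: "labels_ok (verts v ps) (narr m ''lab'')"
    using inv stack_ok_cong[of ps m ?m v] by (auto simp: search_inv_def queue_ok_def)
  have y: "narr m ''QP'' cur = ?y" using qok cur(1) by (simp add: queue_ok_def)
  show ?thesis
    unfolding push_def wp_Seq wp_SetN wp_SetNArr
  proof (rule wp_mono[OF wp_append_nbrs[where z = ?z and y = ?y and qs = "queue v ps"]], goal_cases)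
    case 1
    show ?case
      by (rule input_ok_same[OF ok(1), of "{NA ''sv'', NA ''ps'', NA ''lab'', NR ''y'', NR ''e''}"])
        (auto simp: same_def)
  next
    case 5
    then show ?case using regs stack_ok_L[OF st] by simp
  next
    case 6
    then show ?case using qok by (simp add: queue_ok_def)
  next
    case (7 t1 m1)
    note Q1 = 7(1) and s1 = 7(2)
    have sv1: "narr m1 ''sv'' = (narr m ''sv'')(?d := ?z)" and ps1: "narr m1 ''ps'' = (narr m ''ps'')(?d := cur)"
      and lab1: "narr m1 ''lab'' = (narr m ''lab'')(?z := c + 1 + ?d)"
      and L1: "narr m1 ''L'' = narr m ''L''"
      and regs1: "nreg m1 ''d'' = ?d" "nreg m1 ''cur'' = cur" "nreg m1 ''v'' = v"
        "nreg m1 ''res'' = nreg m ''res''"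
      using s1 regs z by (simp_all add: same_def writes_append_nbrs)
    let ?X = "{NA ''sv'', NA ''ps'', NA ''lab'', NR ''y'', NR ''e'', NR ''p'', NA ''Q'', NA ''QP''}"
    have same1: "same ?X m m1" using s1 by (simp add: same_def writes_append_nbrs)
    let ?m2 = "m1\<lparr>nreg := (nreg m1)(''d'' := nval (NAdd (NReg ''d'') (NConst 1)) m1)\<rparr>"
    let ?m3 = "?m2\<lparr>narr := (narr ?m2)(''L'' := (narr ?m2 ''L'')(nval (NReg ''d'') ?m2 := nval (NReg ''e'') ?m2))\<rparr>"
    have same3: "same (?X \<union> {NR ''d'', NA ''L''}) m ?m3" using same1 by (simp add: same_def)
    have ok3: "input_ok ?m3" "tables_ok ?m3"
      by (rule input_ok_same[OF ok(1) same3], simp, rule tables_ok_same[OF ok(2) same3], simp)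
    have lab3: "labels_ok ?ss (narr m1 ''lab'')"
      unfolding lab1 using labels_ok_push[OF lab cur(4)] by simp
    have "stack_ok v ps ?m3 = stack_ok v ps m"
      by (rule stack_ok_cong) (use sv1 ps1 L1 regs1 in auto)
    then have st3: "stack_ok v (cur # ps) ?m3"
      using st sv1 ps1 regs1 Q1 by simp
    have pre: "check_pre ?ss ?m3"
      unfolding check_pre_def selection_ok_def
      using ok3 distinct_verts[OF val] set_verts[OF v val] valid_length[OF val] regs1
        stack_ok_sv[OF st3] lab3 unfolding labels_ok_def by simp
    show ?case
    proof (rule wp_mono[OF wp_check_set[OF pre]], goal_cases)
      case (1 t2 m4)
      note R = 1(1) and s4 = 1(2)
      have arr4: "narr m4 = narr ?m3" by (intro ext same_narr[OF s4]) (simp add: writes_check_set)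
      let ?m5 = "m4\<lparr>nreg := (nreg m4)(''cur'' := Suc cur)\<rparr>"
      have s5: "same (insert (NR ''cur'') (writes check_set)) ?m3 ?m5"
        by (rule same_trans[OF same_mono[OF s4]]) (auto simp: same_def)
      have ok5: "input_ok ?m5" "tables_ok ?m5"
        by (rule input_ok_same[OF ok3(1) s5], simp add: writes_check_set,
            rule tables_ok_same[OF ok3(2) s5], simp add: writes_check_set)
      have regs4: "nreg m4 ''d'' = Suc ?d" "nreg m4 ''cur'' = cur" "nreg m4 ''v'' = v"
        "nreg m4 ''res'' = (if improvable ?ss then 1 else nreg m ''res'')"
        using s4 regs1 R by (simp_all add: same_def writes_check_set)
      have st5: "stack_ok v (cur # ps) ?m5"
        using st3 stack_ok_cong[of "cur # ps" ?m5 ?m3 v] arr4 by simp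
      have q5: "queue_ok (queue v (cur # ps)) ?m5"
        using Q1 arr4 by (simp add: queue_ok_def)
      have lab5: "labels_ok ?ss (narr ?m5 ''lab'')" using lab3 arr4 by simp
      have res: "nreg m ''res'' \<le> 1"
        "nreg m ''res'' = 1 \<or> (\<exists>ys\<in>remaining v ps cur. improvable (verts v ys)) \<longleftrightarrow> ans"
        using inv by (auto simp: search_inv_def)
      have res5: "nreg ?m5 ''res'' \<le> 1"
        "nreg ?m5 ''res'' = 1 \<or> (\<exists>ys\<in>remaining v (cur # ps) (Suc cur). improvable (verts v ys)) \<longleftrightarrow> ans"
        using res regs4(4) unfolding remaining_push[OF val] by (auto simp del: verts.simps remaining.simps)
      have "\<forall>q\<in>set (cur # ps). q < Suc cur" using val by (auto intro: less_SucI)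
      then have "search_inv v ans (cur # ps, Suc cur) ?m5"
        unfolding search_inv_def prod.case using ok5 val regs4 st5 q5 lab5 res5
        by (simp del: verts.simps remaining.simps queue.simps stack_ok.simps valid.simps)
      moreover have "t1 + t2 + 26 \<le> 110 * D + 330 * c * (D * 3 ^ Suc ?d) * (Suc ?d)\<^sup>2"
        using Q1[THEN conjunct1] R[THEN conjunct1] D_pos unfolding table_size_def length_verts length_Cons by linarith
      ultimately show ?case using regs4(2) by simp
    qed
  qed (use regs z zn y in simp_all)
qed

text \<open>The share released by \<open>cur # ps\<close> pays for its check, for appending its
  neighbours, and for the reserve \<open>40 * (D * k + 2) + 33\<close> that the deeper stack has to
  hold.\<close>

lemma potential_push:
  assumes "v < n" "valid v (cur # ps)"
  shows "potential v (cur # ps, Suc cur) + 110 * D +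
    330 * c * (D * 3 ^ Suc (length ps)) * (Suc (length ps))\<^sup>2 + 35 \<le> potential v (ps, cur)"
proof -
  let ?s = "Suc (length ps)"
  have c: "1 \<le> c" using colour_bounds[OF assms(1)] by linarith
  have s: "?s \<le> k" "1 \<le> k" using assms(2) by auto
  have "potential v (ps, cur) = visit_cost * 3 ^ ?s +
    (\<Sum>ys\<in>remaining v (cur # ps) (Suc cur). visit_cost * 3 ^ length ys) +
    length ps * (40 * (D * k + 2) + 33) + 40 * (D * k + 2 - cur)"
    unfolding potential_def prod.case remaining_push[OF assms(2)]
    by (subst sum.insert[OF finite_remaining[OF assms(1)] push_notin_remaining]) simp
  moreover have "potential v (cur # ps, Suc cur) =
    (\<Sum>ys\<in>remaining v (cur # ps) (Suc cur). visit_cost * 3 ^ length ys) +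
    length ps * (40 * (D * k + 2) + 33) + (40 * (D * k + 2) + 33) + 40 * (D * k + 2 - Suc cur)"
    unfolding potential_def prod.case by simp
  moreover have "110 * D + 330 * c * (D * 3 ^ ?s) * ?s\<^sup>2 + 35 + (40 * (D * k + 2) + 33) \<le> visit_cost * 3 ^ ?s"
  proof -
    define Z where "Z = c * D * k\<^sup>2 * 3 ^ ?s"
    define Y where "Y = 330 * c * (D * 3 ^ ?s) * ?s\<^sup>2"
    have "?s\<^sup>2 \<le> k\<^sup>2" using s(1) by (rule power_mono) simp
    then have "c * D * ?s\<^sup>2 * 3 ^ ?s \<le> Z" unfolding Z_def by (intro mult_le_mono1 mult_le_mono2)
    then have 1: "Y \<le> 330 * Z" unfolding Y_def by (simp only: ac_simps)
    have kk: "k \<le> k\<^sup>2" using s(2) by (simp add: power2_eq_square)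
    have "D * k = 1 * D * k * 1" by simp
    also have "\<dots> \<le> Z" unfolding Z_def using c kk by (intro mult_le_mono) auto
    finally have 2: "D * k \<le> Z" .
    define W where "W = D * k"
    have 3: "D \<le> W" using s(2) unfolding W_def by simp
    have eq: "visit_cost * 3 ^ ?s = 700 * Z" unfolding Z_def by (simp only: visit_cost_def mult.assoc)
    show ?thesis unfolding eq Y_def[symmetric] W_def[symmetric] distrib_left
      using 1 2[folded W_def] 3 D_pos by linarith
  qed
  moreover have "D * k + 2 - Suc cur \<le> D * k + 2 - cur" by simp
  ultimately show ?thesis by linarith
qed

lemma wp_search_step:
  assumes v: "v < n" and k: "0 < k" and inv: "search_inv v ans a m"
    and b: "bval (BNot (BAnd (NEq (NReg ''d'') (NConst 0)) (NLess (NConst 0) (NReg ''cur'')))) m"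
  shows "wp search_step (\<lambda>t m'. \<exists>a'. search_inv v ans a' m' \<and> potential v a' + t + 9 \<le> potential v a) m"
proof -
  obtain ps cur where a: "a = (ps, cur)" by fastforce
  let ?z = "fst (queue v ps ! cur)"
  note inv = inv[unfolded a]
  have ok: "input_ok m" "tables_ok m" "valid v ps" "\<forall>q\<in>set ps. q < cur"
    and regs: "nreg m ''v'' = v" "nreg m ''d'' = length ps" "nreg m ''cur'' = cur"
      "nreg m ''c'' = c" "nreg m ''k'' = k"
    and st: "stack_ok v ps m" and qok: "queue_ok (queue v ps) m"
    and lab: "labels_ok (verts v ps) (narr m ''lab'')"
    using inv by (auto simp: search_inv_def input_ok_def)
  have L: "narr m ''L'' (length ps) = length (queue v ps)" using stack_ok_L[OF st] .
  show ?thesis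
  proof (cases "length ps < k \<and> cur < length (queue v ps)")
    case True
    then have cur: "length ps < k" "cur < length (queue v ps)" by auto
    have Q: "narr m ''Q'' cur = ?z" using qok cur(2) by (simp add: queue_ok_def)
    have zn: "?z < n" using queue_vert_less[OF v ok(3) cur(2)] .
    let ?m1 = "m\<lparr>nreg := (nreg m)(''z'' := ?z)\<rparr>"
    have step: "wp search_step R m = (if ?z \<in> set (verts v ps)
        then R 22 (?m1\<lparr>nreg := (nreg ?m1)(''cur'' := Suc cur)\<rparr>)
        else wp push (\<lambda>t m'. R (t + 21) (m'\<lparr>nreg := (nreg m')(''cur'' := Suc (nreg m' ''cur''))\<rparr>)) ?m1)" for R
      unfolding search_step_def using regs L Q cur labels_ok_mem[OF lab zn]
      by (simp add: wp_simps numeral_eq_Suc)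
    show ?thesis
    proof (cases "?z \<in> set (verts v ps)")
      case True
      then have nv: "\<not> valid v (cur # ps)" by simp
      let ?m2 = "?m1\<lparr>nreg := (nreg ?m1)(''cur'' := Suc cur)\<rparr>"
      have s2: "same {NR ''z'', NR ''cur''} m ?m2" by (simp add: same_def)
      have "input_ok ?m2" "tables_ok ?m2"
        by (rule input_ok_same[OF ok(1) s2], simp, rule tables_ok_same[OF ok(2) s2], simp)
      then have "search_inv v ans (ps, Suc cur) ?m2"
        using inv remaining_skip[OF nv] stack_ok_cong[of ps ?m2 m v]
        unfolding search_inv_def prod.case by (auto simp: queue_ok_def intro: less_SucI)
      \<comment> \<open>The 22 steps and 9 for the loop test come out of the 40 released by
        advancing \<open>cur\<close>. As \<open>cur\<close> is below the bound on the queue length,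
        the truncated difference really drops.\<close>
      moreover have "potential v (ps, Suc cur) + 22 + 9 \<le> potential v (ps, cur)"
        using length_queue_le[OF v ok(3)] cur(2) unfolding potential_def prod.case remaining_skip[OF nv]
        by (simp add: diff_Suc split: nat.split)
      ultimately show ?thesis unfolding step a using True by auto
    next
      case False
      then have val: "valid v (cur # ps)" using ok cur by auto
      have "?m1\<lparr>nreg := (nreg ?m1)(''z'' := nreg m ''z'')\<rparr> = m" by simp
      then have inv': "search_inv v ans (ps, cur) (?m1\<lparr>nreg := (nreg ?m1)(''z'' := nreg m ''z'')\<rparr>)"
        using inv by simp
      have "wp push (\<lambda>t m'. \<exists>a'. search_inv v ans a' (m'\<lparr>nreg := (nreg m')(''cur'' := Suc (nreg m' ''cur''))\<rparr>) \<and>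
        potential v a' + (t + 21) + 9 \<le> potential v (ps, cur)) ?m1"
      proof (rule wp_mono[OF wp_push[OF v inv' _ val]], goal_cases)
        case (2 t m')
        have "potential v (cur # ps, Suc cur) + (t + 21) + 9 \<le> potential v (ps, cur)"
          using potential_push[OF v val] 2(1)[THEN conjunct1] by linarith
        then show ?case using 2(1) by (intro exI[of _ "(cur # ps, Suc cur)"]) simp
      qed simp
      then show ?thesis unfolding step a using False by simp
    qed
  next
    case False
    have "ps \<noteq> []"
    proof
      assume "ps = []"
      then show False using False b regs k by auto
    qed
    then obtain p ps' where ps: "ps = p # ps'" by (cases ps) auto
    let ?x = "fst (queue v ps' ! p)"
    have val': "valid v ps'" "p < length (queue v ps')" using ok(3) ps by auto
    have xn: "?x < n" using queue_vert_less[OF v val'] .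
    have eqs: "narr m ''sv'' (length ps') = ?x" "narr m ''ps'' (length ps') = p" using st ps by auto
    have colx: "narr m ''col'' ?x = \<chi> ?x" using ok(1) xn by (simp add: input_ok_def)
    let ?m2 = "m\<lparr>nreg := (nreg m)(''d'' := length ps', ''cur'' := Suc p),
      narr := (narr m)(''lab'' := (narr m ''lab'')(?x := \<chi> ?x))\<rparr>"
    have s2: "same {NR ''d'', NR ''cur'', NA ''lab''} m ?m2" by (simp add: same_def)
    have ok2: "input_ok ?m2" "tables_ok ?m2"
      by (rule input_ok_same[OF ok(1) s2], simp, rule tables_ok_same[OF ok(2) s2], simp)
    have "length (p # ps') = k \<or> length (queue v (p # ps')) \<le> cur"
      using False valid_length[OF ok(3)] unfolding ps by linarith
    then have rem: "remaining v ps cur = remaining v ps' (Suc p)" unfolding ps by (rule remaining_pop)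
    have st2: "stack_ok v ps' ?m2" using st stack_ok_cong[of ps' ?m2 m v] ps by simp
    have q2: "queue_ok (queue v ps') ?m2"
      using qok unfolding ps queue_ok_def by (auto simp: nth_append)
    have lab2: "labels_ok (verts v ps') ((narr m ''lab'')(?x := \<chi> ?x))"
      using labels_ok_pop[of "verts v ps'" ?x "narr m ''lab''"] lab distinct_verts[OF ok(3)] unfolding ps by simp
    have "search_inv v ans (ps', Suc p) ?m2"
      using inv ok2 val' st2 q2 lab2 ok(3) regs unfolding search_inv_def prod.case rem
      by (auto simp: ps intro: less_SucI)
    \<comment> \<open>The reserve of the removed level covers 24 steps for \<open>pop\<close>, 9 for
      the loop test, and the return of \<open>cur\<close> by at most
      \<open>D * k + 2\<close>.\<close>
    moreover have "potential v (ps', Suc p) + 24 + 9 \<le> potential v (ps, cur)"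
      unfolding potential_def prod.case rem by (simp add: ps)
    moreover have nb: "\<not> bval (BAnd (NLess (NReg ''d'') (NReg ''k'')) (NLess (NReg ''cur'') (NArr ''L'' (NReg ''d'')))) m"
      using regs L False by simp
    have "wp search_step R m = R 24 ?m2" for R
      unfolding search_step_def wp_Cond if_not_P[OF nb] pop_def using regs eqs colx ps
      by (simp add: wp_simps numeral_eq_Suc)
    ultimately show ?thesis unfolding a by auto
  qed
qed

lemma wp_search_root:
  assumes v: "v < n" "nreg m ''v'' = v" and k: "0 < k" and ok: "input_ok m" "tables_ok m"
    and lab: "\<forall>u<n. narr m ''lab'' u = \<chi> u" and res: "nreg m ''res'' \<le> 1"
  shows "wp search_root (\<lambda>t m'.
    t \<le> (\<Sum>ys | valid v ys \<and> ys \<noteq> []. visit_cost * 3 ^ length ys) + 40 * (D * k + 2) + 22 \<and>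
    input_ok m' \<and> tables_ok m' \<and> nreg m' ''v'' = v \<and> (\<forall>u<n. narr m' ''lab'' u = \<chi> u) \<and> nreg m' ''res'' \<le> 1 \<and>
    (nreg m' ''res'' = 1 \<longleftrightarrow> nreg m ''res'' = 1 \<or> (\<exists>ps. ps \<noteq> [] \<and> valid v ps \<and> improvable (verts v ps)))) m"
proof -
  let ?ans = "nreg m ''res'' = 1 \<or> (\<exists>ps. ps \<noteq> [] \<and> valid v ps \<and> improvable (verts v ps))"
  let ?b = "BNot (BAnd (NEq (NReg ''d'') (NConst 0)) (NLess (NConst 0) (NReg ''cur'')))"
  have pot: "potential v ([], 0) =
    (\<Sum>ys | valid v ys \<and> ys \<noteq> []. visit_cost * 3 ^ length ys) + 40 * (D * k + 2)"
    unfolding potential_def prod.case remaining_start by simp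
  have loop: "wp (While ?b search_step) (\<lambda>t m'. \<exists>a. search_inv v ?ans a m' \<and> \<not> bval ?b m' \<and>
      t \<le> potential v ([], 0) + bcost ?b + 1) m0" if "search_inv v ?ans ([], 0) m0" for m0
  proof (rule wp_While[where I = "search_inv v ?ans"])
    fix a m1 assume "search_inv v ?ans a m1" "bval ?b m1"
    note step = wp_search_step[OF v(1) k this]
    have "potential v a' + t + bcost ?b + 1 = potential v a' + t + 9" for a' t by simp
    then show "wp search_step (\<lambda>t m'. \<exists>a'. search_inv v ?ans a' m' \<and>
      potential v a' + t + bcost ?b + 1 \<le> potential v a) m1"
      using step by (simp only:)
  qed fact
  show ?thesis
    unfolding search_root_def wp_Seq wp_SetN wp_SetNArr
  proof (rule wp_mono[OF loop], goal_cases)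
    case 1
    let ?X = "{NA ''Q'', NA ''QP'', NA ''L'', NR ''d'', NR ''cur''}"
    show ?case
      unfolding search_inv_def prod.case remaining_start
      using v res lab
      by (intro conjI input_ok_same[OF ok(1), of ?X] tables_ok_same[OF ok(2), of ?X])
        (auto simp: same_def queue_ok_def labels_ok_def)
  next
    case (2 t m')
    then obtain ps cur where inv: "search_inv v ?ans (ps, cur) m'" and nb: "\<not> bval ?b m'"
      and t: "t \<le> potential v ([], 0) + bcost ?b + 1" by auto
    have "ps = []" "0 < cur" using inv nb by (auto simp: search_inv_def)
    then show ?case
      using inv t remaining_finished[of cur v] unfolding pot search_inv_def prod.case
      by (simp add: labels_ok_def)
  qed
qed

text \<open>\<open>wp_For\<close> asks for one natural number bounding every round, so the real
  estimate, which is uniform in the root, is rounded down.\<close>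

definition root_cost :: nat where
  "root_cost = nat \<lfloor>6 * real visit_cost * (3 * exp 1) ^ k * real D ^ k\<rfloor> + 40 * (D * k + 2) + 22"

lemma root_cost_ge:
  assumes "v < n"
  shows "(\<Sum>ys | valid v ys \<and> ys \<noteq> []. visit_cost * 3 ^ length ys) + 40 * (D * k + 2) + 22 \<le> root_cost"
  unfolding root_cost_def using le_nat_floor[OF sum_valid_le[OF assms]] by simp

lemma wp_program:
  assumes ok: "input_ok m"
  shows "wp program (\<lambda>t m'. t \<le> k * (90 * 3 ^ k) + n * 12 + n * (root_cost + 8) + 50 \<and>
    nreg m' ''res'' = (if LS_Max_Cut {..<n} E \<omega> c \<chi> k then 1 else 0)) m"
proof -
  let ?m0 = "m\<lparr>nreg := (nreg m)(''res'' := 0)\<rparr>"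
  let ?P = "\<lambda>v. \<exists>ps. ps \<noteq> [] \<and> valid v ps \<and> improvable (verts v ps)"
  have ok0: "input_ok ?m0" by (rule input_ok_same[OF ok, of "{NR ''res''}"]) (auto simp: same_def)
  have k0: "nreg ?m0 ''k'' = k" using ok0 by (simp add: input_ok_def)
  show ?thesis
    unfolding program_def wp_Seq wp_SetN nval.simps
  proof (rule wp_mono[OF wp_build_tables[OF k0]], goal_cases)
    case (1 t1 m1)
    note T1 = 1(1) and s1 = 1(2)
    have ok1: "input_ok m1" by (rule input_ok_same[OF ok0 s1]) (simp add: writes_build_tables)
    have res1: "nreg m1 ''res'' = 0" using s1 by (simp add: same_def writes_build_tables)
    show ?case
    proof (rule wp_mono[OF wp_init_labels[OF ok1]], goal_cases)
      case (1 t2 m2)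
      note T2 = 1(1) and s2 = 1(2)
      have ok2: "input_ok m2" by (rule input_ok_same[OF ok1 s2]) (simp add: writes_init_labels)
      have tab2: "tables_ok m2" using T1 by (intro tables_ok_same[OF _ s2]) (auto simp: writes_init_labels)
      have res2: "nreg m2 ''res'' = 0" using s2 res1 by (simp add: same_def writes_init_labels)
      have regs2: "nreg m2 ''k'' = k" "nreg m2 ''n'' = n" using ok2 by (auto simp: input_ok_def)
      show ?case
      proof (cases "0 < k")
        case False
        have "valid v ps \<Longrightarrow> ps = []" for v ps using valid_length[of v ps] False by simp
        then have "\<not> LS_Max_Cut {..<n} E \<omega> c \<chi> k" unfolding LS_iff_improvable_verts by blast
        then show ?thesis using False regs2 res2 T1 T2 by (simp add: wp_simps)
      next
        case True
        have "wp (For ''v'' (NConst 0) (NReg ''n'') search_root)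
          (\<lambda>t m'. t \<le> n * (root_cost + 8) + 6 \<and> nreg m' ''res'' \<le> 1 \<and> (nreg m' ''res'' = 1 \<longleftrightarrow> (\<exists>v<n. ?P v))) m2"
        proof (rule wp_For[where h = n and T = root_cost and I = "\<lambda>v m'. input_ok m' \<and> tables_ok m' \<and>
              (\<forall>u<n. narr m' ''lab'' u = \<chi> u) \<and> nreg m' ''res'' \<le> 1 \<and>
              (nreg m' ''res'' = 1 \<longleftrightarrow> (\<exists>v'<v. ?P v'))"], goal_cases)
          case 1
          show ?case
            using res2 T2 by (intro conjI input_ok_same[OF ok2, of "{NR ''v''}"] tables_ok_same[OF tab2, of "{NR ''v''}"])
              (auto simp: same_def)
        next
          case (2 v m')
          then show ?case by (simp add: input_ok_def)
        next
          case (4 v m')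
          then have inv: "input_ok m'" "tables_ok m'" "\<forall>u<n. narr m' ''lab'' u = \<chi> u" "nreg m' ''res'' \<le> 1"
            "nreg m' ''res'' = 1 \<longleftrightarrow> (\<exists>v'<v. ?P v')" by blast+
          show ?case
          proof (rule wp_mono[OF wp_search_root[OF 4(3,5) True inv(1-4)]], goal_cases)
            case (1 t m'')
            let ?m3 = "m''\<lparr>nreg := (nreg m'')(''v'' := Suc v)\<rparr>"
            have "input_ok ?m3" "tables_ok ?m3"
              using 1(1) input_ok_same[of m'' "{NR ''v''}" ?m3] tables_ok_same[of m'' "{NR ''v''}" ?m3]
              by (auto simp: same_def)
            moreover have "(\<exists>v'<Suc v. ?P v') \<longleftrightarrow> (\<exists>v'<v. ?P v') \<or> ?P v" by (auto simp: less_Suc_eq)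
            ultimately show ?case using 1(1) inv(5) root_cost_ge[OF 4(3)] by simp
          qed
        next
          case (5 t m')
          then show ?case by (simp add: add.commute)
        qed simp
        then have "wp (For ''v'' (NConst 0) (NReg ''n'') search_root)
          (\<lambda>t m'. t \<le> n * (root_cost + 8) + 6 \<and>
             nreg m' ''res'' = (if LS_Max_Cut {..<n} E \<omega> c \<chi> k then 1 else 0)) m2"
          unfolding LS_iff_improvable_verts by (rule wp_mono) auto
        then show ?thesis
          unfolding wp_Cond using True regs2 T1 T2 by (auto elim!: wp_mono)
      qed
    qed
  qed
qed

text \<open>Stated for any \<open>f\<close> with lists of the same lengths, so that it serves both
  the adjacency and the weight array.\<close>

lemma nth_concat_lists:
  assumes "v < n" "i < length (f v)" "\<And>u. length (f u) = length (nbrs u)"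
  shows "concat (map f [0..<n]) ! (off v + i) = f v ! i \<and> off v + i < length (concat (map f [0..<n]))"
proof -
  have len: "length (concat (map f [0..<v])) = off v" for v
    by (induction v) (simp_all add: off_def assms(3))
  have "[0..<n] = [0..<v] @ v # [Suc v..<n]"
    using assms(1) upt_add_eq_append[of 0 v "n - v"] upt_conv_Cons[of v n] by simp
  then have "concat (map f [0..<n]) = concat (map f [0..<v]) @ f v @ concat (map f [Suc v..<n])" by simp
  then show ?thesis using assms(2) len[of v] by (simp add: nth_append)
qed

lemma input_ok_input_mem: "input_ok (input_mem n nbrs \<omega> c \<chi> k)"
proof -
  have "narr (input_mem n nbrs \<omega> c \<chi> k) ''off'' v = off v" if "v \<le> n" for v
  proof -
    have "map (\<lambda>v. \<Sum>u<v. length (nbrs u)) [0..<n + 1] ! v = off v"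
      using that by (subst nth_map) (auto simp: off_def simp del: upt_Suc)
    then show ?thesis using that by (simp add: input_mem_def list_to_array_def del: upt_Suc)
  qed
  moreover have "narr (input_mem n nbrs \<omega> c \<chi> k) ''adj'' (off v + i) = nbrs v ! i"
    "rarr (input_mem n nbrs \<omega> c \<chi> k) ''wt'' (off v + i) = \<omega> {v, nbrs v ! i}"
    if "v < n" "i < length (nbrs v)" for v i
    using nth_concat_lists[of v i nbrs] nth_concat_lists[of v i "\<lambda>v. map (\<lambda>u. \<omega> {v, u}) (nbrs v)"] that
    by (simp_all add: input_mem_def list_to_array_def)
  moreover have "narr (input_mem n nbrs \<omega> c \<chi> k) ''col'' v = \<chi> v" if "v < n" for v
    using that by (simp add: input_mem_def list_to_array_def)
  moreover have "nreg (input_mem n nbrs \<omega> c \<chi> k) ''n'' = n" "nreg (input_mem n nbrs \<omega> c \<chi> k) ''c'' = c"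
    "nreg (input_mem n nbrs \<omega> c \<chi> k) ''k'' = k" by (simp_all add: input_mem_def)
  ultimately show ?thesis unfolding input_ok_def by blast
qed

text \<open>\<open>sum_valid_le\<close> brings \<open>D ^ k\<close>, and \<open>visit_cost\<close>
  the further \<open>D\<close>, \<open>c\<close> and \<open>k\<^sup>2\<close>. The maxima with 1 let
  the product absorb terms that lack some of its factors, such as \<open>k * 3 ^ k\<close> from
  building the tables.\<close>

lemma time_bound:
  "real (k * (90 * 3 ^ k) + n * 12 + n * (root_cost + 8) + 50) \<le>
    10000 * ((3 * exp 1) ^ k * (max 1 (real (max_degree {..<n} E) - 1)) ^ (k + 1) *
               max 1 (real c) * (max 1 (real k)) ^ 3 * max 1 (real n))"
proof -
  let ?X = "(3 * exp 1) ^ k :: real" and ?d = "real D" and ?c = "max 1 (real c)"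
    and ?k = "max 1 (real k)" and ?n = "max 1 (real n)"
  let ?Y = "?X * ?d ^ (k + 1) * ?c * ?k ^ 3"
  \<comment> \<open>Degree 0 gives -1 with real and 0 with truncated subtraction; the maximum with 1
    hides the difference.\<close>
  have d: "max 1 (real (max_degree {..<n} E) - 1) = ?d" by (auto simp: D_def max_def)
  have e: "1 \<le> exp (1::real)" by simp
  have X3: "3 ^ k \<le> ?X" using e by (intro power_mono) auto
  have X1: "1 \<le> ?X" using X3 one_le_power[of "3::real" k] by linarith
  have d1: "1 \<le> ?d" using D_pos by simp
  have dk1: "1 \<le> ?d ^ (k + 1)" using d1 by (rule one_le_power)
  have dk: "?d \<le> ?d ^ (k + 1)" using d1 by simp
  have k3: "?k ^ 1 \<le> ?k ^ 3" "?k ^ 2 \<le> ?k ^ 3" by (rule power_increasing; simp)+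
  have k2: "real k ^ 2 \<le> ?k ^ 2" by (intro power_mono) auto
  have k1: "real k \<le> ?k ^ 3" using k3(1) unfolding power_one_right by linarith
  have Y1: "1 \<le> ?Y"
    using d1 by (intro mult_ge1_I X1 one_le_power) auto
  have a: "real k * 3 ^ k \<le> ?Y"
  proof -
    have "real k * 3 ^ k = 3 ^ k * 1 * 1 * real k" by simp
    also have "\<dots> \<le> ?Y" by (intro mult_mono X3 dk1 k1) auto
    finally show ?thesis .
  qed
  have b: "real (D * k) \<le> ?Y"
  proof -
    have "real (D * k) = 1 * ?d * 1 * real k" by simp
    also have "\<dots> \<le> ?Y" by (intro mult_mono X1 dk k1) auto
    finally show ?thesis .
  qed
  have v: "6 * real visit_cost * ?X * ?d ^ k \<le> 4200 * ?Y"
  proof -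
    have "6 * real visit_cost * ?X * ?d ^ k = 4200 * (?X * ?d ^ (k + 1) * real c * real k ^ 2)"
      by (simp add: visit_cost_def ac_simps)
    also have "\<dots> \<le> 4200 * ?Y"
      by (intro mult_mono order_trans[OF k2 k3(2)]) auto
    finally show ?thesis .
  qed
  define F where "F = nat \<lfloor>6 * real visit_cost * ?X * ?d ^ k\<rfloor>"
  have "real F \<le> 6 * real visit_cost * ?X * ?d ^ k"
    unfolding F_def by (rule of_nat_floor) simp
  moreover have "real root_cost = real F + 40 * real (D * k) + 102"
    unfolding root_cost_def F_def[symmetric] by simp
  \<comment> \<open>4200, 40 and 122 stay below 5000. The 20 gathers, per vertex, 12 for its initial
    label and 8 for the loop over roots.\<close>
  ultimately have root: "real root_cost + 20 \<le> 5000 * ?Y"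
    using v b Y1 by linarith
  have n1: "real n * (real root_cost + 20) \<le> ?n * (5000 * ?Y)"
    using root by (intro mult_mono) auto
  have "1 * ?Y \<le> ?n * ?Y" using Y1 by (intro mult_right_mono) auto
  then have n2: "?Y \<le> ?n * ?Y" unfolding mult_1 .
  have "real (k * (90 * 3 ^ k) + n * 12 + n * (root_cost + 8) + 50) =
    90 * (real k * 3 ^ k) + real n * (real root_cost + 20) + 50" by (simp add: algebra_simps)
  also have "\<dots> \<le> 10000 * (?n * ?Y)" using a n1 n2 Y1 by linarith
  finally show ?thesis unfolding d by (simp add: ac_simps)
qed

end

theorem theorem5:
  "\<exists>(P :: com) (C :: real).
     \<forall>(n :: nat) (E :: nat set set) (nbrs :: nat \<Rightarrow> nat list) (\<omega> :: nat set \<Rightarrow> rat)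
       (c :: nat) (\<chi> :: nat \<Rightarrow> nat) (k :: nat).
       simple_graph {..<n} E \<longrightarrow> adjacency_lists n E nbrs \<longrightarrow> coloring {..<n} c \<chi> \<longrightarrow>
       decides_within P (input_mem n nbrs \<omega> c \<chi> k) (LS_Max_Cut {..<n} E \<omega> c \<chi> k)
         (C * ((3 * exp 1) ^ k * (max 1 (real (max_degree {..<n} E) - 1)) ^ (k + 1) *
               max 1 (real c) * (max 1 (real k)) ^ 3 * max 1 (real n)))"
proof (intro exI[of _ program] exI[of _ 10000] allI impI)
  fix n E nbrs \<omega> c \<chi> k
  assume "simple_graph {..<n} E" "adjacency_lists n E nbrs" "coloring {..<n} c \<chi>"
  then interpret cut_instance n E nbrs \<omega> c \<chi> k by unfold_locales
  from wp_program[OF input_ok_input_mem] obtain t m' where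
    "exec program (input_mem n nbrs \<omega> c \<chi> k) t m'"
    "t \<le> k * (90 * 3 ^ k) + n * 12 + n * (root_cost + 8) + 50"
    "nreg m' ''res'' = (if LS_Max_Cut {..<n} E \<omega> c \<chi> k then 1 else 0)"
    unfolding wp_def by blast
  then show "decides_within program (input_mem n nbrs \<omega> c \<chi> k) (LS_Max_Cut {..<n} E \<omega> c \<chi> k)
    (10000 * ((3 * exp 1) ^ k * (max 1 (real (max_degree {..<n} E) - 1)) ^ (k + 1) *
               max 1 (real c) * (max 1 (real k)) ^ 3 * max 1 (real n)))"
    unfolding decides_within_def using time_bound by (meson of_nat_mono order_trans)
qed

end
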